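(* There exists a step-two Carnot group $\mathbb{G}$, equipped with the left-invariant sub-Riemannian structure determined by an inner product on the first layer of its Lie algebra, which is ideal and satisfies $N_{\mathrm{CE}} > N_0$, where $N_{\mathrm{CE}}$ is the curvature exponent of $\mathbb{G}$ and $N_0 = \sup\{N(p) : p \in \mathfrak{g},\ N(p) < \infty\}$.
   Context: **Step-two Carnot groups.** A step-two Carnot group is a connected, simply connected Lie group $\mathbb{G}$ whose (finite-dimensional, real) Lie algebra $\mathfrak{g}$ admits a stratification $\mathfrak{g} = \mathfrak{g}_1 \oplus \mathfrak{g}_2$ with $[\mathfrak{g}_1,\mathfrak{g}_1] = \mathfrak{g}_2 \neq \{0\}$ and $[\mathfrak{g}_1,\mathfrak{g}_2]=\{0\}$ (and $[\mathfrak{g}_2,\mathfrak{g}_2]=\{0\}$). Via the exponential map, $\mathbb{G}$ is identified with $\mathfrak{g}$ with group law $a * b = a + b + \frac12 [a,b]$; the identity is $0$. Write $m = \dim \mathfrak{g}_1$, $n = \dim\mathfrak{g}_1 + \dim \mathfrak{g}_2$, $Q = \dim \mathfrak{g}_1 + 2\dim\mathfrak{g}_2$. **Sub-Riemannian structure.** Fix an inner product $\langle\cdot,\cdot\rangle$ on $\mathfrak{g}_1$. The horizontal distribution $\mathcal{D}$ is the left-invariant sub-bundle of $T\mathbb{G}$ generated by $\mathfrak{g}_1$, with the left-invariant metric $g$ on $\mathcal{D}$ induced by $\langle\cdot,\cdot\rangle$. An absolutely continuous path $\gamma:[0,1]\to\mathbb{G}$ is horizontal if $\dot\gamma(s)\in\mathcal{D}_{\gamma(s)}$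 for a.e. $s$; its length is $\ell(\gamma)=\int_0^1 \sqrt{g(\dot\gamma,\dot\gamma)}\,d\tau$. The Carnot–Carathéodory distance $d(p,q)$ is the infimum of $\ell(\gamma)$ over horizontal $\gamma$ with $\gamma(0)=p$, $\gamma(1)=q$; it is finite and induces the manifold topology. A length minimizing geodesic is a horizontal path $\gamma$ with $\ell(\gamma)=d(\gamma(0),\gamma(1))$, parametrized with constant speed. Let $\mu$ be a Haar measure on $\mathbb{G}$ (the push-forward of Lebesgue measure on $\mathfrak{g}$); the choice of normalization is irrelevant. **Ideal.** For $p \in \mathbb{G}$ the endpoint map $E_p : L^2([0,1],\mathfrak{g}_1)\to\mathbb{G}$ sends a control $u$ to $\gamma_u(1)$, where $\gamma_u(0)=p$ and $\dot\gamma_u(t) = DL_{\gamma_u(t)}(e)\,u(t)$ for a.e. $t$ ($L_q$ is left translation by $q$, $e$ the identity). A horizontal path $\gamma_u$ is abnormal if $u$ is a critical point of $E_p$ (the differential of $E_p$ at $u$ is not surjective). $\mathbb{G}$ is ideal if it has no non-trivial (i.e. non-constant) abnormal length minimizing geodesics. **Curvature exponent.** On a step-two Carnot group, for every $x\in\mathbb{G}$ there is a $\mu$-negligible set $\mathcal{C}(x)$ and a measurable map $\Phi^x : (\mathbb{G}\setminus\mathcal{C}(x))\times[0,1]\to\mathbb{G}$ such that for every $y\in\mathbb{G}\setminus\mathcal{C}(x)$ the curve $t\mapsto\Phi^x(y,t)$ is the unique length minimizing geodesic from $x$ to $y$. For measurable $A\subset \mathbb{G}$ and $s\in[0,1]$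 set $Z_s(x,A) = \{\Phi^x(y,s) : y\in A\setminus\mathcal{C}(x)\}$. The curvature exponent $N_{\mathrm{CE}}$ is the minimum of all $N$ such that the measure contraction property $\mathrm{MCP}(0,N)$ holds, i.e. such that for every $p\in\mathbb{G}$ and every measurable $A\subset\mathbb{G}$ with $0<\mu(A)<\infty$, $$\mu(Z_s(p,A)) \ge s^N\mu(A)\qquad \text{for all } s\in[0,1].$$ (This minimum exists and is finite on every step-two Carnot group.) **The number $N_0$.** Extend $\langle\cdot,\cdot\rangle$ to an inner product on $\mathfrak{g}$ for which $\mathfrak{g}_1\perp\mathfrak{g}_2$ ($N_0$ does not depend on the extension). For $u\in\mathfrak{g}_2$ let $J_u:\mathfrak{g}_1\to\mathfrak{g}_1$ be the linear map with $\langle u,[v,w]\rangle = \langle J_u v, w\rangle$ for all $v,w\in\mathfrak{g}_1$. For $p=\xi+u\in\mathfrak{g}$ with $\xi\in\mathfrak{g}_1$, $u\in\mathfrak{g}_2$, put $U^0(p)=\{0\}$, $U^\ell(p)=\mathrm{span}\{\xi,J_u\xi,\dots,J_u^{\ell-1}\xi\}$ for $\ell\ge1$, and $U_\ell(p)=\{v\in\mathfrak{g}_2 : J_v(U^\ell(p))=\{0\}\}$ for $\ell\ge0$. Let $W_\ell(p)$ be the orthogonal complement of $U_{\ell+1}(p)$ in $U_\ell(p)$ for $\ell \geq 0$, and $W_\infty(p)=\{v\in\mathfrak{g}_2 : J_v(J_u^\ell\xi)=0 \text{ for all } \ell\ge0\}$. Define $$N(p)=\begin{cases}2Q-n+2\sum_{\ell=0}^\infty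 \ell\,\dim W_\ell(p), & W_\infty(p)=\{0\},\\ \infty, & W_\infty(p)\ne\{0\},\end{cases}$$ and $N_0=\sup\{N(p): p\in\mathfrak{g},\ N(p)<\infty\}$. *)

theory Defs
  imports "HOL-Analysis.Analysis" "HOL-Library.Function_Algebras"
begin

text \<open>
  Dimensions vary inside the statement, so \<open>\<real>\<^sup>n\<close> is the library's
  \<^term>\<open>topspace (Euclidean_space n)\<close>, the linear subspace of \<^typ>\<open>nat \<Rightarrow> real\<close> of all
  sequences that vanish from index \<open>n\<close> on.  With the pointwise vector space structure on functions
  the library notions \<^const>\<open>subspace\<close>, \<^const>\<open>span\<close> and \<^const>\<open>dim\<close> apply to it.
\<close>

instantiation "fun" :: (type, real_vector) real_vector
begin

definition scaleR_fun :: "real \<Rightarrow> ('a \<Rightarrow> 'b) \<Rightarrow> 'a \<Rightarrow> 'b"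
  where "scaleR_fun c f = (\<lambda>x. c *\<^sub>R f x)"

instance
  by standard (auto simp: scaleR_fun_def fun_eq_iff scaleR_add_right scaleR_add_left)

end

type_synonym rvec = "nat \<Rightarrow> real"

subsection \<open>Step-two Carnot groups\<close>

text \<open>
  The Lie algebra has underlying vector space \<open>\<real>\<^sup>n\<close> with \<open>n = vdim G\<close>; bracket and layers are
  arbitrary.  The field \<open>inp\<close> is an inner product on the whole algebra that makes the layers
  orthogonal, i.e. an inner product on the first layer together with a choice of extension.  The
  sub-Riemannian notions use it on \<open>layer1 G\<close> only; the extension enters only \<open>Jmap\<close> and \<open>Wspace\<close>
  below, and the resulting number \<open>N_zero\<close> does not depend on it.
\<close>

record carnot_data =
  vdim :: nat
  layer1 :: "rvec set"
  layer2 :: "rvec set"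
  lie :: "rvec \<Rightarrow> rvec \<Rightarrow> rvec"
  inp :: "rvec \<Rightarrow> rvec \<Rightarrow> real"

definition alg :: "carnot_data \<Rightarrow> rvec set"
  where "alg G = topspace (Euclidean_space (vdim G))"

definition lie_algebra :: "carnot_data \<Rightarrow> bool"
  where "lie_algebra G \<longleftrightarrow>
    (\<forall>x\<in>alg G. \<forall>y\<in>alg G. lie G x y \<in> alg G) \<and>
    (\<forall>x\<in>alg G. \<forall>y\<in>alg G. \<forall>z\<in>alg G. \<forall>a b.
       lie G (a *\<^sub>R x + b *\<^sub>R y) z = a *\<^sub>R lie G x z + b *\<^sub>R lie G y z \<and>
       lie G z (a *\<^sub>R x + b *\<^sub>R y) = a *\<^sub>R lie G z x + b *\<^sub>R lie G z y) \<and>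
    (\<forall>x\<in>alg G. lie G x x = 0) \<and>
    (\<forall>x\<in>alg G. \<forall>y\<in>alg G. \<forall>z\<in>alg G.
       lie G x (lie G y z) + lie G y (lie G z x) + lie G z (lie G x y) = 0)"

definition stratification :: "carnot_data \<Rightarrow> bool"
  where "stratification G \<longleftrightarrow>
    subspace (layer1 G) \<and> subspace (layer2 G) \<and>
    alg G = {v + w |v w. v \<in> layer1 G \<and> w \<in> layer2 G} \<and> layer1 G \<inter> layer2 G = {0} \<and>
    span {lie G v w |v w. v \<in> layer1 G \<and> w \<in> layer1 G} = layer2 G \<and> layer2 G \<noteq> {0} \<and>
    (\<forall>v\<in>layer1 G. \<forall>w\<in>layer2 G. lie G v w = 0) \<and>
    (\<forall>v\<in>layer2 G. \<forall>w\<in>layer2 G. lie G v w = 0)"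

definition adapted_inner_product :: "carnot_data \<Rightarrow> bool"
  where "adapted_inner_product G \<longleftrightarrow>
    (\<forall>x\<in>alg G. \<forall>y\<in>alg G. inp G x y = inp G y x) \<and>
    (\<forall>x\<in>alg G. \<forall>y\<in>alg G. \<forall>z\<in>alg G. \<forall>a b.
       inp G (a *\<^sub>R x + b *\<^sub>R y) z = a * inp G x z + b * inp G y z) \<and>
    (\<forall>x\<in>alg G. x \<noteq> 0 \<longrightarrow> inp G x x > 0) \<and>
    (\<forall>v\<in>layer1 G. \<forall>w\<in>layer2 G. inp G v w = 0)"

definition step_two_carnot :: "carnot_data \<Rightarrow> bool"
  where "step_two_carnot G \<longleftrightarrow> lie_algebra G \<and> stratification G \<and> adapted_inner_product G"

definition gmul :: "carnot_data \<Rightarrow> rvec \<Rightarrow> rvec \<Rightarrow> rvec"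
  where "gmul G a b = a + b + (1/2) *\<^sub>R lie G a b"

text \<open>The differential at the identity of the (affine) left translation by \<open>q\<close>.\<close>

definition ldiff :: "carnot_data \<Rightarrow> rvec \<Rightarrow> rvec \<Rightarrow> rvec"
  where "ldiff G q v = v + (1/2) *\<^sub>R lie G q v"

lemma ldiff_is_derivative:
  assumes "lie_algebra G" "q \<in> alg G" "v \<in> alg G"
  shows "((\<lambda>t. gmul G q (t *\<^sub>R v) i) has_real_derivative ldiff G q v i) (at 0)"
proof -
  have "lie G q (t *\<^sub>R v + 0 *\<^sub>R v) = t *\<^sub>R lie G q v + 0 *\<^sub>R lie G q v" for t
    using assms unfolding lie_algebra_def by blast
  then have "lie G q (t *\<^sub>R v) = t *\<^sub>R lie G q v" for t
    by simp
  then have "(\<lambda>t. gmul G q (t *\<^sub>R v) i) = (\<lambda>t. q i + t * v i + (1/2) * (t * lie G q v i))"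
    unfolding gmul_def by (simp add: fun_eq_iff) (simp add: scaleR_fun_def)
  then show ?thesis
    by (auto simp: ldiff_def scaleR_fun_def intro!: derivative_eq_intros)
qed

subsection \<open>Horizontal paths and the Carnot--Caratheodory distance\<close>

definition abs_cont :: "(real \<Rightarrow> real) \<Rightarrow> bool"
  where "abs_cont f \<longleftrightarrow> (\<forall>\<epsilon>>0. \<exists>\<delta>>0. \<forall>(N::nat) a b.
     (\<forall>k<N. 0 \<le> a k \<and> a k \<le> b k \<and> b k \<le> 1) \<and>
     (\<forall>j<N. \<forall>k<N. j \<noteq> k \<longrightarrow> {a j<..<b j} \<inter> {a k<..<b k} = {}) \<and>
     (\<Sum>k<N. b k - a k) < \<delta> \<longrightarrow> (\<Sum>k<N. \<bar>f (b k) - f (a k)\<bar>) < \<epsilon>)"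

text \<open>A path in \<open>G\<close> is a function on \<^typ>\<open>real\<close> of which only the values on \<open>{0..1}\<close> matter.\<close>

definition ac_path :: "carnot_data \<Rightarrow> (real \<Rightarrow> rvec) \<Rightarrow> bool"
  where "ac_path G \<gamma> \<longleftrightarrow> (\<forall>t\<in>{0..1}. \<gamma> t \<in> alg G) \<and> (\<forall>i. abs_cont (\<lambda>t. \<gamma> t i))"

definition has_velocity :: "(real \<Rightarrow> rvec) \<Rightarrow> rvec \<Rightarrow> real \<Rightarrow> bool"
  where "has_velocity \<gamma> w t \<longleftrightarrow>
    (\<forall>i. ((\<lambda>s. \<gamma> s i) has_real_derivative w i) (at t within {0..1}))"

definition horizontal :: "carnot_data \<Rightarrow> (real \<Rightarrow> rvec) \<Rightarrow> bool"
  where "horizontal G \<gamma> \<longleftrightarrow> ac_path G \<gamma> \<and>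
    (AE t in lebesgue_on {0..1}. \<exists>v\<in>layer1 G. has_velocity \<gamma> (ldiff G (\<gamma> t) v) t)"

text \<open>
  The velocity of a horizontal path, translated back to the first layer; by left-invariance
  \<open>g(\<gamma>', \<gamma>')\<close> is the inner product of this vector with itself.
\<close>

definition hvel :: "carnot_data \<Rightarrow> (real \<Rightarrow> rvec) \<Rightarrow> real \<Rightarrow> rvec"
  where "hvel G \<gamma> t = (THE v. v \<in> layer1 G \<and> has_velocity \<gamma> (ldiff G (\<gamma> t) v) t)"

definition speed :: "carnot_data \<Rightarrow> (real \<Rightarrow> rvec) \<Rightarrow> real \<Rightarrow> real"
  where "speed G \<gamma> t = sqrt (inp G (hvel G \<gamma> t) (hvel G \<gamma> t))"

definition path_len :: "carnot_data \<Rightarrow> (real \<Rightarrow> rvec) \<Rightarrow> real"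
  where "path_len G \<gamma> = integral\<^sup>L (lebesgue_on {0..1}) (speed G \<gamma>)"

definition cc_dist :: "carnot_data \<Rightarrow> rvec \<Rightarrow> rvec \<Rightarrow> real"
  where "cc_dist G p q = Inf {path_len G \<gamma> |\<gamma>. horizontal G \<gamma> \<and> \<gamma> 0 = p \<and> \<gamma> 1 = q}"

definition min_geodesic :: "carnot_data \<Rightarrow> (real \<Rightarrow> rvec) \<Rightarrow> bool"
  where "min_geodesic G \<gamma> \<longleftrightarrow> horizontal G \<gamma> \<and> path_len G \<gamma> = cc_dist G (\<gamma> 0) (\<gamma> 1) \<and>
    (\<exists>c. AE t in lebesgue_on {0..1}. speed G \<gamma> t = c)"

subsection \<open>Abnormal paths and ideal groups\<close>

definition L2_control :: "carnot_data \<Rightarrow> (real \<Rightarrow> rvec) set"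
  where "L2_control G = {u. (\<forall>t\<in>{0..1}. u t \<in> layer1 G) \<and>
    (\<forall>i. (\<lambda>t. u t i) \<in> borel_measurable (lebesgue_on {0..1})) \<and>
    integrable (lebesgue_on {0..1}) (\<lambda>t. inp G (u t) (u t))}"

definition L2_norm :: "carnot_data \<Rightarrow> (real \<Rightarrow> rvec) \<Rightarrow> real"
  where "L2_norm G u = sqrt (integral\<^sup>L (lebesgue_on {0..1}) (\<lambda>t. inp G (u t) (u t)))"

definition steers :: "carnot_data \<Rightarrow> rvec \<Rightarrow> (real \<Rightarrow> rvec) \<Rightarrow> (real \<Rightarrow> rvec) \<Rightarrow> bool"
  where "steers G p u \<gamma> \<longleftrightarrow> ac_path G \<gamma> \<and> \<gamma> 0 = p \<and>
    (AE t in lebesgue_on {0..1}. has_velocity \<gamma> (ldiff G (\<gamma> t) (u t)) t)"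

definition endpoint :: "carnot_data \<Rightarrow> rvec \<Rightarrow> (real \<Rightarrow> rvec) \<Rightarrow> rvec"
  where "endpoint G p u = (THE q. \<exists>\<gamma>. steers G p u \<gamma> \<and> \<gamma> 1 = q)"

text \<open>
  \<open>D\<close> is the Frechet differential at \<open>u\<close> of the endpoint map from \<open>L\<^sup>2([0,1], layer1 G)\<close>; controls are
  represented by functions, and the finitely many nonzero coordinates serve as norm on the target.
\<close>

definition has_endpoint_differential ::
    "carnot_data \<Rightarrow> rvec \<Rightarrow> (real \<Rightarrow> rvec) \<Rightarrow> ((real \<Rightarrow> rvec) \<Rightarrow> rvec) \<Rightarrow> bool"
  where "has_endpoint_differential G p u D \<longleftrightarrow>
    (\<forall>v\<in>L2_control G. D v \<in> alg G) \<and>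
    (\<forall>v\<in>L2_control G. \<forall>w\<in>L2_control G. \<forall>a b. D (a *\<^sub>R v + b *\<^sub>R w) = a *\<^sub>R D v + b *\<^sub>R D w) \<and>
    (\<exists>B. \<forall>v\<in>L2_control G. \<forall>i. \<bar>D v i\<bar> \<le> B * L2_norm G v) \<and>
    (\<forall>\<epsilon>>0. \<exists>\<delta>>0. \<forall>v\<in>L2_control G. L2_norm G v < \<delta> \<longrightarrow>
       (\<forall>i. \<bar>endpoint G p (u + v) i - endpoint G p u i - D v i\<bar> \<le> \<epsilon> * L2_norm G v))"

definition critical_control :: "carnot_data \<Rightarrow> rvec \<Rightarrow> (real \<Rightarrow> rvec) \<Rightarrow> bool"
  where "critical_control G p u \<longleftrightarrow>
    \<not> (\<exists>D. has_endpoint_differential G p u D \<and> D ` L2_control G = alg G)"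

definition abnormal :: "carnot_data \<Rightarrow> (real \<Rightarrow> rvec) \<Rightarrow> bool"
  where "abnormal G \<gamma> \<longleftrightarrow>
    (\<exists>u\<in>L2_control G. steers G (\<gamma> 0) u \<gamma> \<and> critical_control G (\<gamma> 0) u)"

definition ideal_group :: "carnot_data \<Rightarrow> bool"
  where "ideal_group G \<longleftrightarrow>
    \<not> (\<exists>\<gamma>. min_geodesic G \<gamma> \<and> abnormal G \<gamma> \<and> \<not> (\<forall>t\<in>{0..1}. \<gamma> t = \<gamma> 0))"

subsection \<open>The curvature exponent\<close>

definition embed :: "nat \<Rightarrow> rvec \<Rightarrow> rvec"
  where "embed n x = (\<lambda>i. if i < n then x i else 0)"

text \<open>
  Lebesgue measure on \<open>\<real>\<^sup>n\<close>; \<^const>\<open>Pi\<^sub>M\<close> lives on functions that are undefined outside the index set,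
  whence the change of representation by \<^const>\<open>embed\<close>.
\<close>

definition haar :: "carnot_data \<Rightarrow> rvec measure"
  where "haar G = completion (distr (\<Pi>\<^sub>M i\<in>{..<vdim G}. lborel) borel (embed (vdim G)))"

lemma measurable_embed: "embed n \<in> (\<Pi>\<^sub>M i\<in>{..<n}. lborel) \<rightarrow>\<^sub>M borel"
proof (rule measurable_coordinatewise_then_product)
  fix i show "(\<lambda>x. embed n x i) \<in> borel_measurable (\<Pi>\<^sub>M i\<in>{..<n}. lborel)"
    by (cases "i < n") (auto simp: embed_def)
qed

definition geodesic_selection ::
    "carnot_data \<Rightarrow> (rvec \<Rightarrow> rvec set) \<Rightarrow> (rvec \<Rightarrow> rvec \<Rightarrow> real \<Rightarrow> rvec) \<Rightarrow> bool"
  where "geodesic_selection G C \<Phi> \<longleftrightarrow> (\<forall>x\<in>alg G.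
    C x \<subseteq> alg G \<and> C x \<in> null_sets (haar G) \<and>
    (\<lambda>(y, t). \<Phi> x y t) \<in>
      restrict_space (haar G \<Otimes>\<^sub>M lebesgue) ((alg G - C x) \<times> {0..1}) \<rightarrow>\<^sub>M borel \<and>
    (\<forall>y\<in>alg G - C x.
       min_geodesic G (\<Phi> x y) \<and> \<Phi> x y 0 = x \<and> \<Phi> x y 1 = y \<and>
       (\<forall>\<gamma>. min_geodesic G \<gamma> \<and> \<gamma> 0 = x \<and> \<gamma> 1 = y \<longrightarrow> (\<forall>t\<in>{0..1}. \<gamma> t = \<Phi> x y t))))"

definition Zset ::
    "(rvec \<Rightarrow> rvec set) \<Rightarrow> (rvec \<Rightarrow> rvec \<Rightarrow> real \<Rightarrow> rvec) \<Rightarrow> real \<Rightarrow> rvec \<Rightarrow> rvec set \<Rightarrow> rvec set"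
  where "Zset C \<Phi> s x A = {\<Phi> x y s |y. y \<in> A - C x}"

text \<open>
  A selection exists on every step-two Carnot group, and the property below does not depend on it:
  replacing \<open>A\<close> by \<open>A - (C x \<union> C' x)\<close> does not change its measure.  The outer measure agrees with
  the Haar measure on measurable sets and spares us the convention that non-measurable sets have
  \<^const>\<open>emeasure\<close> zero.
\<close>

definition MCP0 :: "carnot_data \<Rightarrow> real \<Rightarrow> bool"
  where "MCP0 G N \<longleftrightarrow> (\<exists>C \<Phi>. geodesic_selection G C \<Phi> \<and>
    (\<forall>p\<in>alg G. \<forall>A\<in>sets (haar G). A \<subseteq> alg G \<and> 0 < emeasure (haar G) A \<and> emeasure (haar G) A < \<infinity> \<longrightarrow>
      (\<forall>s\<in>{0..1}. outer_measure_of (haar G) (Zset C \<Phi> s p A)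
         \<ge> ennreal (s powr N) * emeasure (haar G) A)))"

text \<open>
  The set of admissible exponents is closed, so the infimum is the minimum (which is finite on every
  step-two Carnot group).
\<close>

definition N_CE :: "carnot_data \<Rightarrow> ereal"
  where "N_CE G = Inf {ereal N |N. MCP0 G N}"

subsection \<open>The number \<open>N\<^sub>0\<close>\<close>

definition Jmap :: "carnot_data \<Rightarrow> rvec \<Rightarrow> rvec \<Rightarrow> rvec"
  where "Jmap G u v = (THE z. z \<in> layer1 G \<and> (\<forall>w\<in>layer1 G. inp G u (lie G v w) = inp G z w))"

definition comp1 :: "carnot_data \<Rightarrow> rvec \<Rightarrow> rvec"
  where "comp1 G p = (THE \<xi>. \<xi> \<in> layer1 G \<and> p - \<xi> \<in> layer2 G)"

definition comp2 :: "carnot_data \<Rightarrow> rvec \<Rightarrow> rvec"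
  where "comp2 G p = p - comp1 G p"

definition Uup :: "carnot_data \<Rightarrow> rvec \<Rightarrow> nat \<Rightarrow> rvec set"
  where "Uup G p l = span {(Jmap G (comp2 G p) ^^ k) (comp1 G p) |k. k < l}"

definition Ulow :: "carnot_data \<Rightarrow> rvec \<Rightarrow> nat \<Rightarrow> rvec set"
  where "Ulow G p l = {v \<in> layer2 G. \<forall>x\<in>Uup G p l. Jmap G v x = 0}"

definition Wspace :: "carnot_data \<Rightarrow> rvec \<Rightarrow> nat \<Rightarrow> rvec set"
  where "Wspace G p l = {v \<in> Ulow G p l. \<forall>w\<in>Ulow G p (Suc l). inp G v w = 0}"

definition Winf :: "carnot_data \<Rightarrow> rvec \<Rightarrow> rvec set"
  where "Winf G p =
    {v \<in> layer2 G. \<forall>l. Jmap G v ((Jmap G (comp2 G p) ^^ l) (comp1 G p)) = 0}"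

definition top_dim :: "carnot_data \<Rightarrow> nat"
  where "top_dim G = dim (layer1 G) + dim (layer2 G)"

definition hom_dim :: "carnot_data \<Rightarrow> nat"
  where "hom_dim G = dim (layer1 G) + 2 * dim (layer2 G)"

text \<open>All but finitely many terms of the series vanish, since \<open>Ulow G p\<close> is eventually constant.\<close>

definition N_at :: "carnot_data \<Rightarrow> rvec \<Rightarrow> ereal"
  where "N_at G p =
    (if Winf G p = {0}
     then ereal (2 * real (hom_dim G) - real (top_dim G)
            + 2 * (\<Sum>l. real l * real (dim (Wspace G p l))))
     else \<infinity>)"

definition N_zero :: "carnot_data \<Rightarrow> ereal"
  where "N_zero G = Sup {N_at G p |p. p \<in> alg G \<and> N_at G p < \<infinity>}"

end

theory Submission
  imports Defs
begin

text \<open>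
  The witness has first layer \<open>\<complex>\<^sup>2\<close> and centre \<open>\<real>\<^sup>2\<close>; its bracket is given by two skew maps
  \<open>J1 (a, b) = (\<i> a, - \<i> b)\<close> and \<open>J2 (a, b) = (\<i> a - 2 b, \<i> b + 2 a)\<close>.  Every nontrivial combination
  \<open>J w = w\<^sub>1 J1 + w\<^sub>2 J2\<close> is invertible (\<open>J_eq_0_iff\<close>).  Hence the endpoint map is a submersion at
  every control with nonconstant trajectory (\<open>dend_surjective\<close>), so the group is ideal; and all spaces
  \<open>W\<^sub>l(p)\<close> with \<open>l \<ge> 1\<close> vanish once \<open>p\<close> has a horizontal part, while \<open>N(p) = \<infinity>\<close> for central \<open>p\<close>.
  Therefore \<open>N\<^sub>0 \<le> 2 Q - n = 10\<close> (\<open>N_zero_G0\<close>).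

  It remains to bound the curvature exponent away from 10 from below.  To this end a small set of
  endpoints of geodesics issuing from the identity is compared with the set of their midpoints.
  A geodesic with parameter interval \<open>[-\<theta>, \<theta>]\<close> is described by its velocity \<open>\<eta>\<close> at the middle and by its
  constant covector \<open>\<tau>\<close>; the velocity solves \<open>v' = J \<tau> v\<close>.  Since Taylor expansion about the middle
  cancels every second term, the endpoint is, with \<open>s = 2 \<theta>\<close> and up to a factor \<open>1 + O(\<theta>\<^sup>2)\<close> in
  volume, the image of \<open>(\<eta>, \<tau>)\<close> under the model map
  \<open>(\<eta>, \<tau>) \<mapsto> (s \<eta>, (s\<^sup>3/12) [\<eta>, J \<tau> \<eta>])\<close>, whose Jacobian is \<open>(s\<^sup>1\<^sup>0/144) gram \<eta>\<close>, where \<open>gram \<eta>\<close> is the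
  Gram determinant of \<open>J1 \<eta>\<close> and \<open>J2 \<eta>\<close>.  The first half of the geodesic is a geodesic of the same
  kind with \<open>s = \<theta>\<close>; its own middle velocity is \<open>\<eta>\<close> transported by the flow of \<open>J \<tau>\<close> for time
  \<open>- \<theta>/2\<close>.  Thus the powers of \<open>s\<close> account for a contraction by exactly \<open>2\<^sup>-\<^sup>1\<^sup>0\<close>, and the
  remaining factor is the ratio of the values of \<open>gram\<close> at the transported velocity and at \<open>\<eta>\<close>.

  In a group of Heisenberg type \<open>gram \<eta> = |\<eta>|\<^sup>4\<close> would be constant along the flow and nothing would be
  gained.  Here \<open>gram\<close> varies at first order: along the orbit of the base point it is
  \<open>20 - 16 sin \<theta>\<close> against \<open>20\<close> (\<open>gram_turn_base\<close>), and this beats the errors \<open>O(\<theta>\<^sup>2)\<close>.  For small \<open>\<theta>\<close>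
  the set of midpoints therefore has at most \<open>\<rho> 2\<^sup>-\<^sup>1\<^sup>0\<close> times the volume of the set of endpoints, for
  some \<open>\<rho> < 1\<close> (\<open>volume_drop\<close>), and every admissible exponent is at least \<open>10 - log\<^sub>2 \<rho>\<close>
  (\<open>MCP0_exponent_bound\<close>).

  Two analytic facts carry this argument.  Short normal extremals are minimal among all absolutely
  continuous horizontal paths, by a calibration (\<open>normal_extremal_length_le\<close>).  And volumes are compared
  through Lipschitz constants (\<open>measure_Lipschitz_image_le\<close>) and slices (\<open>measure_le_slices\<close>), which
  replaces the differentiability and the six-dimensional Jacobian of the exponential map by estimates
  for differences.
\<close>

section \<open>Absolutely continuous curves\<close>

text \<open>
  The index set is arbitrary, because the tags and intervals of a tagged division index such families.
\<close>

definition nonoverlapping :: "'i set \<Rightarrow> ('i \<Rightarrow> real) \<Rightarrow> ('i \<Rightarrow> real) \<Rightarrow> bool"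
  where "nonoverlapping I a b \<longleftrightarrow> finite I \<and> (\<forall>k\<in>I. 0 \<le> a k \<and> a k \<le> b k \<and> b k \<le> 1) \<and>
     (\<forall>j\<in>I. \<forall>k\<in>I. j \<noteq> k \<longrightarrow> {a j<..<b j} \<inter> {a k<..<b k} = {})"

text \<open>
  The smallness condition of absolute continuity for an arbitrary weight \<open>d s t\<close> of the interval from
  \<open>s\<close> to \<open>t\<close>.  With a free weight, all closure properties of absolutely continuous curves reduce to
  domination of one weight by others.
\<close>

definition ac_mod :: "(real \<Rightarrow> real \<Rightarrow> real) \<Rightarrow> bool"
  where "ac_mod d \<longleftrightarrow> (\<forall>\<epsilon>>0. \<exists>\<delta>>0. \<forall>(N::nat) a b.
     nonoverlapping {..<N} a b \<and> (\<Sum>k<N. b k - a k) < \<delta> \<longrightarrow> (\<Sum>k<N. d (a k) (b k)) < \<epsilon>)"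

definition ac :: "(real \<Rightarrow> 'a::real_normed_vector) \<Rightarrow> bool"
  where "ac f \<longleftrightarrow> ac_mod (\<lambda>s t. norm (f t - f s))"

lemma abs_cont_iff_ac: "abs_cont f \<longleftrightarrow> ac f"
  by (simp add: abs_cont_def ac_def ac_mod_def nonoverlapping_def conj_assoc Ball_def)

lemma ac_modD:
  assumes "ac_mod d" "\<epsilon> > 0"
  shows "\<exists>\<delta>>0. \<forall>(I::'i set) a b. nonoverlapping I a b \<longrightarrow> (\<Sum>i\<in>I. b i - a i) < \<delta> \<longrightarrow> (\<Sum>i\<in>I. d (a i) (b i)) < \<epsilon>"
proof -
  obtain \<delta> where "\<delta> > 0" and \<delta>: "\<And>(N::nat) a b.
     nonoverlapping {..<N} a b \<and> (\<Sum>k<N. b k - a k) < \<delta> \<Longrightarrow> (\<Sum>k<N. d (a k) (b k)) < \<epsilon>"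
    using assms unfolding ac_mod_def by blast
  have "(\<Sum>i\<in>I. d (a i) (b i)) < \<epsilon>" if I: "nonoverlapping I a b" "(\<Sum>i\<in>I. b i - a i) < \<delta>" for I :: "'i set" and a b
  proof -
    have "finite I" using I by (simp add: nonoverlapping_def)
    obtain h where h: "bij_betw h {..<card I} I"
      using ex_bij_betw_nat_finite[OF \<open>finite I\<close>] by (auto simp: atLeast0LessThan)
    have re: "(\<Sum>k<card I. g (h k)) = (\<Sum>i\<in>I. g i)" for g :: "'i \<Rightarrow> real"
      by (rule sum.reindex_bij_betw[OF h])
    have "nonoverlapping {..<card I} (\<lambda>k. a (h k)) (\<lambda>k. b (h k))"
      unfolding nonoverlapping_def
    proof (intro conjI ballI impI)
      fix j k assume "j \<in> {..<card I}" "k \<in> {..<card I}" "j \<noteq> k"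
      then have "h j \<in> I" "h k \<in> I" "h j \<noteq> h k"
        using h by (auto simp: bij_betw_def inj_on_def)
      then show "{a (h j)<..<b (h j)} \<inter> {a (h k)<..<b (h k)} = {}"
        using I unfolding nonoverlapping_def by blast
    qed (use I h in \<open>auto simp: nonoverlapping_def dest: bij_betwE\<close>)
    then have "(\<Sum>k<card I. d (a (h k)) (b (h k))) < \<epsilon>"
      using I re[of "\<lambda>i. b i - a i"] by (intro \<delta>) simp
    then show ?thesis using re[of "\<lambda>i. d (a i) (b i)"] by simp
  qed
  then show ?thesis using \<open>\<delta> > 0\<close> by blast
qed

lemma ac_mod_mono:
  assumes "ac_mod d" "\<And>s t. 0 \<le> s \<Longrightarrow> s \<le> t \<Longrightarrow> t \<le> 1 \<Longrightarrow> d' s t \<le> d s t"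
  shows "ac_mod d'"
  unfolding ac_mod_def
proof (intro allI impI)
  fix \<epsilon> :: real assume "\<epsilon> > 0"
  obtain \<delta> where "\<delta> > 0" and \<delta>: "\<And>(N::nat) a b.
     nonoverlapping {..<N} a b \<and> (\<Sum>k<N. b k - a k) < \<delta> \<Longrightarrow> (\<Sum>k<N. d (a k) (b k)) < \<epsilon>"
    using assms(1) \<open>\<epsilon> > 0\<close> unfolding ac_mod_def by blast
  show "\<exists>\<delta>>0. \<forall>(N::nat) a b.
     nonoverlapping {..<N} a b \<and> (\<Sum>k<N. b k - a k) < \<delta> \<longrightarrow> (\<Sum>k<N. d' (a k) (b k)) < \<epsilon>"
  proof (intro exI[of _ \<delta>] conjI allI impI \<open>\<delta> > 0\<close>)
    fix N :: nat and a b
    assume *: "nonoverlapping {..<N} a b \<and> (\<Sum>k<N. b k - a k) < \<delta>"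
    have "(\<Sum>k<N. d' (a k) (b k)) \<le> (\<Sum>k<N. d (a k) (b k))"
      using * assms(2) by (intro sum_mono) (auto simp: nonoverlapping_def)
    with \<delta>[OF *] show "(\<Sum>k<N. d' (a k) (b k)) < \<epsilon>" by simp
  qed
qed

lemma ac_mod_add:
  assumes "ac_mod d" "ac_mod d'"
  shows "ac_mod (\<lambda>s t. d s t + d' s t)"
  unfolding ac_mod_def
proof (intro allI impI)
  fix \<epsilon> :: real assume "\<epsilon> > 0"
  then have "\<epsilon>/2 > 0" by simp
  obtain \<delta> where "\<delta> > 0" and \<delta>: "\<And>(N::nat) a b.
     nonoverlapping {..<N} a b \<and> (\<Sum>k<N. b k - a k) < \<delta> \<Longrightarrow> (\<Sum>k<N. d (a k) (b k)) < \<epsilon>/2"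
    using assms(1) \<open>\<epsilon>/2 > 0\<close> unfolding ac_mod_def by blast
  obtain \<delta>' where "\<delta>' > 0" and \<delta>': "\<And>(N::nat) a b.
     nonoverlapping {..<N} a b \<and> (\<Sum>k<N. b k - a k) < \<delta>' \<Longrightarrow> (\<Sum>k<N. d' (a k) (b k)) < \<epsilon>/2"
    using assms(2) \<open>\<epsilon>/2 > 0\<close> unfolding ac_mod_def by blast
  show "\<exists>\<delta>>0. \<forall>(N::nat) a b.
     nonoverlapping {..<N} a b \<and> (\<Sum>k<N. b k - a k) < \<delta> \<longrightarrow> (\<Sum>k<N. d (a k) (b k) + d' (a k) (b k)) < \<epsilon>"
  proof (intro exI[of _ "min \<delta> \<delta>'"] conjI allI impI)
    fix N :: nat and a b
    assume "nonoverlapping {..<N} a b \<and> (\<Sum>k<N. b k - a k) < min \<delta> \<delta>'"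
    then show "(\<Sum>k<N. d (a k) (b k) + d' (a k) (b k)) < \<epsilon>"
      using \<delta>[of N a b] \<delta>'[of N a b] by (simp add: sum.distrib)
  qed (use \<open>\<delta> > 0\<close> \<open>\<delta>' > 0\<close> in auto)
qed

lemma ac_mod_cmult:
  assumes "ac_mod d" "c \<ge> 0"
  shows "ac_mod (\<lambda>s t. c * d s t)"
  unfolding ac_mod_def
proof (intro allI impI)
  fix \<epsilon> :: real assume "\<epsilon> > 0"
  then have "\<epsilon>/(c+1) > 0" using assms by simp
  obtain \<delta> where "\<delta> > 0" and \<delta>: "\<And>(N::nat) a b.
     nonoverlapping {..<N} a b \<and> (\<Sum>k<N. b k - a k) < \<delta> \<Longrightarrow> (\<Sum>k<N. d (a k) (b k)) < \<epsilon>/(c+1)"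
    using assms(1) \<open>\<epsilon>/(c+1) > 0\<close> unfolding ac_mod_def by blast
  show "\<exists>\<delta>>0. \<forall>(N::nat) a b.
     nonoverlapping {..<N} a b \<and> (\<Sum>k<N. b k - a k) < \<delta> \<longrightarrow> (\<Sum>k<N. c * d (a k) (b k)) < \<epsilon>"
  proof (intro exI[of _ "\<delta>"] conjI allI impI \<open>\<delta> > 0\<close>)
    fix N :: nat and a b
    assume "nonoverlapping {..<N} a b \<and> (\<Sum>k<N. b k - a k) < \<delta>"
    from \<delta>[OF this] have *: "(\<Sum>k<N. d (a k) (b k)) < \<epsilon>/(c+1)" .
    have "c * (\<Sum>k<N. d (a k) (b k)) \<le> c * (\<epsilon>/(c+1))"
      using * assms by (intro mult_left_mono) auto
    also have "\<dots> < \<epsilon>" using \<open>\<epsilon> > 0\<close> assms by (simp add: field_simps)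
    finally show "(\<Sum>k<N. c * d (a k) (b k)) < \<epsilon>" by (simp add: sum_distrib_left)
  qed
qed

lemma ac_dominated:
  assumes "ac f" "L \<ge> 0"
    "\<And>s t. s \<in> {0..1} \<Longrightarrow> t \<in> {0..1} \<Longrightarrow> norm (h t - h s) \<le> L * norm (f t - f s)"
  shows "ac h"
  unfolding ac_def
  by (rule ac_mod_mono[OF ac_mod_cmult[OF assms(1)[unfolded ac_def] assms(2)]]) (use assms(3) in auto)

lemma ac_dominated2:
  assumes "ac f" "ac g" "L \<ge> 0" "M \<ge> 0"
    "\<And>s t. s \<in> {0..1} \<Longrightarrow> t \<in> {0..1} \<Longrightarrow> norm (h t - h s) \<le> L * norm (f t - f s) + M * norm (g t - g s)"
  shows "ac h"
  unfolding ac_def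
  by (rule ac_mod_mono[OF ac_mod_add[OF ac_mod_cmult[OF assms(1)[unfolded ac_def] assms(3)]
        ac_mod_cmult[OF assms(2)[unfolded ac_def] assms(4)]]]) (use assms(5) in auto)

lemma ac_ident: "ac (\<lambda>t::real. t)"
  unfolding ac_def ac_mod_def
proof (intro allI impI exI conjI)
  fix \<epsilon> :: real and N :: nat and a b :: "nat \<Rightarrow> real"
  assume *: "nonoverlapping {..<N} a b \<and> (\<Sum>k<N. b k - a k) < \<epsilon>"
  have "(\<Sum>k<N. norm (b k - a k)) = (\<Sum>k<N. b k - a k)"
    using * by (intro sum.cong) (auto simp: nonoverlapping_def)
  then show "(\<Sum>k<N. norm (b k - a k)) < \<epsilon>" using * by simp
qed

lemma ac_lipschitz:
  assumes "L \<ge> 0" "\<And>s t. s \<in> {0..1} \<Longrightarrow> t \<in> {0..1} \<Longrightarrow> norm (f t - f s) \<le> L * \<bar>t - s\<bar>"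
  shows "ac f"
  by (rule ac_dominated[OF ac_ident assms(1)]) (use assms(2) in auto)

lemma ac_const: "ac (\<lambda>t. c)"
  by (rule ac_lipschitz[of 0]) auto

lemma ac_cong:
  assumes "ac f" "\<And>t. t \<in> {0..1} \<Longrightarrow> f t = g t"
  shows "ac g"
  by (rule ac_dominated[OF assms(1), of 1]) (use assms(2) in auto)

lemma ac_add:
  assumes "ac f" "ac g" shows "ac (\<lambda>t. f t + g t)"
proof (rule ac_dominated2[OF assms, of 1 1])
  fix s t
  show "norm (f t + g t - (f s + g s)) \<le> 1 * norm (f t - f s) + 1 * norm (g t - g s)"
    using norm_triangle_ineq[of "f t - f s" "g t - g s"] by (simp add: algebra_simps)
qed auto

lemma ac_bounded_linear:
  assumes "bounded_linear h" "ac f" shows "ac (\<lambda>t. h (f t))"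
proof (rule ac_dominated[OF assms(2), of "onorm h"])
  fix s t
  show "norm (h (f t) - h (f s)) \<le> onorm h * norm (f t - f s)"
    using onorm[OF assms(1), of "f t - f s"]
    by (simp add: linear_diff[OF bounded_linear.linear[OF assms(1)]])
qed (rule onorm_pos_le[OF assms(1)])

lemma ac_diff: "ac f \<Longrightarrow> ac g \<Longrightarrow> ac (\<lambda>t. f t - g t)"
  using ac_add[OF _ ac_bounded_linear[OF bounded_linear_minus[OF bounded_linear_ident]], of f g] by simp

lemma ac_imp_continuous_on:
  assumes "ac f" shows "continuous_on {0..1} f"
  unfolding continuous_on_iff
proof (intro ballI allI impI)
  fix t \<epsilon> :: real assume "t \<in> {0..1}" "\<epsilon> > 0"
  obtain \<delta> where "\<delta> > 0" and \<delta>: "\<And>(I::unit set) a b. nonoverlapping I a b \<Longrightarrow>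
       (\<Sum>i\<in>I. b i - a i) < \<delta> \<Longrightarrow> (\<Sum>i\<in>I. norm (f (b i) - f (a i))) < \<epsilon>"
    using ac_modD[OF assms[unfolded ac_def] \<open>\<epsilon> > 0\<close>, where ?'i = unit] by blast
  have *: "norm (f v - f u) < \<epsilon>" if "0 \<le> u" "u \<le> v" "v \<le> 1" "v - u < \<delta>" for u v
    using \<delta>[of "{()}" "\<lambda>_. u" "\<lambda>_. v"] that by (auto simp: nonoverlapping_def)
  show "\<exists>d>0. \<forall>x'\<in>{0..1}. dist x' t < d \<longrightarrow> dist (f x') (f t) < \<epsilon>"
  proof (intro exI[of _ \<delta>] conjI ballI impI \<open>\<delta> > 0\<close>)
    fix s assume "s \<in> {0..1}" "dist s t < \<delta>"
    then show "dist (f s) (f t) < \<epsilon>"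
      using *[of s t] *[of t s] \<open>t \<in> {0..1}\<close>
      by (cases "s \<le> t") (auto simp: dist_norm norm_minus_commute)
  qed
qed

lemma ac_bounded:
  assumes "ac f" obtains B where "B \<ge> 0" "\<And>t. t \<in> {0..1} \<Longrightarrow> norm (f t) \<le> B"
proof -
  have "compact (f ` {0..1})"
    by (rule compact_continuous_image[OF ac_imp_continuous_on[OF assms]]) simp
  then obtain B where "\<And>x. x \<in> f ` {0..1} \<Longrightarrow> norm x \<le> B" 
    using compact_imp_bounded bounded_iff by metis
  then show thesis by (intro that[of "max B 0"]) (auto simp: le_max_iff_disj)
qed

lemma ac_bilinear:
  assumes "bounded_bilinear h" "ac f" "ac g" shows "ac (\<lambda>t. h (f t) (g t))"
proof -
  interpret bounded_bilinear h by fact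
  obtain K where K: "K \<ge> 0" "\<And>a b. norm (h a b) \<le> norm a * norm b * K" using nonneg_bounded by blast
  obtain A where A: "A \<ge> 0" "\<And>t. t \<in> {0..1} \<Longrightarrow> norm (f t) \<le> A" using ac_bounded[OF assms(2)] by blast
  obtain B where B: "B \<ge> 0" "\<And>t. t \<in> {0..1} \<Longrightarrow> norm (g t) \<le> B" using ac_bounded[OF assms(3)] by blast
  show ?thesis
  proof (rule ac_dominated2[OF assms(2,3), of "B * K" "A * K"])
    fix s t :: real assume st: "s \<in> {0..1}" "t \<in> {0..1}"
    have "h (f t) (g t) - h (f s) (g s) = h (f t - f s) (g t) + h (f s) (g t - g s)"
      by (simp add: diff_left diff_right)
    also have "norm \<dots> \<le> norm (f t - f s) * norm (g t) * K + norm (f s) * norm (g t - g s) * K"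
      by (rule order_trans[OF norm_triangle_ineq add_mono[OF K(2) K(2)]])
    also have "\<dots> \<le> norm (f t - f s) * B * K + A * norm (g t - g s) * K"
      using A B K st by (intro add_mono mult_right_mono mult_left_mono) auto
    finally show "norm (h (f t) (g t) - h (f s) (g s)) \<le> B * K * norm (f t - f s) + A * K * norm (g t - g s)"
      by (simp add: mult_ac)
  qed (use A B K in auto)
qed

lemma ac_Pair: "ac f \<Longrightarrow> ac g \<Longrightarrow> ac (\<lambda>t. (f t, g t))"
  by (rule ac_dominated2[of f g 1 1]) (auto intro: norm_Pair_le)

lemma ac_compose_C1:
  assumes "ac \<theta>" "\<And>t. t \<in> {0..1} \<Longrightarrow> \<theta> t \<in> {0..1}"
    "\<And>s. s \<in> {0..1} \<Longrightarrow> (f has_vector_derivative f' s) (at s within {0..1})"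
    "continuous_on {0..1} f'"
  shows "ac (\<lambda>t. f (\<theta> t))"
proof -
  have "compact (f' ` {0..1})"
    by (rule compact_continuous_image[OF assms(4)]) simp
  then have "bounded (f' ` {0..1})" by (rule compact_imp_bounded)
  then obtain B where "\<forall>x\<in>f' ` {0..1}. norm x \<le> B"
    unfolding bounded_iff by blast
  then have B: "norm (f' s) \<le> B" if "s \<in> {0..1}" for s using that by blast
  then have "0 \<le> B" using order_trans[OF norm_ge_zero B[of 0]] by simp
  show ?thesis
  proof (rule ac_dominated[OF assms(1) \<open>0 \<le> B\<close>])
    fix s t :: real assume st: "s \<in> {0..1}" "t \<in> {0..1}"
    show "norm (f (\<theta> t) - f (\<theta> s)) \<le> B * norm (\<theta> t - \<theta> s)"
    proof (rule differentiable_bound[of "{0..1}" f "\<lambda>s h. h *\<^sub>R f' s"])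
      fix r :: real assume r: "r \<in> {0..1}"
      show "(f has_derivative (\<lambda>h. h *\<^sub>R f' r)) (at r within {0..1})"
        using assms(3)[OF r] by (simp add: has_vector_derivative_def)
      show "onorm (\<lambda>h. h *\<^sub>R f' r) \<le> B"
        using B[OF r] by (intro onorm_bound \<open>0 \<le> B\<close>) (simp add: mult.commute[of B] mult_left_mono)
    qed (use assms(2) st in auto)
  qed
qed

lemma ac_C1:
  assumes "\<And>s. s \<in> {0..1} \<Longrightarrow> (f has_vector_derivative f' s) (at s within {0..1})"
    "continuous_on {0..1} f'"
  shows "ac f"
  using ac_compose_C1[OF ac_ident _ assms] by simp

section \<open>Absolute continuity and integration\<close>

lemma sum_nonoverlapping_le_measure:
  assumes I: "nonoverlapping I a b" and U: "U \<in> lmeasurable" "\<And>i. i \<in> I \<Longrightarrow> {a i<..<b i} \<subseteq> U"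
  shows "(\<Sum>i\<in>I. b i - a i) \<le> measure lebesgue U"
proof -
  have "(\<Sum>i\<in>I. b i - a i) = (\<Sum>i\<in>I. measure lebesgue {a i<..<b i})"
    using I by (intro sum.cong) (auto simp: nonoverlapping_def)
  also have "\<dots> = measure lebesgue (\<Union>i\<in>I. {a i<..<b i})"
    using I by (intro measure_finite_Union[symmetric])
      (auto simp: nonoverlapping_def disjoint_family_on_def emeasure_lborel_Ioo)
  also have "\<dots> \<le> measure lebesgue U"
  proof (rule measure_mono_fmeasurable)
    show "(\<Union>i\<in>I. {a i<..<b i}) \<in> sets lebesgue"
      using I by (intro sets.finite_UN) (auto simp: nonoverlapping_def)
  qed (use U in auto)
  finally show ?thesis .
qed

text \<open>
  The fundamental theorem of calculus for absolutely continuous curves, proved directly for the gauge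
  integral.  Around a point of the exceptional null set \<open>E\<close> the gauge keeps the interval inside an open
  set of small measure that contains \<open>E\<close>, so that absolute continuity makes the sum of the increments
  small; elsewhere differentiability controls the increment over an interval straddling its tag.
\<close>

lemma ac_has_integral:
  fixes f :: "real \<Rightarrow> 'a::banach"
  assumes f: "ac f" and E: "negligible E"
    and deriv: "\<And>t. t \<in> {0..1} - E \<Longrightarrow> (f has_vector_derivative g t) (at t within {0..1})"
    and ab: "0 \<le> a" "a \<le> b" "b \<le> 1"
  shows "(g has_integral (f b - f a)) {a..b}"
proof (cases "a = b")
  case True then show ?thesis by (auto intro: has_integral_refl)
next
  case False
  with ab have "a < b" by simp
  \<comment> \<open>Values on the null set do not affect the integral; the value 0 removes the terms \<open>g' x\<close> from the
    Riemann sum at tags in \<open>E\<close>.\<close>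
  define g' where "g' t = (if t \<in> E then 0 else g t)" for t
  have "(g' has_integral (f b - f a)) {a..b}"
    unfolding has_integral_factor_content_real
  proof (intro allI impI)
    fix e :: real assume "e > 0"
    define e1 where "e1 = e / 2 * (b - a)"
    have "e1 > 0" using \<open>e > 0\<close> \<open>a < b\<close> by (simp add: e1_def)
    obtain \<delta> where "\<delta> > 0" and \<delta>: "\<And>(I::(real \<times> real set) set) u v. nonoverlapping I u v \<Longrightarrow>
         (\<Sum>i\<in>I. v i - u i) < \<delta> \<Longrightarrow> (\<Sum>i\<in>I. norm (f (v i) - f (u i))) < e1"
      using ac_modD[OF f[unfolded ac_def] \<open>e1 > 0\<close>, where ?'i = "real \<times> real set"] by blast
    obtain U where U: "open U" "E \<subseteq> U" "U \<in> lmeasurable" "measure lebesgue U < \<delta>"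
    proof -
      have "E \<in> sets lebesgue" using E by (simp add: negligible_iff_null_sets null_sets_def)
      from sets_lebesgue_outer_open[OF this \<open>\<delta> > 0\<close>] obtain T where
        T: "open T" "E \<subseteq> T" "T - E \<in> lmeasurable" "emeasure lebesgue (T - E) < ennreal \<delta>" by blast
      have TE: "T = (T - E) \<union> E" using T by auto
      have "T \<in> lmeasurable" 
        using fmeasurable.Un[OF T(3) negligible_imp_measurable[OF E]] TE by simp
      moreover have "measure lebesgue T = measure lebesgue (T - E)"
        using measure_negligible_finite_Union[of "{}"] 
        by (metis E T(3) TE measure_Un_null_set negligible_iff_null_sets fmeasurableD)
      moreover have "measure lebesgue (T - E) < \<delta>"
        using T(3,4) \<open>\<delta> > 0\<close> by (simp add: emeasure_eq_measure2 ennreal_less_iff)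
      ultimately show thesis using that T by simp
    qed
    have "\<exists>d>0. (x \<in> E \<longrightarrow> ball x d \<subseteq> U) \<and> (x \<in> {0..1} - E \<longrightarrow> (\<forall>y\<in>{0..1}. norm (y - x) < d \<longrightarrow>
             norm (f y - f x - (y - x) *\<^sub>R g x) \<le> e / 2 * norm (y - x)))" for x
    proof (cases "x \<in> E")
      case True then show ?thesis using U(1,2) open_contains_ball by blast
    next
      case False
      show ?thesis
      proof (cases "x \<in> {0..1}")
        case True
        then have "(f has_derivative (\<lambda>h. h *\<^sub>R g x)) (at x within {0..1})"
          using deriv[of x] False by (simp add: has_vector_derivative_def)
        then show ?thesis using False \<open>e > 0\<close> unfolding has_derivative_within_alt
          by (metis half_gt_zero)
      qed (use False zero_less_one in blast)
    qed
    then obtain d where d: "\<And>x. d x > 0" "\<And>x. x \<in> E \<Longrightarrow> ball x (d x) \<subseteq> U"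
      "\<And>x y. x \<in> {0..1} - E \<Longrightarrow> y \<in> {0..1} \<Longrightarrow> norm (y - x) < d x \<Longrightarrow>
             norm (f y - f x - (y - x) *\<^sub>R g x) \<le> e / 2 * norm (y - x)"
      by metis
    show "\<exists>d. gauge d \<and> (\<forall>p. p tagged_division_of {a..b} \<and> d fine p \<longrightarrow>
      norm ((\<Sum>(x,k)\<in>p. measure lborel k *\<^sub>R g' x) - (f b - f a)) \<le> e * measure lborel {a..b})"
    proof (intro exI[of _ "\<lambda>x. ball x (d x)"] conjI allI impI)
      show "gauge (\<lambda>x. ball x (d x))" using d(1) gauge_ball_dependent by blast
      fix p assume "p tagged_division_of {a..b} \<and> (\<lambda>x. ball x (d x)) fine p"
      then have p: "p tagged_division_of {a..b}" and fine: "(\<lambda>x. ball x (d x)) fine p" by auto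
      have fin: "finite p" using p by blast
      have K: "\<exists>u v. K = {u..v} \<and> u \<le> x \<and> x \<le> v \<and> a \<le> u \<and> v \<le> b \<and> {u..v} \<subseteq> ball x (d x)"
        if xKp: "(x,K) \<in> p" for x K
      proof -
        obtain u v where uv: "K = {u..v}" using tagged_division_ofD(4)[OF p xKp] by auto
        have "x \<in> K" "K \<subseteq> {a..b}" using tagged_division_ofD(2,3)[OF p xKp] by auto
        moreover have "K \<subseteq> ball x (d x)" using fineD[OF fine xKp] .
        ultimately show ?thesis using uv by (intro exI[of _ u] exI[of _ v]) simp
      qed
      define h where "h = (\<lambda>(x,K). measure lborel K *\<^sub>R g' x - (f (Sup K) - f (Inf K)))"
      have eq: "(\<Sum>(x,k)\<in>p. measure lborel k *\<^sub>R g' x) - (f b - f a) = sum h p"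
        using additive_tagged_division_1[OF \<open>a \<le> b\<close> p, of f]
        by (simp add: h_def split_def sum_subtractf)
      let ?A = "{xK \<in> p. fst xK \<in> E}" and ?B = "{xK \<in> p. fst xK \<notin> E}"
      have "sum h p = sum h ?A + sum h ?B"
        using fin by (subst sum.union_disjoint[symmetric]) (auto intro!: sum.cong)
      have 1: "norm (sum h ?A) \<le> e1"
      proof -
        have len: "0 \<le> Inf K \<and> Inf K \<le> Sup K \<and> Sup K \<le> 1 \<and> {Inf K<..<Sup K} = interior K"
          if "(x,K) \<in> p" for x K
          using K[OF that] ab by (auto simp: cInf_atLeastAtMost cSup_atLeastAtMost)
        have no: "nonoverlapping ?A (\<lambda>xK. Inf (snd xK)) (\<lambda>xK. Sup (snd xK))"
          unfolding nonoverlapping_def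
        proof (intro conjI ballI impI)
          fix j k assume "j \<in> ?A" "k \<in> ?A" "j \<noteq> k"
          then have "interior (snd j) \<inter> interior (snd k) = {}"
            using tagged_division_ofD(5)[OF p, of "fst j" "snd j" "fst k" "snd k"] by (auto simp: prod_eq_iff)
          then show "{Inf (snd j)<..<Sup (snd j)} \<inter> {Inf (snd k)<..<Sup (snd k)} = {}"
            using len[of "fst j" "snd j"] len[of "fst k" "snd k"] \<open>j \<in> ?A\<close> \<open>k \<in> ?A\<close> by simp
        qed (use fin len in auto)
        have sub: "{Inf (snd i)<..<Sup (snd i)} \<subseteq> U" if "i \<in> ?A" for i
        proof -
          obtain x K where i: "i = (x, K)" by (cases i)
          then have "(x,K) \<in> p" "x \<in> E" using that by auto
          with K[of x K] d(2)[of x] len[of x K] show ?thesis using interior_subset[of K] i by auto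
        qed
        have "(\<Sum>i\<in>?A. Sup (snd i) - Inf (snd i)) < \<delta>"
          using sum_nonoverlapping_le_measure[OF no U(3) sub] U(4) by simp
        then have "(\<Sum>i\<in>?A. norm (f (Sup (snd i)) - f (Inf (snd i)))) < e1"
          by (rule \<delta>[OF no])
        moreover have "norm (sum h ?A) \<le> (\<Sum>i\<in>?A. norm (f (Sup (snd i)) - f (Inf (snd i))))"
          by (rule sum_norm_le) (auto simp: h_def g'_def norm_minus_commute)
        ultimately show ?thesis by simp
      qed
      have 2: "norm (sum h ?B) \<le> e1"
      proof -
        have "norm (sum h ?B) \<le> (\<Sum>(x,K)\<in>?B. e / 2 * (Sup K - Inf K))"
        proof (rule sum_norm_le, clarify)
          fix x Kk assume xK: "(x, Kk) \<in> p" "fst (x, Kk) \<notin> E"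
          obtain u v where uv: "Kk = {u..v}" "u \<le> x" "x \<le> v" "a \<le> u" "v \<le> b" "{u..v} \<subseteq> ball x (d x)"
            using K[OF xK(1)] by blast
          have "u \<in> {u..v}" "v \<in> {u..v}" using uv by auto
          then have "norm (u - x) < d x" "norm (v - x) < d x"
            using uv(6) by (auto simp: subset_iff dist_norm norm_minus_commute)
          then have *: "norm (f u - f x - (u - x) *\<^sub>R g x) \<le> e / 2 * norm (u - x)"
             "norm (f v - f x - (v - x) *\<^sub>R g x) \<le> e / 2 * norm (v - x)"
            using uv ab xK by (intro d(3); simp)+
          have "norm ((v - u) *\<^sub>R g x - (f v - f u)) = 
             norm ((f u - f x - (u - x) *\<^sub>R g x) - (f v - f x - (v - x) *\<^sub>R g x))"
            by (simp add: algebra_simps)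
          also have "\<dots> \<le> e / 2 * norm (u - x) + e / 2 * norm (v - x)"
            by (rule order_trans[OF norm_triangle_ineq4 add_mono[OF *]])
          also have "\<dots> = e / 2 * (v - u)" using uv by (simp add: field_simps)
          finally show "norm (h (x, Kk)) \<le> e / 2 * (Sup Kk - Inf Kk)"
            using uv xK by (simp add: h_def g'_def)
        qed
        also have "\<dots> \<le> (\<Sum>(x,K)\<in>p. e / 2 * (Sup K - Inf K))"
        proof (rule sum_mono2[OF fin])
          fix i assume "i \<in> p - ?B"
          then show "0 \<le> (case i of (x, K) \<Rightarrow> e / 2 * (Sup K - Inf K))"
            using K[of "fst i" "snd i"] \<open>e > 0\<close> by (cases i) auto
        qed auto
        also have "\<dots> = e / 2 * (b - a)"
          using additive_tagged_division_1[OF \<open>a \<le> b\<close> p, of "\<lambda>x. x"]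
          by (simp only: split_def sum_distrib_left[symmetric])
        finally show ?thesis by (simp add: e1_def)
      qed
      have "norm (sum h p) \<le> e1 + e1"
        using norm_triangle_ineq[of "sum h ?A" "sum h ?B"] 1 2 \<open>sum h p = _\<close> by simp
      also have "\<dots> = e * measure lborel {a..b}" using \<open>a < b\<close> by (simp add: e1_def)
      finally show "norm ((\<Sum>(x,k)\<in>p. measure lborel k *\<^sub>R g' x) - (f b - f a)) \<le> e * measure lborel {a..b}"
        by (simp add: eq)
    qed
  qed
  then show ?thesis
    by (rule has_integral_spike[OF E, rotated]) (auto simp: g'_def)
qed

text \<open>
  On an interval that is shorter than the \<open>\<delta>\<close> belonging to \<open>\<epsilon> = 1\<close> the curve has variation at most 1,
  which bounds the sums of the norms of the integrals of \<open>g\<close>; finitely many such intervals cover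
  \<open>{0..1}\<close>.
\<close>

lemma ac_absolutely_integrable:
  fixes f :: "real \<Rightarrow> 'a::euclidean_space"
  assumes f: "ac f" and E: "negligible E"
    and deriv: "\<And>t. t \<in> {0..1} - E \<Longrightarrow> (f has_vector_derivative g t) (at t within {0..1})"
  shows "g absolutely_integrable_on {0..1}"
proof -
  obtain \<delta> where "\<delta> > 0" and \<delta>: "\<And>(I::real set set) u v. nonoverlapping I u v \<Longrightarrow>
         (\<Sum>i\<in>I. v i - u i) < \<delta> \<Longrightarrow> (\<Sum>i\<in>I. norm (f (v i) - f (u i))) < 1"
    using ac_modD[OF f[unfolded ac_def] zero_less_one, where ?'i = "real set"] by blast
  have small: "g absolutely_integrable_on {a..b}" if ab: "0 \<le> a" "a \<le> b" "b \<le> 1" "b - a < \<delta>" for a b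
  proof -
    have "g absolutely_integrable_on cbox a b"
    proof (rule bounded_variation_absolutely_integrable_interval[of _ _ _ 1])
      show "g integrable_on cbox a b"
        using ac_has_integral[OF f E deriv ab(1-3)] by auto
      fix d assume d: "d division_of cbox a b"
      have K: "\<exists>u v. K = {u..v} \<and> a \<le> u \<and> u \<le> v \<and> v \<le> b" if Kd: "K \<in> d" for K
      proof -
        obtain u v where uv: "K = {u..v}" using division_ofD(4)[OF d Kd] by auto
        moreover have "K \<noteq> {}" "K \<subseteq> {a..b}" using division_ofD(2,3)[OF d Kd] by auto
        ultimately show ?thesis by (intro exI[of _ u] exI[of _ v]) auto
      qed
      have len: "0 \<le> Inf K \<and> Inf K \<le> Sup K \<and> Sup K \<le> 1 \<and> {Inf K<..<Sup K} = interior K \<and> measure lborel K = Sup K - Inf K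
          \<and> integral K g = f (Sup K) - f (Inf K)"
        if "K \<in> d" for K
      proof -
        obtain u v where uv: "K = {u..v}" "a \<le> u" "u \<le> v" "v \<le> b" using K[OF \<open>K \<in> d\<close>] by blast
        have "(g has_integral (f v - f u)) {u..v}"
          using uv ab by (intro ac_has_integral[OF f E deriv]) auto
        then show ?thesis using uv ab by (auto intro: integral_unique)
      qed
      have no: "nonoverlapping d Inf Sup"
        unfolding nonoverlapping_def
      proof (intro conjI ballI impI)
        fix j k assume "j \<in> d" "k \<in> d" "j \<noteq> k"
        then show "{Inf j<..<Sup j} \<inter> {Inf k<..<Sup k} = {}"
          using division_ofD(5)[OF d] len by simp
      qed (use d len in auto)
      have "(\<Sum>K\<in>d. Sup K - Inf K) = (\<Sum>K\<in>d. measure lborel K)"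
        using len by (intro sum.cong) auto
      also have "\<dots> = b - a" using additive_content_division[OF d] ab by simp
      finally have "(\<Sum>K\<in>d. norm (f (Sup K) - f (Inf K))) < 1"
        using ab by (intro \<delta>[OF no]) simp
      also have "(\<Sum>K\<in>d. norm (f (Sup K) - f (Inf K))) = (\<Sum>K\<in>d. norm (integral K g))"
        using len by (intro sum.cong) auto
      finally show "(\<Sum>K\<in>d. norm (integral K g)) \<le> 1" by simp
    qed
    then show ?thesis by simp
  qed
  obtain n :: nat where n: "inverse (of_nat (Suc n)) < \<delta>" using reals_Archimedean[OF \<open>\<delta> > 0\<close>] by blast
  have "g absolutely_integrable_on {0..of_nat k / of_nat (Suc n)}" if "k \<le> Suc n" for k
    using that
  proof (induction k)
    case 0
    show ?case using small[of 0 0] \<open>\<delta> > 0\<close> by simp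
  next
    case (Suc k)
    have "g absolutely_integrable_on {of_nat k / of_nat (Suc n)..of_nat (Suc k) / of_nat (Suc n)}"
      using Suc.prems n by (intro small) (auto simp: field_simps)
    then show ?case
      by (rule absolutely_integrable_on_combine[OF Suc.IH[OF Suc_leD[OF Suc.prems]]])
        (auto simp: field_simps)
  qed
  from this[of "Suc n"] show ?thesis by simp
qed

text \<open>
  Truncating \<open>norm f\<close> at height \<open>n\<close> leaves a remainder with small integral; the truncated part
  contributes at most \<open>n\<close> times the total length of the intervals.
\<close>

lemma ac_integral:
  fixes f :: "real \<Rightarrow> 'a::euclidean_space"
  assumes f: "f absolutely_integrable_on {0..1}"
  shows "ac (\<lambda>t. integral {0..t} f)"
  unfolding ac_def ac_mod_def
proof (intro allI impI)
  fix \<epsilon> :: real assume "\<epsilon> > 0"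
  define h where "h x = norm (f x)" for x
  have h: "h absolutely_integrable_on {0..1}"
    unfolding h_def using absolutely_integrable_norm[OF f] by (simp add: o_def)
  define hn where "hn n x = min (h x) (real n)" for n x
  have hn: "hn n absolutely_integrable_on {0..1}" for n
    unfolding hn_def by (intro absolutely_integrable_min_1 h absolutely_integrable_on_const) auto
  have "(\<lambda>n. integral {0..1} (hn n)) \<longlonglongrightarrow> integral {0..1} h"
  proof (rule dominated_convergence(2)[where h=h])
    show "hn n integrable_on {0..1}" for n
      using hn by (simp add: absolutely_integrable_on_def)
    show "h integrable_on {0..1}" using h by (simp add: absolutely_integrable_on_def)
    show "norm (hn n x) \<le> h x" if "x \<in> {0..1}" for n x by (auto simp: hn_def h_def)
    fix x :: real assume "x \<in> {0..1}"
    show "(\<lambda>n. hn n x) \<longlonglongrightarrow> h x"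
    proof (rule tendsto_eventually)
      obtain N :: nat where "h x \<le> N" using real_arch_simple by blast
      then show "\<forall>\<^sub>F n in sequentially. hn n x = h x"
        by (intro eventually_sequentiallyI[of N]) (auto simp: hn_def)
    qed
  qed
  then have "\<forall>\<^sub>F n in sequentially. dist (integral {0..1} (hn n)) (integral {0..1} h) < \<epsilon>/2"
    using \<open>\<epsilon> > 0\<close> by (intro tendstoD) auto
  then obtain n where n: "\<bar>integral {0..1} (hn n) - integral {0..1} h\<bar> < \<epsilon>/2"
    by (auto simp: eventually_sequentially dist_real_def)
  define r where "r x = h x - hn n x" for x
  have r0: "r x \<ge> 0" for x by (simp add: r_def hn_def)
  have r: "r absolutely_integrable_on {0..1}"
    unfolding r_def by (rule set_integral_diff(1)[OF h hn])
  have "integral {0..1} r = integral {0..1} h - integral {0..1} (hn n)"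
    unfolding r_def using h hn by (intro integral_diff) (auto simp: absolutely_integrable_on_def)
  then have r_small: "integral {0..1} r < \<epsilon>/2" using n by linarith
  show "\<exists>\<delta>>0. \<forall>(N::nat) a b. nonoverlapping {..<N} a b \<and> (\<Sum>k<N. b k - a k) < \<delta> \<longrightarrow>
     (\<Sum>k<N. norm (integral {0..b k} f - integral {0..a k} f)) < \<epsilon>"
  proof (intro exI[of _ "\<epsilon> / (2 * (real n + 1))"] conjI allI impI)
    fix N :: nat and a b
    assume "nonoverlapping {..<N} a b \<and> (\<Sum>k<N. b k - a k) < \<epsilon> / (2 * (real n + 1))"
    then have no: "nonoverlapping {..<N} a b" and len: "(\<Sum>k<N. b k - a k) < \<epsilon> / (2 * (real n + 1))" by auto
    have ab: "0 \<le> a k" "a k \<le> b k" "b k \<le> 1" if "k < N" for k using no that by (auto simp: nonoverlapping_def)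
    have sub: "g absolutely_integrable_on {a k..b k}" "g absolutely_integrable_on {a k<..<b k}"
      if "g absolutely_integrable_on {0..1}" "k < N" for g :: "real \<Rightarrow> real" and k
      by (rule set_integrable_subset[OF that(1)]; use ab[OF that(2)] in force)+
    have *: "norm (integral {0..b k} f - integral {0..a k} f) \<le> integral {a k..b k} r + n * (b k - a k)"
      if k: "k < N" for k
    proof -
      have fint: "f absolutely_integrable_on {0..b k}" "f absolutely_integrable_on {a k..b k}"
        by (rule set_integrable_subset[OF f]; use ab[OF k] in force)+
      have "integral {0..b k} f - integral {0..a k} f = integral {a k..b k} f"
        using Henstock_Kurzweil_Integration.integral_combine[OF ab(1,2)[OF k], of f] fint
        by (auto simp: absolutely_integrable_on_def algebra_simps)
      also have "norm \<dots> \<le> integral {a k..b k} (\<lambda>x. r x + n)"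
      proof (rule integral_norm_bound_integral)
        show "f integrable_on {a k..b k}" using fint by (auto simp: absolutely_integrable_on_def)
        show "(\<lambda>x. r x + n) integrable_on {a k..b k}"
          using sub(1)[OF r k] by (intro integrable_add) (auto simp: absolutely_integrable_on_def)
      qed (auto simp: r_def hn_def h_def)
      also have "\<dots> = integral {a k..b k} r + n * (b k - a k)"
        using sub(1)[OF r k] ab[OF k]
        by (subst integral_add) (auto simp: absolutely_integrable_on_def)
      finally show ?thesis .
    qed
    have "(\<Sum>k<N. integral {a k..b k} r) = (\<Sum>k<N. set_lebesgue_integral lebesgue {a k<..<b k} r)"
    proof (rule sum.cong[OF refl])
      fix k assume "k \<in> {..<N}"
      then show "integral {a k..b k} r = set_lebesgue_integral lebesgue {a k<..<b k} r"
        using sub(2)[OF r, of k] integral_open_interval_real[of "a k" "b k" r] by (simp add: set_lebesgue_integral_eq_integral)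
    qed
    also have "\<dots> = set_lebesgue_integral lebesgue (\<Union>k<N. {a k<..<b k}) r"
      using sub(2)[OF r] no
      by (intro set_integral_finite_Union[symmetric]) (auto simp: disjoint_family_on_def nonoverlapping_def)
    also have "\<dots> \<le> set_lebesgue_integral lebesgue {0..1} r"
      unfolding set_lebesgue_integral_def
    proof (rule integral_mono)
      have sub01: "(\<Union>k<N. {a k<..<b k}) \<subseteq> {0..1}" using ab by force
      have "(\<Union>k<N. {a k<..<b k}) \<in> sets lebesgue" by (intro sets.finite_UN) auto
      then have "set_integrable lebesgue (\<Union>k<N. {a k<..<b k}) r"
        by (rule set_integrable_subset[OF r _ sub01])
      then show "integrable lebesgue (\<lambda>x. indicat_real (\<Union>k<N. {a k<..<b k}) x *\<^sub>R r x)"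
        by (simp only: set_integrable_def)
      show "integrable lebesgue (\<lambda>x. indicat_real {0..1} x *\<^sub>R r x)"
        using r by (simp only: set_integrable_def)
      fix x
      show "indicat_real (\<Union>k<N. {a k<..<b k}) x *\<^sub>R r x \<le> indicat_real {0..1} x *\<^sub>R r x"
        using subsetD[OF sub01, of x] r0[of x]
        by (cases "x \<in> (\<Union>k<N. {a k<..<b k})"; cases "x \<in> {0..1}") (simp_all only: indicator_simps, simp_all)
    qed
    also have "\<dots> = integral {0..1} r" using r by (simp add: set_lebesgue_integral_eq_integral)
    finally have "(\<Sum>k<N. integral {a k..b k} r) < \<epsilon>/2" using r_small by simp
    moreover have "n * (\<Sum>k<N. b k - a k) \<le> \<epsilon>/2"
    proof -
      have "n * (\<Sum>k<N. b k - a k) \<le> n * (\<epsilon> / (2 * (real n + 1)))"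
        using len by (intro mult_left_mono) auto
      also have "\<dots> \<le> \<epsilon>/2" using \<open>\<epsilon> > 0\<close> by (simp add: field_simps)
      finally show ?thesis .
    qed
    moreover have "(\<Sum>k<N. norm (integral {0..b k} f - integral {0..a k} f)) \<le> (\<Sum>k<N. integral {a k..b k} r + n * (b k - a k))"
      using * by (intro sum_mono) auto
    ultimately show "(\<Sum>k<N. norm (integral {0..b k} f - integral {0..a k} f)) < \<epsilon>"
      by (simp add: sum.distrib sum_distrib_left)
  qed (use \<open>\<epsilon> > 0\<close> in auto)
qed

text \<open>
  One-sided differentiation of the indefinite integral is applied to \<open>f\<close> and to its reflection, the
  latter giving the left derivative.
\<close>

lemma AE_deriv_integral:
  fixes f :: "real \<Rightarrow> 'a::euclidean_space"
  assumes f: "f integrable_on {0..1}"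
  obtains E where "negligible E" 
    "\<And>t. t \<in> {0..1} - E \<Longrightarrow> ((\<lambda>t. integral {0..t} f) has_vector_derivative f t) (at t within {0..1})"
proof -
  define f0 where "f0 x = (if x \<in> {0..1} then f x else 0)" for x
  have f0: "f0 integrable_on {a..b}" for a b
  proof -
    have "f0 integrable_on UNIV" using integrable_restrict_UNIV[of "{0..1}" f] f unfolding f0_def by (simp only:)
    then show ?thesis using integrable_on_subinterval[of f0 UNIV a b] by simp
  qed
  have f1: "(\<lambda>x. f0 (- x)) integrable_on {a..b}" for a b
    using Henstock_Kurzweil_Integration.integrable_reflect_real[of f0 "-a" "-b"] f0 by simp
  obtain N1 where N1: "negligible N1" "\<And>x e. \<lbrakk>x \<notin> N1; 0 < e\<rbrakk> \<Longrightarrow> \<exists>d>0. \<forall>h. 0 < h \<and> h < d \<longrightarrow>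
        norm (integral {x..x + h} f0 /\<^sub>R h - f0 x) < e"
    using integrable_ccontinuous_explicit[of f0] f0 by auto
  obtain N2 where N2: "negligible N2" "\<And>x e. \<lbrakk>x \<notin> N2; 0 < e\<rbrakk> \<Longrightarrow> \<exists>d>0. \<forall>h. 0 < h \<and> h < d \<longrightarrow>
        norm (integral {x..x + h} (\<lambda>x. f0 (- x)) /\<^sub>R h - f0 (- x)) < e"
    using integrable_ccontinuous_explicit[of "\<lambda>x. f0 (- x)"] f1 by auto
  have N2': "\<exists>d>0. \<forall>h. 0 < h \<and> h < d \<longrightarrow> norm (integral {x - h..x} f0 /\<^sub>R h - f0 x) < e"
    if "x \<notin> uminus ` N2" "0 < e" for x e
  proof -
    have "- x \<notin> N2" using that by (metis image_eqI minus_minus)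
    from N2(2)[OF this \<open>0 < e\<close>] show ?thesis
      using Henstock_Kurzweil_Integration.integral_reflect_real[of "x" "x - _" f0] by (simp add: algebra_simps)
  qed
  have "negligible (uminus ` N2)"
    by (rule negligible_differentiable_image_negligible[OF _ N2(1)])
      (auto intro!: differentiable_on_minus differentiable_on_ident)
  with N1(1) have "negligible (N1 \<union> uminus ` N2)" by simp
  moreover have "((\<lambda>t. integral {0..t} f) has_vector_derivative f t) (at t within {0..1})"
    if t: "t \<in> {0..1} - (N1 \<union> uminus ` N2)" for t
    unfolding has_vector_derivative_def has_derivative_within_alt
  proof (intro conjI allI impI bounded_linear_scaleR_left)
    fix e :: real assume "e > 0"
    obtain d1 where d1: "d1 > 0" "\<And>h. 0 < h \<Longrightarrow> h < d1 \<Longrightarrow> norm (integral {t..t + h} f0 /\<^sub>R h - f0 t) < e"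
      using N1(2)[of t e] t \<open>e > 0\<close> by auto
    obtain d2 where d2: "d2 > 0" "\<And>h. 0 < h \<Longrightarrow> h < d2 \<Longrightarrow> norm (integral {t - h..t} f0 /\<^sub>R h - f0 t) < e"
      using N2'[of t e] t \<open>e > 0\<close> by auto
    have I: "integral {0..v} f - integral {0..u} f = integral {u..v} f0" if "0 \<le> u" "u \<le> v" "v \<le> 1" for u v
    proof -
      have "integral {0..v} f0 = integral {0..u} f0 + integral {u..v} f0"
        using Henstock_Kurzweil_Integration.integral_combine[OF that(1,2), of f0] f0 by simp
      moreover have "integral {0..w} f0 = integral {0..w} f" if "w \<le> 1" for w
        using that by (intro integral_cong) (auto simp: f0_def)
      ultimately show ?thesis using that by simp
    qed
    have scale: "norm (y - h *\<^sub>R z) \<le> e * h" if "norm (y /\<^sub>R h - z) < e" "h > 0" for y z :: 'a and h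
    proof -
      have "y - h *\<^sub>R z = h *\<^sub>R (y /\<^sub>R h - z)" using that by (simp add: scaleR_diff_right)
      then have "norm (y - h *\<^sub>R z) = h * norm (y /\<^sub>R h - z)" using that by simp
      also have "\<dots> \<le> h * e" using that by (intro mult_left_mono) auto
      finally show ?thesis by (simp add: mult.commute)
    qed
    show "\<exists>d>0. \<forall>y\<in>{0..1}. norm (y - t) < d \<longrightarrow>
       norm (integral {0..y} f - integral {0..t} f - (y - t) *\<^sub>R f t) \<le> e * norm (y - t)"
    proof (intro exI[of _ "min d1 d2"] conjI ballI impI)
      fix y :: real assume y: "y \<in> {0..1}" "norm (y - t) < min d1 d2"
      have f0t: "f0 t = f t" using t by (simp add: f0_def)
      consider "y = t" | "y > t" | "y < t" by linarith
      then show "norm (integral {0..y} f - integral {0..t} f - (y - t) *\<^sub>R f t) \<le> e * norm (y - t)"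
      proof cases
        case 2
        then show ?thesis using scale[OF d1(2)[of "y - t"]] I[of t y] y t f0t by simp
      next
        case 3
        have "integral {0..y} f - integral {0..t} f - (y - t) *\<^sub>R f t = - (integral {y..t} f0 - (t - y) *\<^sub>R f0 t)"
          using I[of y t] 3 y t f0t by (simp add: algebra_simps)
        then have "norm (integral {0..y} f - integral {0..t} f - (y - t) *\<^sub>R f t) = norm (integral {y..t} f0 - (t - y) *\<^sub>R f0 t)"
          by (metis norm_minus_cancel)
        then show ?thesis using scale[OF d2(2)[of "t - y"]] 3 y by simp
      qed simp
    qed (use d1 d2 in auto)
  qed
  ultimately show thesis by (rule that)
qed

section \<open>Volume under Lipschitz maps and slicing\<close>

text \<open>
  The sharp constant \<open>L ^ DIM('a)\<close> is essential, as the volume ratios compared later differ only by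
  factors close to 1.  It results from covering almost all of \<open>S\<close> by disjoint balls (Vitali): the image
  of a ball with radius \<open>r\<close> lies in a ball with radius \<open>L r\<close>.
\<close>

lemma measure_Lipschitz_image_le:
  fixes f :: "'a::euclidean_space \<Rightarrow> 'a"
  assumes S: "compact S" and L: "L \<ge> 0" and lip: "\<And>x y. x \<in> S \<Longrightarrow> y \<in> S \<Longrightarrow> norm (f x - f y) \<le> L * norm (x - y)"
  shows "measure lborel (f ` S) \<le> L ^ DIM('a) * measure lborel S"
proof (rule field_le_epsilon)
  fix \<epsilon> :: real assume "\<epsilon> > 0"
  have cont: "continuous_on S f"
    by (rule lipschitz_on_continuous_on[of L])
      (auto simp: lipschitz_on_def dist_norm L intro: lip)
  have fS: "compact (f ` S)" by (rule compact_continuous_image[OF cont S])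
  define e where "e = \<epsilon> / (L ^ DIM('a) + 1)"
  have pos: "L ^ DIM('a) + 1 > 0" using L by (simp add: add_nonneg_pos)
  have "e > 0" using \<open>\<epsilon> > 0\<close> pos by (simp add: e_def)
  have SL: "S \<in> sets lebesgue" using S by (simp add: borel_compact)
  obtain U where U: "open U" "S \<subseteq> U" "(U - S) \<in> lmeasurable" "emeasure lebesgue (U - S) < ennreal e"
    using sets_lebesgue_outer_open[OF SL \<open>e > 0\<close>] by blast
  have Sfin: "emeasure lborel S < \<infinity>" using emeasure_compact_finite[OF S] by simp
  have eU: "emeasure lborel U \<le> emeasure lborel S + ennreal e"
  proof -
    have "emeasure lebesgue U = emeasure lebesgue (S \<union> (U - S))" using U by (simp add: Un_absorb1)
    also have "\<dots> \<le> emeasure lebesgue S + emeasure lebesgue (U - S)"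
      using SL U by (intro emeasure_subadditive) auto
    also have "\<dots> \<le> emeasure lebesgue S + ennreal e" using U by (intro add_left_mono) auto
    finally show ?thesis using U S by (simp add: borel_compact)
  qed
  define K where "K = {(x, r). x \<in> S \<and> 0 < r \<and> ball x r \<subseteq> U}"
  have "\<exists>i. i \<in> K \<and> x \<in> ball (fst i) (snd i) \<and> snd i < d" if xd: "x \<in> S" "0 < d" for x d
  proof -
    obtain r where r: "r > 0" "ball x r \<subseteq> U" using U(1,2) xd(1) openE by blast
    then have "(x, min r (d/2)) \<in> K" using xd by (auto simp: K_def)
    then show ?thesis using xd r by (intro exI[of _ "(x, min r (d/2))"]) auto
  qed
  then obtain C where C: "countable C" "C \<subseteq> K"
     "pairwise (\<lambda>i j. disjnt (ball (fst i) (snd i)) (ball (fst j) (snd j))) C"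
     "negligible (S - (\<Union>i\<in>C. ball (fst i) (snd i)))"
    by (rule Vitali_covering_theorem_balls[of S K fst snd])
  define b where "b n = (if n \<in> to_nat_on C ` C then ball (fst (from_nat_into C n)) (snd (from_nat_into C n)) else {})" for n
  define c where "c n = (if n \<in> to_nat_on C ` C then cball (f (fst (from_nat_into C n))) (L * snd (from_nat_into C n)) else {})" for n
  have inC: "from_nat_into C n \<in> C" if "n \<in> to_nat_on C ` C" for n
    using that C(1) by auto
  have disj: "disjoint_family b"
    unfolding disjoint_family_on_def
  proof (intro ballI impI)
    fix m n :: nat assume "m \<noteq> n"
    show "b m \<inter> b n = {}"
    proof (cases "m \<in> to_nat_on C ` C \<and> n \<in> to_nat_on C ` C")
      case True
      then have "from_nat_into C m \<noteq> from_nat_into C n" using \<open>m \<noteq> n\<close> C(1) by auto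
      then have "disjnt (ball (fst (from_nat_into C m)) (snd (from_nat_into C m))) (ball (fst (from_nat_into C n)) (snd (from_nat_into C n)))"
        using C(3) inC True by (auto simp: pairwise_def)
      then show ?thesis by (auto simp: b_def disjnt_def)
    qed (auto simp: b_def)
  qed
  have KD: "fst i \<in> S \<and> 0 < snd i \<and> ball (fst i) (snd i) \<subseteq> U" if "i \<in> C" for i
    using subsetD[OF C(2) that] by (auto simp: K_def)
  have bU: "(\<Union>n. b n) \<subseteq> U" using KD[OF inC] by (auto simp: b_def)
  have ebc: "emeasure lborel (c n) \<le> ennreal (L ^ DIM('a)) * emeasure lborel (b n)" for n
  proof (cases "n \<in> to_nat_on C ` C")
    case True
    then have r: "snd (from_nat_into C n) > 0" using KD[OF inC] by blast
    show ?thesis using r L True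
      by (simp add: b_def c_def emeasure_cball emeasure_ball power_mult_distrib flip: ennreal_mult')
  qed (simp add: c_def)
  define N where "N = f ` (S - (\<Union>i\<in>C. ball (fst i) (snd i)))"
  have N: "negligible N"
    unfolding N_def
  proof (rule negligible_locally_Lipschitz_image[OF _ C(4)])
    fix x assume x: "x \<in> S - (\<Union>i\<in>C. ball (fst i) (snd i))"
    show "\<exists>T B. open T \<and> x \<in> T \<and> (\<forall>y\<in>(S - (\<Union>i\<in>C. ball (fst i) (snd i))) \<inter> T. norm (f y - f x) \<le> B * norm (y - x))"
      by (intro exI[of _ UNIV] exI[of _ L]) (use x lip in auto)
  qed simp
  have sub: "f ` S \<subseteq> (\<Union>n. c n) \<union> N"
  proof
    fix y assume "y \<in> f ` S"
    then obtain x where x: "x \<in> S" "y = f x" by blast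
    show "y \<in> (\<Union>n. c n) \<union> N"
    proof (cases "x \<in> (\<Union>i\<in>C. ball (fst i) (snd i))")
      case True
      then obtain i where i: "i \<in> C" "x \<in> ball (fst i) (snd i)" by blast
      then have fi: "fst i \<in> S" using KD by blast
      have "norm (f (fst i) - f x) \<le> L * norm (fst i - x)" using lip fi x by blast
      also have "\<dots> \<le> L * snd i" using i L by (intro mult_left_mono) (auto simp: dist_norm)
      finally have "y \<in> c (to_nat_on C i)" using i(1) C(1) x by (simp add: c_def dist_norm)
      then show ?thesis by blast
    qed (use x in \<open>auto simp: N_def\<close>)
  qed
  have bm: "b n \<in> sets borel" "c n \<in> sets borel" for n by (auto simp: b_def c_def)
  have cu: "(\<Union>n. c n) \<in> sets lebesgue" using bm by (intro sets_completionI_sets) auto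
  have NS: "N \<in> sets lebesgue" "N \<in> null_sets lebesgue" using N by (auto simp only: negligible_iff_null_sets null_setsD2)
  have "emeasure lborel (f ` S) = emeasure lebesgue (f ` S)" using fS by (simp add: borel_compact)
  also have "\<dots> \<le> emeasure lebesgue ((\<Union>n. c n) \<union> N)"
    using sub by (rule emeasure_mono[OF _ sets.Un[OF cu NS(1)]])
  also have "\<dots> = emeasure lebesgue (\<Union>n. c n)"
    by (rule emeasure_Un_null_set[OF cu NS(2)])
  also have "\<dots> = emeasure lborel (\<Union>n. c n)" using bm by simp
  also have "\<dots> \<le> (\<Sum>n. emeasure lborel (c n))" using bm by (intro emeasure_subadditive_countably) auto
  also have "\<dots> \<le> (\<Sum>n. ennreal (L ^ DIM('a)) * emeasure lborel (b n))" by (intro suminf_le ebc) auto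
  also have "\<dots> = ennreal (L ^ DIM('a)) * (\<Sum>n. emeasure lborel (b n))" by (rule ennreal_suminf_cmult)
  also have "(\<Sum>n. emeasure lborel (b n)) = emeasure lborel (\<Union>n. b n)"
    using bm by (intro suminf_emeasure disj) auto
  also have "\<dots> \<le> emeasure lborel U" using bU U(1) by (intro emeasure_mono) auto
  also have "\<dots> \<le> emeasure lborel S + ennreal e" by (rule eU)
  also have "\<dots> = ennreal (measure lborel S + e)"
    using Sfin \<open>e > 0\<close> by (simp add: emeasure_eq_ennreal_measure)
  finally have "emeasure lborel (f ` S) \<le> ennreal (L ^ DIM('a) * (measure lborel S + e))"
    using L \<open>e > 0\<close> by (simp add: ennreal_mult' mult_left_mono)
  then have "measure lborel (f ` S) \<le> L ^ DIM('a) * (measure lborel S + e)"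
    using L \<open>e > 0\<close> by (simp add: measure_def enn2real_leI)
  also have "\<dots> \<le> L ^ DIM('a) * measure lborel S + \<epsilon>"
  proof -
    have "L ^ DIM('a) * e \<le> (L ^ DIM('a) + 1) * e" using \<open>e > 0\<close> by simp
    also have "\<dots> = \<epsilon>" using pos by (simp add: e_def)
    finally show ?thesis by (simp add: distrib_left)
  qed
  finally show "measure lborel (f ` S) \<le> L ^ DIM('a) * measure lborel S + \<epsilon>" .
qed

lemma compact_slice:
  fixes S :: "('a::euclidean_space \<times> 'b::euclidean_space) set"
  assumes "compact S"
  shows "compact (Pair x -` S)" "compact ((\<lambda>x. (x, y)) -` S)"
proof -
  have "bounded (snd ` S)" "bounded (fst ` S)" using assms compact_imp_bounded bounded_snd bounded_fst by blast+
  then have "bounded (Pair x -` S)" "bounded ((\<lambda>x. (x, y)) -` S)"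
    by (auto elim!: bounded_subset simp: image_iff; force)+
  moreover have "closed (Pair x -` S)" "closed ((\<lambda>x. (x, y)) -` S)"
    by (intro closed_vimage compact_imp_closed[OF assms] continuous_intros)+
  ultimately show "compact (Pair x -` S)" "compact ((\<lambda>x. (x, y)) -` S)"
    by (auto simp: compact_eq_bounded_closed)
qed

lemma measure_le_iff_emeasure:
  assumes "compact S" "compact T" "c \<ge> 0"
  shows "measure lborel T \<le> c * measure lborel S \<longleftrightarrow> emeasure lborel T \<le> ennreal c * emeasure lborel S"
proof -
  have "emeasure lborel S = ennreal (measure lborel S)" "emeasure lborel T = ennreal (measure lborel T)"
    using emeasure_compact_finite[OF assms(1)] emeasure_compact_finite[OF assms(2)]
    by (intro emeasure_eq_ennreal_measure; simp add: less_top)+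
  then show ?thesis using assms by (simp add: ennreal_mult' [symmetric] ennreal_le_iff)
qed

text \<open>
  Together with its mirror image \<open>measure_le_slices'\<close> this handles maps that move only one of the two factors: their volume
  distortion is read off from the slices, on which they are linear.
\<close>

lemma measure_le_slices:
  fixes S T :: "('a::euclidean_space \<times> 'b::euclidean_space) set"
  assumes S: "compact S" and T: "compact T" and c: "c \<ge> 0"
    and le: "\<And>x. measure lborel (Pair x -` T) \<le> c * measure lborel (Pair x -` S)"
  shows "measure lborel T \<le> c * measure lborel S"
proof -
  have ST: "S \<in> sets (lborel \<Otimes>\<^sub>M lborel)" "T \<in> sets (lborel \<Otimes>\<^sub>M lborel)"
    unfolding lborel_prod sets_lborel using S T by (auto simp: borel_compact)
  have "emeasure lborel T = (\<integral>\<^sup>+x. emeasure lborel (Pair x -` T) \<partial>lborel)"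
    using lborel.emeasure_pair_measure_alt[OF ST(2)] by (simp add: lborel_prod)
  also have "\<dots> \<le> (\<integral>\<^sup>+x. ennreal c * emeasure lborel (Pair x -` S) \<partial>lborel)"
    using le compact_slice(1)[OF S] compact_slice(1)[OF T] c
    by (intro nn_integral_mono) (simp add: measure_le_iff_emeasure[symmetric])
  also have "\<dots> = ennreal c * emeasure lborel S"
    using lborel.emeasure_pair_measure_alt[OF ST(1)] lborel.measurable_emeasure_Pair[OF ST(1)]
    by (simp add: lborel_prod nn_integral_cmult)
  finally show ?thesis using S T c by (simp add: measure_le_iff_emeasure)
qed

lemma measure_swap:
  fixes S :: "('a::euclidean_space \<times> 'b::euclidean_space) set"
  assumes "compact S"
  shows "measure lborel (prod.swap ` S) = measure lborel S"
proof -
  have ST: "S \<in> sets (lborel \<Otimes>\<^sub>M lborel)"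
    unfolding lborel_prod sets_lborel using assms by (rule borel_compact)
  have "compact (prod.swap ` S)"
    by (intro compact_continuous_image assms continuous_intros continuous_on_swap)
  then have ST': "prod.swap ` S \<in> sets (lborel \<Otimes>\<^sub>M lborel)"
    unfolding lborel_prod sets_lborel by (rule borel_compact)
  have "Pair y -` (prod.swap ` S) = (\<lambda>x. (x, y)) -` S" for y by (auto simp: image_iff; force)
  then have "emeasure lborel (prod.swap ` S) = emeasure lborel S"
    using lborel.emeasure_pair_measure_alt[OF ST'] lborel_pair.emeasure_pair_measure_alt2[OF ST]
    by (simp add: lborel_prod)
  then show ?thesis by (simp add: measure_def)
qed

lemma measure_le_slices':
  fixes S T :: "('a::euclidean_space \<times> 'b::euclidean_space) set"
  assumes S: "compact S" and T: "compact T" and c: "c \<ge> 0"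
    and le: "\<And>y. measure lborel ((\<lambda>x. (x, y)) -` T) \<le> c * measure lborel ((\<lambda>x. (x, y)) -` S)"
  shows "measure lborel T \<le> c * measure lborel S"
proof -
  have *: "Pair y -` (prod.swap ` R) = (\<lambda>x. (x, y)) -` R" for y and R :: "('a \<times> 'b) set" by (auto simp: image_iff; force)
  have "measure lborel (prod.swap ` T) \<le> c * measure lborel (prod.swap ` S)"
    using S T c le unfolding *[symmetric]
    by (intro measure_le_slices compact_continuous_image continuous_on_swap) auto
  then show ?thesis using S T by (simp add: measure_swap)
qed

lemma measure_matrix_image:
  fixes S :: "(real^'n::{finite,wellorder}) set"
  assumes "compact S" "linear f"
  shows "measure lborel (f ` S) = \<bar>det (matrix f)\<bar> * measure lborel S"
proof -
  have "compact (f ` S)" using assms by (intro compact_continuous_image linear_continuous_on linear_conv_bounded_linear[THEN iffD1])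
  then show ?thesis
    using measure_linear_image[OF assms(2), of S] assms(1) lmeasurable_compact[OF assms(1)]
    by (simp add: borel_compact)
qed

section \<open>Differential equations with a skew linear part\<close>

text \<open>
  A skew linear part does not change the norm, so only the forcing term \<open>e\<close> can make \<open>d\<close> grow.
\<close>

lemma forced_skew_bound_nonneg:
  fixes d :: "real \<Rightarrow> 'a::real_inner"
  assumes d: "\<And>t. (d has_vector_derivative A (d t) + e t) (at t)"
    and A: "\<And>x. A x \<bullet> x = 0" and e: "\<And>t. norm (e t) \<le> K" and "t \<ge> 0"
  shows "norm (d t) \<le> norm (d 0) + K * t"
proof (rule field_le_epsilon)
  fix \<delta> :: real assume "\<delta> > 0"
  \<comment> \<open>The regularised norm is differentiable also where \<open>d\<close> vanishes.\<close>
  define N where "N s = sqrt (d s \<bullet> d s + \<delta>\<^sup>2)" for s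
  have pos: "d s \<bullet> d s + \<delta>\<^sup>2 > 0" for s using \<open>\<delta> > 0\<close> by (simp add: add_nonneg_pos)
  have Ngt: "norm (d s) \<le> N s" "N s > 0" for s
    using pos[of s] by (auto simp: N_def norm_eq_sqrt_inner)
  have K: "K \<ge> 0" using order_trans[OF norm_ge_zero e[of 0]] .
  have N': "(N has_real_derivative (d s \<bullet> e s) / N s) (at s)" for s
  proof -
    have "((\<lambda>s. d s \<bullet> d s + \<delta>\<^sup>2) has_real_derivative (d s \<bullet> (A (d s) + e s) + (A (d s) + e s) \<bullet> d s)) (at s)"
      using d[of s] unfolding has_vector_derivative_def has_field_derivative_def
      by (auto intro!: derivative_eq_intros simp: algebra_simps inner_simps)
    then have "(N has_real_derivative (d s \<bullet> (A (d s) + e s) + (A (d s) + e s) \<bullet> d s) * (inverse (N s) / 2)) (at s)"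
      unfolding N_def by (rule DERIV_chain2[where f=sqrt and g="\<lambda>s. d s \<bullet> d s + \<delta>\<^sup>2", OF DERIV_real_sqrt[OF pos[of s]], THEN DERIV_cong]) simp
    then show ?thesis
      by (rule DERIV_cong) (simp add: inner_add_left inner_add_right A inner_commute[of "d s" "A (d s)"] field_simps inner_commute[of "d s" "e s"])
  qed
  have "N t - K * t \<le> N 0 - K * 0"
  proof (rule DERIV_nonpos_imp_nonincreasing[OF \<open>t \<ge> 0\<close>, of "\<lambda>s. N s - K * s"])
    fix s
    have "d s \<bullet> e s \<le> norm (d s) * norm (e s)" by (rule norm_cauchy_schwarz)
    also have "\<dots> \<le> N s * K" using Ngt[of s] e K by (intro mult_mono) auto
    finally have "(d s \<bullet> e s) / N s - K \<le> 0" using Ngt[of s] by (simp add: field_simps)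
    moreover have "((\<lambda>s. N s - K * s) has_real_derivative (d s \<bullet> e s) / N s - K) (at s)"
      by (auto intro!: derivative_eq_intros N')
    ultimately show "\<exists>y. ((\<lambda>s. N s - K * s) has_real_derivative y) (at s) \<and> y \<le> 0" by blast
  qed
  moreover have "N 0 \<le> norm (d 0) + \<delta>"
    using sqrt_add_le_add_sqrt[of "d 0 \<bullet> d 0" "\<delta>\<^sup>2"] \<open>\<delta> > 0\<close> by (simp add: N_def norm_eq_sqrt_inner)
  ultimately show "norm (d t) \<le> norm (d 0) + K * t + \<delta>" using Ngt(1)[of t] by simp
qed

lemma forced_skew_bound:
  fixes d :: "real \<Rightarrow> 'a::real_inner"
  assumes d: "\<And>t. (d has_vector_derivative A (d t) + e t) (at t)"
    and A: "\<And>x. A x \<bullet> x = 0" and e: "\<And>t. norm (e t) \<le> K"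
  shows "norm (d t) \<le> norm (d 0) + K * \<bar>t\<bar>"
proof (cases "t \<ge> 0")
  case True then show ?thesis using forced_skew_bound_nonneg[OF assms, of t] by simp
next
  case False
  have "((\<lambda>t. d (- t)) has_vector_derivative - A (d (- t)) + - e (- t)) (at t)" for t
  proof -
    have "(uminus has_vector_derivative (-1::real)) (at t)"
      using has_vector_derivative_minus[OF has_vector_derivative_id, of "at t"] by simp
    from vector_diff_chain_at[OF this d] show ?thesis by (simp add: o_def)
  qed
  from forced_skew_bound_nonneg[of "\<lambda>t. d (- t)" "\<lambda>x. - A x" "\<lambda>t. - e (- t)" K "- t", OF this]
  show ?thesis using False A e by simp
qed

text \<open>
  The antiderivative that vanishes at 0, on the whole line: one of the two integrals is over an empty
  or degenerate interval.
\<close>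

definition prim :: "(real \<Rightarrow> 'a::banach) \<Rightarrow> real \<Rightarrow> 'a"
  where "prim f x = integral {0..x} f - integral {x..0} f"

lemma prim_has_vector_derivative:
  assumes f: "\<And>x. isCont f x"
  shows "(prim f has_vector_derivative f x) (at x)"
proof -
  define c where "c = - \<bar>x\<bar> - 1"
  have cont: "continuous_on S f" for S using f by (simp add: continuous_at_imp_continuous_on)
  have int: "f integrable_on {a..b}" for a b by (rule integrable_continuous_real[OF cont])
  have c0: "c \<le> 0" by (simp add: c_def)
  have eq: "prim f y = integral {c..y} f - integral {c..0} f" if "y \<ge> c" for y
  proof (cases "y \<ge> 0")
    case True
    then show ?thesis
      using Henstock_Kurzweil_Integration.integral_combine[of c 0 y f] int c0
      by (cases "y = 0") (simp_all add: prim_def algebra_simps)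
  next
    case False
    then show ?thesis
      using Henstock_Kurzweil_Integration.integral_combine[of c y 0 f] int c0 that by (simp add: prim_def algebra_simps)
  qed
  have "((\<lambda>y. integral {c..y} f) has_vector_derivative f x) (at x within {c..\<bar>x\<bar> + 1})"
    by (rule integral_has_vector_derivative[OF cont]) (auto simp: c_def)
  then have "((\<lambda>y. integral {c..y} f - integral {c..0} f) has_vector_derivative f x) (at x within {c..\<bar>x\<bar> + 1})"
    by (auto intro!: derivative_eq_intros)
  then have "(prim f has_vector_derivative f x) (at x within {c..\<bar>x\<bar> + 1})"
    by (rule has_vector_derivative_transform[rotated 2]) (auto simp: eq c_def)
  moreover have "at x within {c..\<bar>x\<bar> + 1} = at x"
    by (rule at_within_interior) (auto simp: c_def interior_atLeastAtMost_real)
  ultimately show ?thesis by simp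
qed

section \<open>The bracket\<close>

type_synonym hvec = "complex \<times> complex"

text \<open>
  A pair stands for a group element in exponential coordinates (horizontal and central part) or for
  the initial data of a geodesic (horizontal velocity and covector).
\<close>

type_synonym hpair = "hvec \<times> (real^2)"

text \<open>
  With the rotation \<open>R (a, b) = (- b, a)\<close>, which anticommutes with \<open>J1\<close>, the second map is \<open>\<i> + 2 R\<close>.
  The maps \<open>J1\<close> and \<open>R\<close> alone would give a group of Heisenberg type.  The summand \<open>\<i>\<close> destroys that
  symmetry, and the coefficient 2 is large enough to keep all nonzero combinations invertible.
\<close>

definition J1 :: "hvec \<Rightarrow> hvec" where "J1 v = (\<i> * fst v, - \<i> * snd v)"
definition J2 :: "hvec \<Rightarrow> hvec" where "J2 v = (\<i> * fst v - 2 * snd v, \<i> * snd v + 2 * fst v)"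
definition J :: "real^2 \<Rightarrow> hvec \<Rightarrow> hvec" where "J w v = (w $ 1) *\<^sub>R J1 v + (w $ 2) *\<^sub>R J2 v"
definition br :: "hvec \<Rightarrow> hvec \<Rightarrow> real^2" where "br a b = vector [J1 a \<bullet> b, J2 a \<bullet> b]"

lemma J_add_left: "J (w + w') v = J w v + J w' v"
  and J_add_right: "J w (v + v') = J w v + J w v'"
  and J_scaleR_left: "J (c *\<^sub>R w) v = c *\<^sub>R J w v"
  and J_scaleR_right: "J w (c *\<^sub>R v) = c *\<^sub>R J w v"
  by (auto simp: J_def J1_def J2_def prod_eq_iff algebra_simps)

lemma bounded_bilinear_J: "bounded_bilinear J"
  unfolding bilinear_conv_bounded_bilinear[symmetric] bilinear_def linear_iff
  by (auto simp: J_add_left J_add_right J_scaleR_left J_scaleR_right)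

interpretation J: bounded_bilinear J by (rule bounded_bilinear_J)

lemma bounded_bilinear_br: "bounded_bilinear br"
  unfolding bilinear_conv_bounded_bilinear[symmetric] bilinear_def linear_iff
  by (auto simp: br_def J1_def J2_def vec_eq_iff forall_2 inner_prod_def inner_complex_def algebra_simps)

interpretation br: bounded_bilinear br by (rule bounded_bilinear_br)

lemma inner_br: "w \<bullet> br a b = J w a \<bullet> b"
  by (simp add: br_def J_def inner_vec_def sum_2 inner_add_left)

lemma J_skew: "J w a \<bullet> b = - (a \<bullet> J w b)"
  by (simp add: J_def J1_def J2_def inner_prod_def inner_complex_def algebra_simps)

lemma J_self [simp]: "J w a \<bullet> a = 0"
  using J_skew[of w a a] by (simp add: inner_commute)

lemma br_self [simp]: "br a a = 0"
  by (simp add: br_def J1_def J2_def vec_eq_iff forall_2 inner_prod_def inner_complex_def algebra_simps)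

lemma br_antisym: "br a b = - br b a"
  by (simp add: br_def J1_def J2_def vec_eq_iff forall_2 inner_prod_def inner_complex_def algebra_simps)

lemma norm_J_le: "norm (J w a) \<le> 4 * norm w * norm a"
proof -
  have "norm (J1 a) = norm a" by (simp add: J1_def norm_prod_def norm_mult)
  moreover have "norm (J2 a) \<le> 3 * norm a"
  proof -
    have "J2 a = (\<i> * fst a, \<i> * snd a) + 2 *\<^sub>R (- snd a, fst a)"
      by (simp add: J2_def scaleR_conv_of_real)
    also have "norm \<dots> \<le> norm (\<i> * fst a, \<i> * snd a) + norm (2 *\<^sub>R (- snd a, fst a))"
      by (rule norm_triangle_ineq)
    also have "norm (2 *\<^sub>R (- snd a, fst a)) = 2 * norm (- snd a, fst a)" by (rule norm_scaleR[THEN trans]) simp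
    also have "norm (\<i> * fst a, \<i> * snd a) + 2 * norm (- snd a, fst a) = 3 * norm a"
      by (simp add: norm_prod_def norm_mult add.commute)
    finally show ?thesis .
  qed
  moreover have "norm (J w a) \<le> \<bar>w $ 1\<bar> * norm (J1 a) + \<bar>w $ 2\<bar> * norm (J2 a)"
    unfolding J_def using norm_triangle_ineq[of "(w $ 1) *\<^sub>R J1 a" "(w $ 2) *\<^sub>R J2 a"] by simp
  moreover have "\<bar>w $ 1\<bar> * norm (J1 a) + \<bar>w $ 2\<bar> * norm (J2 a) \<le> norm w * norm a + norm w * (3 * norm a)"
    using calculation component_le_norm_cart[of w] by (intro add_mono mult_mono) auto
  ultimately show ?thesis by (simp add: mult_ac)
qed

lemma norm_br_le: "norm (br a b) \<le> 4 * norm a * norm b"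
proof (cases "br a b = 0")
  case False
  have "norm (br a b) * norm (br a b) = J (br a b) a \<bullet> b"
    by (simp add: inner_br[symmetric] power2_norm_eq_inner[symmetric] power2_eq_square)
  also have "\<dots> \<le> norm (J (br a b) a) * norm b" by (rule norm_cauchy_schwarz)
  also have "\<dots> \<le> 4 * norm (br a b) * norm a * norm b" by (intro mult_right_mono norm_J_le) auto
  finally have "norm (br a b) * norm (br a b) \<le> norm (br a b) * (4 * norm a * norm b)" by (simp add: mult_ac)
  then show ?thesis using False by (simp add: mult_le_cancel_left)
qed simp

section \<open>The flow of a covector\<close>

text \<open>
  The linear part \<open>L = J w - w\<^sub>2 \<i>\<close> satisfies \<open>L\<^sup>2 = - (freq w)\<^sup>2\<close>.
\<close>

definition freq :: "real^2 \<Rightarrow> real" where "freq w = sqrt ((w $ 1)\<^sup>2 + 4 * (w $ 2)\<^sup>2)"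

text \<open>
  The one-parameter group \<open>exp (\<theta> (J w))\<close> in closed form: \<open>J w\<close> is the sum of the commuting maps
  \<open>w\<^sub>2 \<i>\<close> and \<open>L\<close> above.  For \<open>freq w = 0\<close> also \<open>w = 0\<close>, and then the term with the quotient by 0
  vanishes as it should.
\<close>

definition flow :: "real^2 \<Rightarrow> real \<Rightarrow> hvec \<Rightarrow> hvec" where
  "flow w \<theta> v =
    (exp (\<i> * of_real (w $ 2) * of_real \<theta>) * (cos (of_real (freq w) * of_real \<theta>) * fst v
       + sin (of_real (freq w) * of_real \<theta>) / of_real (freq w) * (\<i> * of_real (w $ 1) * fst v - 2 * of_real (w $ 2) * snd v)),
     exp (\<i> * of_real (w $ 2) * of_real \<theta>) * (cos (of_real (freq w) * of_real \<theta>) * snd v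
       + sin (of_real (freq w) * of_real \<theta>) / of_real (freq w) * (2 * of_real (w $ 2) * fst v - \<i> * of_real (w $ 1) * snd v)))"

lemma flow_0 [simp]: "flow w 0 v = v"
  by (simp add: flow_def)

lemma flow_has_vector_derivative: "((\<lambda>\<theta>. flow w \<theta> v) has_vector_derivative J w (flow w \<theta> v)) (at \<theta>)"
proof (cases "freq w = 0")
  case True
  then have "(w $ 1)\<^sup>2 + 4 * (w $ 2)\<^sup>2 = 0" by (simp add: freq_def)
  moreover have "(w $ 1)\<^sup>2 \<ge> 0" "(w $ 2)\<^sup>2 \<ge> 0" by auto
  ultimately have "(w $ 1)\<^sup>2 = 0" "(w $ 2)\<^sup>2 = 0" by linarith+
  then have "w $ 1 = 0" "w $ 2 = 0" by auto
  then show ?thesis by (simp add: flow_def J_def True)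
next
  case False
  define \<omega> :: complex where "\<omega> = of_real (freq w)"
  define x :: complex where "x = of_real (w $ 1)"
  define y :: complex where "y = of_real (w $ 2)"
  have \<omega>0: "\<omega> \<noteq> 0" using False by (simp add: \<omega>_def)
  have "(freq w)\<^sup>2 = (w $ 1)\<^sup>2 + 4 * (w $ 2)\<^sup>2" by (simp add: freq_def)
  then have "of_real ((freq w)\<^sup>2) = (of_real ((w $ 1)\<^sup>2 + 4 * (w $ 2)\<^sup>2) :: complex)" by simp
  then have \<omega>: "\<omega> * \<omega> = x * x + 4 * y * y" by (simp add: \<omega>_def x_def y_def power2_eq_square)
  let ?t = "of_real \<theta> :: complex"
  let ?E = "exp (\<i> * y * ?t)" and ?C = "cos (\<omega> * ?t)" and ?S = "sin (\<omega> * ?t) / \<omega>"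
  let ?l1 = "\<i> * x * fst v - 2 * y * snd v" and ?l2 = "2 * y * fst v - \<i> * x * snd v"
  have gen: "((\<lambda>\<theta>. exp (\<i> * y * of_real \<theta>) * (cos (\<omega> * of_real \<theta>) * u + sin (\<omega> * of_real \<theta>) / \<omega> * l))
      has_vector_derivative (\<i> * y * (?E * (?C * u + ?S * l)) + ?E * (?C * l - \<omega> * \<omega> * ?S * u))) (at \<theta>)" for u l
  proof -
    have "((\<lambda>z. exp (\<i> * y * z) * (cos (\<omega> * z) * u + sin (\<omega> * z) / \<omega> * l))
      has_field_derivative (\<i> * y * (?E * (?C * u + ?S * l)) + ?E * (?C * l - \<omega> * \<omega> * ?S * u))) (at ?t)"
      using \<omega>0 by (auto intro!: derivative_eq_intros simp: field_simps)
    from has_vector_derivative_real_field[OF this] show ?thesis by simp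
  qed
  have fl: "flow w = (\<lambda>\<theta> v. (exp (\<i> * y * of_real \<theta>) * (cos (\<omega> * of_real \<theta>) * fst v + sin (\<omega> * of_real \<theta>) / \<omega> * (\<i> * x * fst v - 2 * y * snd v)),
      exp (\<i> * y * of_real \<theta>) * (cos (\<omega> * of_real \<theta>) * snd v + sin (\<omega> * of_real \<theta>) / \<omega> * (2 * y * fst v - \<i> * x * snd v))))"
    by (simp add: flow_def x_def y_def \<omega>_def fun_eq_iff)
  have "((\<lambda>\<theta>. flow w \<theta> v) has_vector_derivative
     (\<i> * y * (?E * (?C * fst v + ?S * ?l1)) + ?E * (?C * ?l1 - \<omega> * \<omega> * ?S * fst v),
      \<i> * y * (?E * (?C * snd v + ?S * ?l2)) + ?E * (?C * ?l2 - \<omega> * \<omega> * ?S * snd v))) (at \<theta>)"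
    unfolding fl by (intro has_vector_derivative_Pair gen)
  also have "(\<i> * y * (?E * (?C * fst v + ?S * ?l1)) + ?E * (?C * ?l1 - \<omega> * \<omega> * ?S * fst v),
      \<i> * y * (?E * (?C * snd v + ?S * ?l2)) + ?E * (?C * ?l2 - \<omega> * \<omega> * ?S * snd v)) = J w (flow w \<theta> v)"
  proof -
    have Jw: "J w u = (\<i> * x * fst u + y * (\<i> * fst u - 2 * snd u), - \<i> * x * snd u + y * (\<i> * snd u + 2 * fst u))" for u
      by (simp add: J_def J1_def J2_def x_def y_def scaleR_conv_of_real algebra_simps)
    have ii: "\<i> * (\<i> * z) = - z" for z :: complex by (simp add: mult.assoc[symmetric])
    show ?thesis
      unfolding \<omega> unfolding Jw fl fst_conv snd_conv prod.inject
      by (simp add: ring_distribs right_diff_distrib left_diff_distrib mult_ac ii)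
  qed
  finally show ?thesis .
qed

text \<open>
  The bound for a skew linear part without forcing, applied forwards and backwards in time.
\<close>

lemma skew_flow_norm:
  assumes "\<And>t. (f has_vector_derivative J w (f t)) (at t)"
  shows "norm (f t) = norm (f 0)"
proof -
  have 1: "norm (g t) \<le> norm (g 0)" if "\<And>t. (g has_vector_derivative J w (g t)) (at t)" for g w t
    using forced_skew_bound[of g "J w" "\<lambda>_. 0" 0 t] that by simp
  have "((\<lambda>s. f (t - s)) has_vector_derivative J (- w) (f (t - s))) (at s)" for s
  proof -
    have "((\<lambda>s. t - s) has_vector_derivative -1) (at s)" by (auto intro!: derivative_eq_intros)
    from vector_diff_chain_at[OF this assms] show ?thesis by (simp add: o_def J.minus_left)
  qed
  from 1[OF this, of t] 1[OF assms] show ?thesis by (simp add: antisym)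
qed

lemma flow_unique:
  assumes "\<And>t. (f has_vector_derivative J w (f t)) (at t)"
  shows "f t = flow w t (f 0)"
proof -
  have "((\<lambda>t. f t - flow w t (f 0)) has_vector_derivative J w (f t - flow w t (f 0))) (at t)" for t
    using has_vector_derivative_diff[OF assms flow_has_vector_derivative] by (simp add: J.diff_right)
  from skew_flow_norm[OF this, of t] show ?thesis by simp
qed

lemma norm_flow [simp]: "norm (flow w t v) = norm v"
  using skew_flow_norm[of "\<lambda>t. flow w t v" w t, OF flow_has_vector_derivative] by simp

lemma flow_diff: "flow w t (u - v) = flow w t u - flow w t v"
proof -
  have "((\<lambda>t. flow w t u - flow w t v) has_vector_derivative J w (flow w t u - flow w t v)) (at t)" for t
    using has_vector_derivative_diff[OF flow_has_vector_derivative flow_has_vector_derivative] by (simp add: J.diff_right)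
  from flow_unique[OF this, of t] show ?thesis by simp
qed

lemma flow_add: "flow w (s + t) v = flow w s (flow w t v)"
proof -
  have "((\<lambda>s. flow w (s + t) v) has_vector_derivative J w (flow w (s + t) v)) (at s)" for s
  proof -
    have "((\<lambda>s. s + t) has_vector_derivative 1) (at s)"
      unfolding has_real_derivative_iff_has_vector_derivative[symmetric] by (auto intro!: derivative_eq_intros)
    from vector_diff_chain_at[OF this flow_has_vector_derivative] show ?thesis by (simp add: o_def)
  qed
  from flow_unique[OF this, of s] show ?thesis by simp
qed

text \<open>
  The difference of two orbits solves the equation of the first flow with a forcing term that is
  proportional to \<open>w - w'\<close>.
\<close>

lemma flow_Lipschitz:
  "norm (flow w t v - flow w' t v') \<le> norm (v - v') + 4 * norm (w - w') * norm v' * \<bar>t\<bar>"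
proof -
  have "((\<lambda>t. flow w t v - flow w' t v') has_vector_derivative J w (flow w t v - flow w' t v') + J (w - w') (flow w' t v')) (at t)" for t
    using has_vector_derivative_diff[OF flow_has_vector_derivative flow_has_vector_derivative]
    by (simp add: J.diff_right J.diff_left)
  from forced_skew_bound[OF this, of "4 * norm (w - w') * norm v'" t] show ?thesis
    using norm_J_le[of "w - w'"] by (simp add: order_trans[OF norm_J_le])
qed

lemma norm_flow_diff_le: "norm (flow w t v - v) \<le> 4 * norm w * norm v * \<bar>t\<bar>"
proof -
  have "((\<lambda>_. v) has_vector_derivative J 0 v) (at t)" for t by (simp add: J.zero_left)
  from flow_unique[OF this, of t] have "flow 0 t v = v" by simp
  then show ?thesis using flow_Lipschitz[of w t v 0 v] by simp
qed

section \<open>Families of bounded Lipschitz maps\<close>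

text \<open>
  One constant bounds both values and difference quotients, so that products and integrals of
  such maps can be estimated without derivatives with respect to \<open>p\<close>.
\<close>

definition bdd_lip :: "'p::real_normed_vector set \<Rightarrow> real \<Rightarrow> ('p \<Rightarrow> 'a::real_normed_vector) \<Rightarrow> bool"
  where "bdd_lip S c f \<longleftrightarrow> (\<forall>p\<in>S. norm (f p) \<le> c) \<and> (\<forall>p\<in>S. \<forall>q\<in>S. norm (f p - f q) \<le> c * norm (p - q))"

lemma bdd_lip_mono:
  assumes "bdd_lip S c f" "c \<le> c'" shows "bdd_lip S c' f"
  unfolding bdd_lip_def
proof (intro conjI ballI)
  fix p q assume "p \<in> S" "q \<in> S"
  then have "norm (f p - f q) \<le> c * norm (p - q)" "norm (f p) \<le> c" using assms by (auto simp: bdd_lip_def)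
  moreover have "c * norm (p - q) \<le> c' * norm (p - q)" using assms by (intro mult_right_mono) auto
  ultimately show "norm (f p - f q) \<le> c' * norm (p - q)" by linarith
qed (use assms in \<open>force simp: bdd_lip_def\<close>)

lemma bdd_lip_add: 
  assumes "bdd_lip S c f" "bdd_lip S c' g" shows "bdd_lip S (c + c') (\<lambda>p. f p + g p)"
  unfolding bdd_lip_def
proof (intro conjI ballI)
  fix p q assume "p \<in> S" "q \<in> S"
  have "f p + g p - (f q + g q) = (f p - f q) + (g p - g q)" by simp
  then have "norm (f p + g p - (f q + g q)) \<le> norm (f p - f q) + norm (g p - g q)"
    by (simp only: norm_triangle_ineq)
  also have "\<dots> \<le> c * norm (p - q) + c' * norm (p - q)"
    using assms \<open>p \<in> S\<close> \<open>q \<in> S\<close> by (intro add_mono) (auto simp: bdd_lip_def)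
  finally show "norm (f p + g p - (f q + g q)) \<le> (c + c') * norm (p - q)" by (simp add: distrib_right)
next
  fix p assume "p \<in> S"
  then show "norm (f p + g p) \<le> c + c'" 
    using assms by (intro order_trans[OF norm_triangle_ineq add_mono]) (auto simp: bdd_lip_def)
qed

lemma bdd_lip_bilinear:
  assumes B: "bounded_bilinear B" and K: "K \<ge> 0" "\<And>a b. norm (B a b) \<le> norm a * norm b * K"
    and f: "bdd_lip S c f" and g: "bdd_lip S c' g" and c: "c \<ge> 0" "c' \<ge> 0"
  shows "bdd_lip S (2 * K * c * c') (\<lambda>p. B (f p) (g p))"
proof -
  interpret bounded_bilinear B by fact
  show ?thesis
    unfolding bdd_lip_def
  proof (intro conjI ballI)
    fix p q assume pq: "p \<in> S" "q \<in> S"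
    have "B (f p) (g p) - B (f q) (g q) = B (f p - f q) (g p) + B (f q) (g p - g q)"
      by (simp add: diff_left diff_right)
    also have "norm \<dots> \<le> norm (f p - f q) * norm (g p) * K + norm (f q) * norm (g p - g q) * K"
      by (rule order_trans[OF norm_triangle_ineq add_mono[OF K(2) K(2)]])
    also have "\<dots> \<le> (c * norm (p - q)) * c' * K + c * (c' * norm (p - q)) * K"
      using f g pq c K by (intro add_mono mult_right_mono mult_mono) (auto simp: bdd_lip_def)
    finally show "norm (B (f p) (g p) - B (f q) (g q)) \<le> 2 * K * c * c' * norm (p - q)" by (simp add: mult_ac)
  next
    fix p assume p: "p \<in> S"
    have "norm (B (f p) (g p)) \<le> norm (f p) * norm (g p) * K" by (rule K)
    also have "\<dots> \<le> c * c' * K" using f g p c K by (intro mult_right_mono mult_mono) (auto simp: bdd_lip_def)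
    also have "\<dots> \<le> 2 * K * c * c'" using c K by simp
    finally show "norm (B (f p) (g p)) \<le> 2 * K * c * c'" .
  qed
qed

text \<open>
  The relation \<open>F \<theta> = O(\<theta>\<^sup>k)\<close> uniformly on \<open>S\<close>, for values and for Lipschitz constants at once.
  This is the form of Taylor remainders that volume comparison needs.
\<close>

definition lip_order :: "real set \<Rightarrow> 'p::real_normed_vector set \<Rightarrow> nat \<Rightarrow> (real \<Rightarrow> 'p \<Rightarrow> 'a::real_normed_vector) \<Rightarrow> bool"
  where "lip_order \<Theta> S k F \<longleftrightarrow> (\<exists>C\<ge>0. \<forall>\<theta>\<in>\<Theta>. bdd_lip S (C * \<theta> ^ k) (F \<theta>))"

lemma lip_order_cong: "lip_order \<Theta> S k F \<Longrightarrow> (\<And>\<theta> p. \<theta> \<in> \<Theta> \<Longrightarrow> p \<in> S \<Longrightarrow> F \<theta> p = G \<theta> p) \<Longrightarrow> lip_order \<Theta> S k G"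
  unfolding lip_order_def bdd_lip_def by (metis (no_types, lifting))

lemma lip_order_subset: "lip_order \<Theta> S k F \<Longrightarrow> \<Theta>' \<subseteq> \<Theta> \<Longrightarrow> lip_order \<Theta>' S k F"
  unfolding lip_order_def by blast

lemma lip_order_weaken:
  assumes "lip_order \<Theta> S k F" "j \<le> k" "\<Theta> \<subseteq> {0..1}" shows "lip_order \<Theta> S j F"
proof -
  obtain C where C: "C \<ge> 0" "\<And>\<theta>. \<theta> \<in> \<Theta> \<Longrightarrow> bdd_lip S (C * \<theta> ^ k) (F \<theta>)" using assms(1) by (auto simp: lip_order_def)
  have "bdd_lip S (C * \<theta> ^ j) (F \<theta>)" if "\<theta> \<in> \<Theta>" for \<theta>
  proof (rule bdd_lip_mono[OF C(2)[OF that]])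
    have "\<theta> ^ k \<le> \<theta> ^ j" using that assms(2,3) by (intro power_decreasing) auto
    then show "C * \<theta> ^ k \<le> C * \<theta> ^ j" using C by (intro mult_left_mono)
  qed
  then show ?thesis using C by (auto simp: lip_order_def)
qed

lemma lip_order_add:
  assumes "lip_order \<Theta> S k F" "lip_order \<Theta> S k G" shows "lip_order \<Theta> S k (\<lambda>\<theta> p. F \<theta> p + G \<theta> p)"
proof -
  obtain C where C: "C \<ge> 0" "\<And>\<theta>. \<theta> \<in> \<Theta> \<Longrightarrow> bdd_lip S (C * \<theta> ^ k) (F \<theta>)" using assms(1) by (auto simp: lip_order_def)
  obtain D where D: "D \<ge> 0" "\<And>\<theta>. \<theta> \<in> \<Theta> \<Longrightarrow> bdd_lip S (D * \<theta> ^ k) (G \<theta>)" using assms(2) by (auto simp: lip_order_def)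
  show ?thesis unfolding lip_order_def
    by (intro exI[of _ "C + D"] conjI ballI) (use C D bdd_lip_add[OF C(2) D(2)] in \<open>auto simp: distrib_right\<close>)
qed

lemma lip_order_bilinear:
  assumes B: "bounded_bilinear B" and F: "lip_order \<Theta> S k F" and G: "lip_order \<Theta> S l G" and \<Theta>: "\<Theta> \<subseteq> {0..}"
  shows "lip_order \<Theta> S (k + l) (\<lambda>\<theta> p. B (F \<theta> p) (G \<theta> p))"
proof -
  obtain C where C: "C \<ge> 0" "\<And>\<theta>. \<theta> \<in> \<Theta> \<Longrightarrow> bdd_lip S (C * \<theta> ^ k) (F \<theta>)" using assms(2) by (auto simp: lip_order_def)
  obtain D where D: "D \<ge> 0" "\<And>\<theta>. \<theta> \<in> \<Theta> \<Longrightarrow> bdd_lip S (D * \<theta> ^ l) (G \<theta>)" using assms(3) by (auto simp: lip_order_def)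
  obtain K where K: "K \<ge> 0" "\<And>a b. norm (B a b) \<le> norm a * norm b * K" using bounded_bilinear.nonneg_bounded[OF B] by blast
  have "bdd_lip S ((2 * K * C * D) * \<theta> ^ (k + l)) (\<lambda>p. B (F \<theta> p) (G \<theta> p))" if "\<theta> \<in> \<Theta>" for \<theta>
  proof -
    have "\<theta> \<ge> 0" using that \<Theta> by auto
    then have "bdd_lip S (2 * K * (C * \<theta> ^ k) * (D * \<theta> ^ l)) (\<lambda>p. B (F \<theta> p) (G \<theta> p))"
      using C D that by (intro bdd_lip_bilinear[OF B K]) auto
    then show ?thesis by (simp add: power_add mult_ac)
  qed
  then show ?thesis unfolding lip_order_def using C D K by (intro exI[of _ "2 * K * C * D"]) auto
qed

lemma lip_order_linear:
  assumes "bounded_linear h" "lip_order \<Theta> S k F" "\<Theta> \<subseteq> {0..}" shows "lip_order \<Theta> S k (\<lambda>\<theta> p. h (F \<theta> p))"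
proof -
  have 1: "lip_order \<Theta> S 0 (\<lambda>_ _. 1::real)" unfolding lip_order_def by (intro exI[of _ 1]) (auto simp: bdd_lip_def)
  have "bounded_bilinear (\<lambda>(c::real) x. c *\<^sub>R h x)"
    using bounded_bilinear.comp[OF bounded_bilinear_scaleR bounded_linear_ident assms(1)] .
  from lip_order_bilinear[OF this 1 assms(2,3)] show ?thesis by simp
qed

lemma lip_order_scale:
  assumes "lip_order \<Theta> S k F" "\<Theta> \<subseteq> {0..}" shows "lip_order \<Theta> S k (\<lambda>\<theta> p. c *\<^sub>R F \<theta> p)"
  by (rule lip_order_linear[OF bounded_linear_scaleR_right assms])

lemma lip_order_diff:
  assumes "lip_order \<Theta> S k F" "lip_order \<Theta> S k G" "\<Theta> \<subseteq> {0..}" shows "lip_order \<Theta> S k (\<lambda>\<theta> p. F \<theta> p - G \<theta> p)"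
  using lip_order_add[OF assms(1) lip_order_scale[OF assms(2,3), of "-1"]] by simp

lemma lip_order_power_scale:
  assumes "lip_order \<Theta> S k F" "\<Theta> \<subseteq> {0..}" shows "lip_order \<Theta> S (k + j) (\<lambda>\<theta> p. \<theta> ^ j *\<^sub>R F \<theta> p)"
proof -
  obtain C where C: "C \<ge> 0" "\<And>\<theta>. \<theta> \<in> \<Theta> \<Longrightarrow> bdd_lip S (C * \<theta> ^ k) (F \<theta>)" using assms(1) by (auto simp: lip_order_def)
  have "bdd_lip S (C * \<theta> ^ (k + j)) (\<lambda>p. \<theta> ^ j *\<^sub>R F \<theta> p)" if "\<theta> \<in> \<Theta>" for \<theta>
  proof -
    have t: "\<theta> \<ge> 0" using that assms by auto
    have *: "\<theta> ^ j * x \<le> C * \<theta> ^ (k + j) * y" if "x \<le> C * \<theta> ^ k * y" for x y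
      using mult_left_mono[OF that, of "\<theta> ^ j"] t by (simp add: power_add mult_ac)
    show ?thesis using C(2)[OF that] t *[of _ 1] *
      by (simp add: bdd_lip_def scaleR_diff_right[symmetric])
  qed
  then show ?thesis using C by (auto simp: lip_order_def)
qed

lemma lip_order_divide:
  assumes "lip_order \<Theta> S (k + j) (\<lambda>\<theta> p. \<theta> ^ j *\<^sub>R F \<theta> p)" "\<Theta> \<subseteq> {0<..}" shows "lip_order \<Theta> S k F"
proof -
  obtain C where C: "C \<ge> 0" "\<And>\<theta>. \<theta> \<in> \<Theta> \<Longrightarrow> bdd_lip S (C * \<theta> ^ (k + j)) (\<lambda>p. \<theta> ^ j *\<^sub>R F \<theta> p)" using assms(1) by (auto simp: lip_order_def)
  have "bdd_lip S (C * \<theta> ^ k) (F \<theta>)" if "\<theta> \<in> \<Theta>" for \<theta>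
  proof -
    have t: "\<theta> > 0" using that assms by auto
    have *: "x \<le> C * \<theta> ^ k * y" if "\<theta> ^ j * x \<le> C * \<theta> ^ (k + j) * y" for x y
    proof -
      have "\<theta> ^ j * x \<le> \<theta> ^ j * (C * \<theta> ^ k * y)" using that by (simp add: power_add mult_ac)
      then show ?thesis using t by (simp only: mult_le_cancel_left_pos zero_less_power)
    qed
    show ?thesis using C(2)[OF that] t *[of _ 1] *
      by (simp add: bdd_lip_def scaleR_diff_right[symmetric])
  qed
  then show ?thesis using C by (auto simp: lip_order_def)
qed

lemma lip_order_ident:
  assumes "bounded S" shows "lip_order \<Theta> S 0 (\<lambda>_ p. p)"
proof -
  obtain B where B: "\<And>p. p \<in> S \<Longrightarrow> norm p \<le> B" using assms bounded_iff by metis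
  have "bdd_lip S (max 1 B) (\<lambda>p. p)"
    unfolding bdd_lip_def
  proof (intro conjI ballI)
    fix p q assume "p \<in> S" "q \<in> S"
    show "norm (p - q) \<le> max 1 B * norm (p - q)" using mult_right_mono[of 1 "max 1 B" "norm (p - q)"] by simp
  qed (use B in \<open>auto simp: le_max_iff_disj\<close>)
  then show ?thesis unfolding lip_order_def by (intro exI[of _ "max 1 B"]) auto
qed

lemma vector_derivative_bound:
  fixes f :: "real \<Rightarrow> 'a::real_normed_vector"
  assumes "\<And>s. s \<in> {0..t} \<Longrightarrow> (f has_vector_derivative g s) (at s within {0..t})"
    "\<And>s. s \<in> {0..t} \<Longrightarrow> norm (g s) \<le> B" "t \<ge> 0"
  shows "norm (f t - f 0) \<le> B * t"
proof -
  have "norm (f t - f 0) \<le> B * norm (t - 0)"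
  proof (rule differentiable_bound[of "{0..t}" f "\<lambda>s h. h *\<^sub>R g s"])
    fix r :: real assume r: "r \<in> {0..t}"
    show "(f has_derivative (\<lambda>h. h *\<^sub>R g r)) (at r within {0..t})"
      using assms(1)[OF r] by (simp add: has_vector_derivative_def)
    have "B \<ge> 0" using order_trans[OF norm_ge_zero assms(2)[OF r]] .
    then show "onorm (\<lambda>h. h *\<^sub>R g r) \<le> B"
      using assms(2)[OF r] by (intro onorm_bound) (simp_all add: mult.commute[of B] mult_left_mono)
  qed (use assms(3) in auto)
  then show ?thesis using assms(3) by simp
qed

text \<open>
  Each integration in \<open>\<theta>\<close> gains one order, which is the induction step of a Taylor expansion.
\<close>

lemma lip_order_integrate:
  assumes d: "\<And>p \<theta>. p \<in> S \<Longrightarrow> \<theta> \<in> {0..1} \<Longrightarrow> ((\<lambda>\<theta>. F \<theta> p) has_vector_derivative G \<theta> p) (at \<theta>)"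
    and 0: "\<And>p. p \<in> S \<Longrightarrow> F 0 p = 0" and G: "lip_order {0..1} S k G"
  shows "lip_order {0..1} S (Suc k) F"
proof -
  obtain C where C: "C \<ge> 0" "\<And>\<theta>. \<theta> \<in> {0..1} \<Longrightarrow> bdd_lip S (C * \<theta> ^ k) (G \<theta>)" using G by (auto simp: lip_order_def)
  have "bdd_lip S (C * \<theta> ^ Suc k) (F \<theta>)" if \<theta>: "\<theta> \<in> {0..1}" for \<theta>
  proof -
    have pw: "C * s ^ k * x \<le> C * \<theta> ^ k * x" if "s \<in> {0..\<theta>}" "x \<ge> 0" for s x
      using that \<theta> C by (intro mult_right_mono mult_left_mono power_mono) auto
    show ?thesis
      unfolding bdd_lip_def
    proof (intro conjI ballI)
      fix p assume p: "p \<in> S"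
      have "norm (F \<theta> p - F 0 p) \<le> (C * \<theta> ^ k) * \<theta>"
      proof (rule vector_derivative_bound[of \<theta> "\<lambda>\<theta>. F \<theta> p" "\<lambda>\<theta>. G \<theta> p"])
        fix s assume s: "s \<in> {0..\<theta>}"
        show "((\<lambda>\<theta>. F \<theta> p) has_vector_derivative G s p) (at s within {0..\<theta>})"
          using d[OF p, of s] s \<theta> by (auto intro: has_vector_derivative_at_within)
        have "norm (G s p) \<le> C * s ^ k" using C(2)[of s] s \<theta> p by (auto simp: bdd_lip_def)
        also have "\<dots> \<le> C * \<theta> ^ k" using pw[OF s, of 1] by simp
        finally show "norm (G s p) \<le> C * \<theta> ^ k" .
      qed (use \<theta> in auto)
      then show "norm (F \<theta> p) \<le> C * \<theta> ^ Suc k" using 0[OF p] by (simp add: mult_ac)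
    next
      fix p q assume pq: "p \<in> S" "q \<in> S"
      have "norm ((F \<theta> p - F \<theta> q) - (F 0 p - F 0 q)) \<le> (C * \<theta> ^ k * norm (p - q)) * \<theta>"
      proof (rule vector_derivative_bound[of \<theta> "\<lambda>\<theta>. F \<theta> p - F \<theta> q" "\<lambda>\<theta>. G \<theta> p - G \<theta> q"])
        fix s assume s: "s \<in> {0..\<theta>}"
        show "((\<lambda>\<theta>. F \<theta> p - F \<theta> q) has_vector_derivative G s p - G s q) (at s within {0..\<theta>})"
          using d[OF pq(1), of s] d[OF pq(2), of s] s \<theta> by (auto intro: has_vector_derivative_at_within has_vector_derivative_diff)
        have "norm (G s p - G s q) \<le> C * s ^ k * norm (p - q)" using C(2)[of s] s \<theta> pq by (auto simp: bdd_lip_def)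
        also have "\<dots> \<le> C * \<theta> ^ k * norm (p - q)" using pw[OF s] by simp
        finally show "norm (G s p - G s q) \<le> C * \<theta> ^ k * norm (p - q)" .
      qed (use \<theta> in auto)
      then show "norm (F \<theta> p - F \<theta> q) \<le> C * \<theta> ^ Suc k * norm (p - q)" using 0[OF pq(1)] 0[OF pq(2)] by (simp add: mult_ac)
    qed
  qed
  then show ?thesis using C by (auto simp: lip_order_def)
qed

section \<open>Displacement along a flow\<close>

text \<open>
  A pair \<open>p\<close> consists of the horizontal velocity at time 0 and the covector; \<open>vel p\<close> is the velocity of
  the normal extremal with these data.  With \<open>\<gamma>\<close> any horizontal lift, \<open>disp p \<alpha> \<beta>\<close> is the
  group element \<open>\<gamma>(\<alpha>)\<^sup>-\<^sup>1 * \<gamma>(\<beta>)\<close>, which is the same for all lifts by left invariance.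
\<close>

definition vel :: "hpair \<Rightarrow> real \<Rightarrow> hvec" where "vel p \<theta> = flow (snd p) \<theta> (fst p)"
definition prim1 :: "hpair \<Rightarrow> real \<Rightarrow> hvec" where "prim1 p = prim (vel p)"
definition prim2 :: "hpair \<Rightarrow> real \<Rightarrow> real^2" where "prim2 p = prim (\<lambda>\<theta>. br (prim1 p \<theta>) (vel p \<theta>))"
definition disp :: "hpair \<Rightarrow> real \<Rightarrow> real \<Rightarrow> hpair"
  where "disp p \<alpha> \<beta> = (prim1 p \<beta> - prim1 p \<alpha>, (1/2) *\<^sub>R (prim2 p \<beta> - prim2 p \<alpha> - br (prim1 p \<alpha>) (prim1 p \<beta>)))"

lemma vel_deriv: "(vel p has_vector_derivative J (snd p) (vel p \<theta>)) (at \<theta>)"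
  using flow_has_vector_derivative[of "snd p" "fst p"] by (simp add: vel_def[abs_def])

lemma isCont_vel: "isCont (vel p) \<theta>"
  using vel_deriv has_vector_derivative_continuous by blast

lemma norm_vel [simp]: "norm (vel p \<theta>) = norm (fst p)"
  by (simp add: vel_def)

lemma prim1_deriv: "(prim1 p has_vector_derivative vel p \<theta>) (at \<theta>)"
  unfolding prim1_def by (rule prim_has_vector_derivative[OF isCont_vel])

lemma isCont_prim1: "isCont (prim1 p) \<theta>"
  using prim1_deriv has_vector_derivative_continuous by blast

lemma prim2_deriv: "(prim2 p has_vector_derivative br (prim1 p \<theta>) (vel p \<theta>)) (at \<theta>)"
  unfolding prim2_def by (rule prim_has_vector_derivative) (intro br.isCont isCont_prim1 isCont_vel)

lemma br_deriv:
  assumes "(f has_vector_derivative f') (at t within S)" "(g has_vector_derivative g') (at t within S)"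
  shows "((\<lambda>t. br (f t) (g t)) has_vector_derivative br (f t) g' + br f' (g t)) (at t within S)"
  using br.has_vector_derivative[OF assms] .

lemma disp_self [simp]: "disp p \<alpha> \<alpha> = (0, 0)"
  by (simp add: disp_def)

lemma disp_fst_deriv: "((\<lambda>\<beta>. fst (disp p \<alpha> \<beta>)) has_vector_derivative vel p \<beta>) (at \<beta>)"
  unfolding disp_def fst_conv using has_vector_derivative_diff[OF prim1_deriv has_vector_derivative_const] by simp

lemma disp_snd_deriv:
  "((\<lambda>\<beta>. snd (disp p \<alpha> \<beta>)) has_vector_derivative (1/2) *\<^sub>R br (fst (disp p \<alpha> \<beta>)) (vel p \<beta>)) (at \<beta>)"
proof -
  have "((\<lambda>\<beta>. (1/2) *\<^sub>R (prim2 p \<beta> - prim2 p \<alpha> - br (prim1 p \<alpha>) (prim1 p \<beta>))) has_vector_derivative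
     (1/2) *\<^sub>R (br (prim1 p \<beta>) (vel p \<beta>) - 0 - (br (prim1 p \<alpha>) (vel p \<beta>) + br 0 (prim1 p \<beta>)))) (at \<beta>)"
    by (intro bounded_linear.has_vector_derivative[OF bounded_linear_scaleR_right] has_vector_derivative_diff
        br_deriv prim1_deriv prim2_deriv has_vector_derivative_const)
  then show ?thesis unfolding disp_def snd_conv fst_conv by (simp add: br.diff_left br.zero_left)
qed

text \<open>
  The extremal equation is autonomous, so a shift of time only changes the velocity at time 0.  Both
  sides have the same derivative in \<open>\<beta>\<close> and vanish at \<open>\<beta> = \<alpha>\<close>.
\<close>

lemma disp_shift: "disp p (\<alpha> + c) (\<beta> + c) = disp (vel p c, snd p) \<alpha> \<beta>"
proof -
  let ?p' = "(vel p c, snd p)"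
  have v: "vel p (\<beta> + c) = vel ?p' \<beta>" for \<beta> by (simp add: vel_def flow_add)
  have shift: "((\<lambda>\<beta>. \<beta> + c) has_vector_derivative 1) (at \<beta>)" for \<beta> :: real
    unfolding has_real_derivative_iff_has_vector_derivative[symmetric] by (auto intro!: derivative_eq_intros)
  have 1: "fst (disp p (\<alpha> + c) (\<beta> + c)) = fst (disp ?p' \<alpha> \<beta>)" for \<beta>
  proof -
    define f where "f \<beta> = fst (disp p (\<alpha> + c) (\<beta> + c)) - fst (disp ?p' \<alpha> \<beta>)" for \<beta>
    have "(f has_vector_derivative 0) (at \<beta>)" for \<beta>
      unfolding f_def using has_vector_derivative_diff[OF vector_diff_chain_at[OF shift disp_fst_deriv[of p "\<alpha> + c"]] disp_fst_deriv[of ?p' \<alpha> \<beta>]]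
      by (simp add: o_def v)
    moreover have "f \<alpha> = 0" by (simp add: f_def)
    ultimately have "f \<beta> = 0"
      using has_vector_derivative_zero_constant[of UNIV f] by (metis UNIV_I convex_UNIV)
    then show ?thesis by (simp add: f_def)
  qed
  have 2: "snd (disp p (\<alpha> + c) (\<beta> + c)) = snd (disp ?p' \<alpha> \<beta>)"
  proof -
    define f where "f \<beta> = snd (disp p (\<alpha> + c) (\<beta> + c)) - snd (disp ?p' \<alpha> \<beta>)" for \<beta>
    have "(f has_vector_derivative 0) (at \<beta>)" for \<beta>
      unfolding f_def using has_vector_derivative_diff[OF vector_diff_chain_at[OF shift disp_snd_deriv[of p "\<alpha> + c"]] disp_snd_deriv[of ?p' \<alpha> \<beta>]]
      by (simp add: o_def v 1)
    moreover have "f \<alpha> = 0" by (simp add: f_def)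
    ultimately have "f \<beta> = 0"
      using has_vector_derivative_zero_constant[of UNIV f] by (metis UNIV_I convex_UNIV)
    then show ?thesis by (simp add: f_def)
  qed
  show ?thesis using 1[of \<beta>] 2 by (simp add: prod_eq_iff)
qed

section \<open>Expansion of the symmetric displacement\<close>

text \<open>
  Even and odd part of the velocity in time.  Only the even part contributes to the horizontal
  displacement over \<open>[-\<theta>, \<theta>]\<close>, so its Taylor expansion lacks every second term.
\<close>

definition vel_even :: "real \<Rightarrow> hpair \<Rightarrow> hvec" where "vel_even \<theta> p = (1/2) *\<^sub>R (vel p \<theta> + vel p (- \<theta>))"
definition vel_odd :: "real \<Rightarrow> hpair \<Rightarrow> hvec" where "vel_odd \<theta> p = (1/2) *\<^sub>R (vel p \<theta> - vel p (- \<theta>))"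

lemma reflect_deriv:
  assumes "\<And>t. (f has_vector_derivative f' t) (at t)"
  shows "((\<lambda>t::real. f (- t)) has_vector_derivative - f' (- t)) (at t)"
proof -
  have "(uminus has_vector_derivative (-1::real)) (at t)"
    using has_vector_derivative_minus[OF has_vector_derivative_id, of "at t"] by simp
  from vector_diff_chain_at[OF this assms] show ?thesis by (simp add: o_def)
qed

lemma vel_even_deriv: "((\<lambda>\<theta>. vel_even \<theta> p) has_vector_derivative J (snd p) (vel_odd \<theta> p)) (at \<theta>)"
proof -
  have "((\<lambda>\<theta>. vel_even \<theta> p) has_vector_derivative (1/2) *\<^sub>R (J (snd p) (vel p \<theta>) + - J (snd p) (vel p (- \<theta>)))) (at \<theta>)"
    unfolding vel_even_def
    by (intro bounded_linear.has_vector_derivative[OF bounded_linear_scaleR_right] has_vector_derivative_add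
        vel_deriv reflect_deriv)
  then show ?thesis by (simp add: vel_odd_def J.scaleR_right J.diff_right)
qed

lemma vel_odd_deriv: "((\<lambda>\<theta>. vel_odd \<theta> p) has_vector_derivative J (snd p) (vel_even \<theta> p)) (at \<theta>)"
proof -
  have "((\<lambda>\<theta>. vel_odd \<theta> p) has_vector_derivative (1/2) *\<^sub>R (J (snd p) (vel p \<theta>) - - J (snd p) (vel p (- \<theta>)))) (at \<theta>)"
    unfolding vel_odd_def
    by (intro bounded_linear.has_vector_derivative[OF bounded_linear_scaleR_right] has_vector_derivative_diff
        vel_deriv reflect_deriv)
  then show ?thesis by (simp add: vel_even_def J.scaleR_right J.add_right)
qed

lemma symdisp_fst_deriv: "((\<lambda>\<theta>. fst (disp p (- \<theta>) \<theta>)) has_vector_derivative 2 *\<^sub>R vel_even \<theta> p) (at \<theta>)"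
  unfolding disp_def fst_conv
  using has_vector_derivative_diff[OF prim1_deriv reflect_deriv[of "prim1 p" "vel p", OF prim1_deriv], of p \<theta>] by (simp add: vel_even_def)

text \<open>
  The two ends of the interval move in opposite directions; in the sum of their contributions the
  bracket with the even part of the velocity cancels.
\<close>

lemma symdisp_snd_deriv: "((\<lambda>\<theta>. snd (disp p (- \<theta>) \<theta>)) has_vector_derivative br (fst (disp p (- \<theta>) \<theta>)) (vel_odd \<theta> p)) (at \<theta>)"
proof -
  have "((\<lambda>\<theta>. snd (disp p (- \<theta>) \<theta>)) has_vector_derivative
     (1/2) *\<^sub>R (br (prim1 p \<theta>) (vel p \<theta>) - - br (prim1 p (- \<theta>)) (vel p (- \<theta>))
       - (br (prim1 p (- \<theta>)) (vel p \<theta>) + br (- vel p (- \<theta>)) (prim1 p \<theta>)))) (at \<theta>)"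
    unfolding disp_def snd_conv
    by (intro bounded_linear.has_vector_derivative[OF bounded_linear_scaleR_right] has_vector_derivative_diff
        br_deriv prim1_deriv prim2_deriv reflect_deriv)
  then show ?thesis
    by (simp add: disp_def vel_odd_def br.scaleR_right br.diff_left br.diff_right br.minus_left
        br_antisym[of "vel p (- \<theta>)" "prim1 p \<theta>"] algebra_simps)
qed

text \<open>
  Both remainders are two orders smaller than the main terms \<open>2 \<theta> \<eta>\<close> and \<open>(2/3) \<theta>\<^sup>3 [\<eta>, J \<tau> \<eta>]\<close>, for
  reasons of parity.  This relative error \<open>O(\<theta>\<^sup>2)\<close> is what makes a first-order change of volume
  visible.
\<close>

lemma lip_order_symdisp:
  assumes S: "bounded S"
  shows "lip_order {0..1} S 3 (\<lambda>\<theta> p. fst (disp p (- \<theta>) \<theta>) - (2 * \<theta>) *\<^sub>R fst p)"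
    and "lip_order {0..1} S 5 (\<lambda>\<theta> p. snd (disp p (- \<theta>) \<theta>) - ((2/3) * \<theta> ^ 3) *\<^sub>R br (fst p) (J (snd p) (fst p)))"
proof -
  let ?I = "{0..1::real}"
  have I: "?I \<subseteq> {0..}" "?I \<subseteq> {0..1}" by auto
  obtain R where R: "R \<ge> 1" "\<And>p. p \<in> S \<Longrightarrow> norm p \<le> R"
  proof -
    obtain B where "\<And>p. p \<in> S \<Longrightarrow> norm p \<le> B" using S bounded_iff by metis
    then show thesis by (intro that[of "max 1 B"]) (auto simp: le_max_iff_disj)
  qed
  have nf: "norm (fst p) \<le> norm p" "norm (snd p) \<le> norm p" for p :: "hpair"
    using norm_fst_le[of "fst p" "snd p"] norm_snd_le[of "snd p" "fst p"] by simp_all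
  have id: "lip_order ?I S 0 (\<lambda>_ p. p)" by (rule lip_order_ident[OF S])
  have F: "lip_order ?I S 0 (\<lambda>_. fst)" and W: "lip_order ?I S 0 (\<lambda>_. snd)"
    using lip_order_linear[OF bounded_linear_fst id I(1)] lip_order_linear[OF bounded_linear_snd id I(1)] by auto
  have vel: "bdd_lip S (R + 4 * R) (\<lambda>p. vel p \<theta>)" if "\<bar>\<theta>\<bar> \<le> 1" for \<theta>
    unfolding bdd_lip_def
  proof (intro conjI ballI)
    fix p assume "p \<in> S"
    from R(2)[OF this] show "norm (vel p \<theta>) \<le> R + 4 * R" using R(1) nf(1)[of p] unfolding norm_vel by linarith
  next
    fix p q assume pq: "p \<in> S" "q \<in> S"
    have "norm (vel p \<theta> - vel q \<theta>) \<le> norm (fst p - fst q) + 4 * norm (snd p - snd q) * norm (fst q) * \<bar>\<theta>\<bar>"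
      unfolding vel_def by (rule flow_Lipschitz)
    also have "\<dots> \<le> norm (p - q) + 4 * norm (p - q) * R * 1"
      using nf[of "p - q"] nf[of q] R(2)[OF pq(2)] R(1) that
      by (intro add_mono mult_mono) (auto intro: order_trans)
    also have "\<dots> \<le> R * norm (p - q) + 4 * norm (p - q) * R * 1" using R mult_right_mono[of 1 R "norm (p - q)"] by simp
    also have "\<dots> = (R + 4 * R) * norm (p - q)" by (simp add: algebra_simps)
    finally show "norm (vel p \<theta> - vel q \<theta>) \<le> (R + 4 * R) * norm (p - q)" .
  qed
  have v1: "lip_order ?I S 0 (\<lambda>\<theta> p. vel p \<theta>)" and v2: "lip_order ?I S 0 (\<lambda>\<theta> p. vel p (- \<theta>))"
    unfolding lip_order_def using vel R by (auto intro!: exI[of _ "R + 4 * R"])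
  have e0: "lip_order ?I S 0 vel_even" unfolding vel_even_def[abs_def] by (intro lip_order_scale lip_order_add v1 v2 I)
  have Jb: "lip_order ?I S k (\<lambda>\<theta> p. J (snd p) (F \<theta> p))" if "lip_order ?I S k F" for k F
    using lip_order_bilinear[OF bounded_bilinear_J W that I(1)] by simp
  have odd0: "vel_odd 0 p = 0" and even0: "vel_even 0 p - fst p = 0" for p
    by (simp_all add: vel_odd_def vel_even_def vel_def scaleR_add_right[symmetric] scaleR_half_double)
  \<comment> \<open>The even and the odd part are derivatives of each other up to \<open>J \<tau>\<close>; alternating integration
    raises the order of the remainders.\<close>
  have o1: "lip_order ?I S 1 vel_odd"
    using lip_order_integrate[OF vel_odd_deriv odd0 Jb[OF e0]] by simp
  have e2: "lip_order ?I S 2 (\<lambda>\<theta> p. vel_even \<theta> p - fst p)"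
  proof -
    have "((\<lambda>\<theta>. vel_even \<theta> p - fst p) has_vector_derivative J (snd p) (vel_odd \<theta> p)) (at \<theta>)" for p \<theta>
      using has_vector_derivative_diff[OF vel_even_deriv has_vector_derivative_const] by simp
    from lip_order_integrate[OF this even0 Jb[OF o1]] show ?thesis by (simp add: numeral_2_eq_2)
  qed
  have lin: "((\<lambda>\<theta>. (c * \<theta>) *\<^sub>R x) has_vector_derivative c *\<^sub>R x) (at \<theta>)" for c \<theta> and x :: hvec
  proof -
    have "((\<lambda>\<theta>. c * \<theta>) has_real_derivative c) (at \<theta>)" by (auto intro!: derivative_eq_intros)
    then show ?thesis by (auto intro!: derivative_eq_intros simp: has_real_derivative_iff_has_vector_derivative)
  qed
  have o3: "lip_order ?I S 3 (\<lambda>\<theta> p. vel_odd \<theta> p - \<theta> *\<^sub>R J (snd p) (fst p))"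
  proof -
    have "((\<lambda>\<theta>. vel_odd \<theta> p - \<theta> *\<^sub>R J (snd p) (fst p)) has_vector_derivative J (snd p) (vel_even \<theta> p - fst p)) (at \<theta>)" for p \<theta>
      using has_vector_derivative_diff[OF vel_odd_deriv lin[of 1]] by (simp add: J.diff_right)
    from lip_order_integrate[OF this _ Jb[OF e2]] show ?thesis by (simp add: odd0 eval_nat_numeral)
  qed
  show X3: "lip_order ?I S 3 (\<lambda>\<theta> p. fst (disp p (- \<theta>) \<theta>) - (2 * \<theta>) *\<^sub>R fst p)"
  proof -
    have "((\<lambda>\<theta>. fst (disp p (- \<theta>) \<theta>) - (2 * \<theta>) *\<^sub>R fst p) has_vector_derivative 2 *\<^sub>R (vel_even \<theta> p - fst p)) (at \<theta>)" for p \<theta>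
      using has_vector_derivative_diff[OF symdisp_fst_deriv lin] by (simp add: scaleR_diff_right)
    from lip_order_integrate[OF this _ lip_order_scale[OF e2 I(1)]] show ?thesis by (simp add: eval_nat_numeral)
  qed
  have X1: "lip_order ?I S 1 (\<lambda>\<theta> p. 2 *\<^sub>R (\<theta> ^ 1 *\<^sub>R fst p))"
    using lip_order_scale[OF lip_order_power_scale[OF F I(1), of 1] I(1), of 2] by simp
  have G1: "lip_order ?I S 4 (\<lambda>\<theta> p. br (fst (disp p (- \<theta>) \<theta>) - (2 * \<theta>) *\<^sub>R fst p) (vel_odd \<theta> p))"
    using lip_order_bilinear[OF bounded_bilinear_br X3 o1 I(1)] by simp
  have G2: "lip_order ?I S 4 (\<lambda>\<theta> p. br (2 *\<^sub>R (\<theta> ^ 1 *\<^sub>R fst p)) (vel_odd \<theta> p - \<theta> *\<^sub>R J (snd p) (fst p)))"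
    using lip_order_bilinear[OF bounded_bilinear_br X1 o3 I(1)] by simp
  note G = lip_order_add[OF G1 G2]
  show "lip_order ?I S 5 (\<lambda>\<theta> p. snd (disp p (- \<theta>) \<theta>) - ((2/3) * \<theta> ^ 3) *\<^sub>R br (fst p) (J (snd p) (fst p)))"
  proof -
    have "((\<lambda>\<theta>. snd (disp p (- \<theta>) \<theta>) - ((2/3) * \<theta> ^ 3) *\<^sub>R br (fst p) (J (snd p) (fst p))) has_vector_derivative
       br (fst (disp p (- \<theta>) \<theta>) - (2 * \<theta>) *\<^sub>R fst p) (vel_odd \<theta> p)
       + br (2 *\<^sub>R (\<theta> ^ 1 *\<^sub>R fst p)) (vel_odd \<theta> p - \<theta> *\<^sub>R J (snd p) (fst p))) (at \<theta>)" for p \<theta>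
    proof -
      have "((\<lambda>\<theta>. (2/3) * \<theta> ^ 3) has_real_derivative 2 * \<theta>\<^sup>2) (at \<theta>)" by (auto intro!: derivative_eq_intros)
      then have "((\<lambda>\<theta>. ((2/3) * \<theta> ^ 3) *\<^sub>R x) has_vector_derivative (2 * \<theta>\<^sup>2) *\<^sub>R x) (at \<theta>)" for x :: "real^2"
        by (auto intro!: derivative_eq_intros simp: has_real_derivative_iff_has_vector_derivative)
      from has_vector_derivative_diff[OF symdisp_snd_deriv this] show ?thesis
        by (simp add: br.diff_left br.diff_right br.scaleR_left br.scaleR_right algebra_simps power2_eq_square)
    qed
    from lip_order_integrate[OF this _ G] show ?thesis by (simp add: eval_nat_numeral)
  qed
qed

section \<open>The Gram determinant\<close>

definition m11 :: "hvec \<Rightarrow> real" where "m11 X = J1 X \<bullet> J1 X"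
definition m12 :: "hvec \<Rightarrow> real" where "m12 X = J1 X \<bullet> J2 X"
definition m22 :: "hvec \<Rightarrow> real" where "m22 X = J2 X \<bullet> J2 X"
definition gram :: "hvec \<Rightarrow> real" where "gram X = m11 X * m22 X - m12 X * m12 X"

lemma m_eq:
  "m11 X = (norm (fst X))\<^sup>2 + (norm (snd X))\<^sup>2"
  "m12 X = (norm (fst X))\<^sup>2 - (norm (snd X))\<^sup>2"
  "m22 X = 5 * ((norm (fst X))\<^sup>2 + (norm (snd X))\<^sup>2) - 8 * Im (cnj (fst X) * snd X)"
  unfolding cmod_power2
  by (simp_all add: m11_def m12_def m22_def J1_def J2_def inner_prod_def inner_complex_def power2_eq_square algebra_simps)

text \<open>
  With \<open>n = |X|\<^sup>2\<close> the Gram determinant is at least \<open>4 (n - |a| |b|)\<^sup>2\<close> for \<open>X = (a, b)\<close>, and \<open>2 |a| |b| \<le> n\<close>.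
\<close>

lemma gram_ge: "gram X \<ge> norm X ^ 4"
proof -
  define p q m n where "p = norm (fst X)" and "q = norm (snd X)" and "m = Im (cnj (fst X) * snd X)" and "n = p\<^sup>2 + q\<^sup>2"
  have "\<bar>m\<bar> \<le> p * q"
    using abs_Im_le_cmod[of "cnj (fst X) * snd X"] by (simp add: m_def p_def q_def norm_mult)
  then have m: "m \<le> p * q" by simp
  have n: "n \<ge> 0" "2 * (p * q) \<le> n" using sum_squares_bound[of p q] by (auto simp: n_def)
  have "gram X = n * (5 * n - 8 * m) - (p\<^sup>2 - q\<^sup>2)\<^sup>2"
    by (simp add: gram_def m_eq p_def q_def m_def n_def power2_eq_square)
  also have "\<dots> \<ge> n * (5 * n - 8 * (p * q)) - (p\<^sup>2 - q\<^sup>2)\<^sup>2"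
    using m n by (intro diff_right_mono mult_left_mono) auto
  also have "n * (5 * n - 8 * (p * q)) - (p\<^sup>2 - q\<^sup>2)\<^sup>2 = 4 * (n - p * q)\<^sup>2"
    by (simp add: n_def power2_eq_square algebra_simps)
  also have "4 * (n - p * q)\<^sup>2 \<ge> 4 * (n / 2)\<^sup>2"
    using n by (intro mult_left_mono power_mono) auto
  also have "4 * (n / 2)\<^sup>2 = norm X ^ 4"
  proof -
    have "n = (norm X)\<^sup>2" by (simp add: n_def p_def q_def norm_prod_def)
    then show ?thesis by (simp add: power2_eq_square power4_eq_xxxx)
  qed
  finally show ?thesis .
qed

lemma gram_ge_1: "norm X \<ge> 1 \<Longrightarrow> gram X \<ge> 1"
  using gram_ge[of X] one_le_power[of "norm X" 4] by linarith

lemma bounded_linear_J1: "bounded_linear J1" and bounded_linear_J2: "bounded_linear J2"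
proof -
  have "J1 = J (axis 1 1)" by (auto simp: J_def fun_eq_iff axis_def)
  then show "bounded_linear J1" using J.bounded_linear_right[of "axis 1 1"] by simp
  have "J2 = J (axis 2 1)" by (auto simp: J_def fun_eq_iff axis_def)
  then show "bounded_linear J2" using J.bounded_linear_right[of "axis 2 1"] by simp
qed

text \<open>
  Multiplication by the adjugate of the Gram matrix, which is the matrix of \<open>w \<mapsto> br X (J w X)\<close>.
\<close>

definition adj_gram :: "hvec \<Rightarrow> real^2 \<Rightarrow> real^2"
  where "adj_gram X z = (m22 X * z $ 1 - m12 X * z $ 2) *\<^sub>R axis 1 1 + (m11 X * z $ 2 - m12 X * z $ 1) *\<^sub>R axis 2 1"

lemma br_J_component:
  "br X (J w X) $ 1 = m11 X * w $ 1 + m12 X * w $ 2" "br X (J w X) $ 2 = m12 X * w $ 1 + m22 X * w $ 2"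
  by (simp_all add: br_def J_def m11_def m12_def m22_def inner_add_right inner_commute)

lemma adj_gram_component:
  "adj_gram X z $ 1 = m22 X * z $ 1 - m12 X * z $ 2" "adj_gram X z $ 2 = m11 X * z $ 2 - m12 X * z $ 1"
  by (simp_all add: adj_gram_def axis_def)

lemma adj_gram_br: "adj_gram X (br X (J w X)) = gram X *\<^sub>R w"
  by (simp add: vec_eq_iff forall_2 adj_gram_component br_J_component gram_def algebra_simps)

lemma br_adj_gram: "br X (J (adj_gram X z) X) = gram X *\<^sub>R z"
  by (simp add: vec_eq_iff forall_2 adj_gram_component br_J_component gram_def algebra_simps)

lemma adj_gram_diff: "adj_gram X (y - z) = adj_gram X y - adj_gram X z"
  by (simp add: vec_eq_iff forall_2 adj_gram_component algebra_simps)

section \<open>Volume of the model map\<close>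

text \<open>
  The leading terms of the symmetric displacement over an interval of length \<open>s\<close>.
\<close>

definition model :: "real \<Rightarrow> hpair \<Rightarrow> hpair"
  where "model s p = (s *\<^sub>R fst p, (s ^ 3 / 12) *\<^sub>R br (fst p) (J (snd p) (fst p)))"

lemma measure_scaleR_image_le:
  fixes A :: "'a::euclidean_space set"
  assumes "compact A" "s \<ge> 0"
  shows "measure lborel ((*\<^sub>R) s ` A) \<le> s ^ DIM('a) * measure lborel A"
  using assms by (intro measure_Lipschitz_image_le) (auto simp: scaleR_diff_right[symmetric])

lemma continuous_on_model: "continuous_on S (model s)"
  unfolding model_def[abs_def] by (intro continuous_intros br.continuous_on J.continuous_on)

text \<open>
  The model map is the composition of a map that is linear on each slice with fixed first component,
  with determinant \<open>(s\<^sup>3/12)\<^sup>2 gram\<close>, and the homothety by \<open>s\<close> in the first component, which has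
  dimension 4; together this gives \<open>s\<^sup>1\<^sup>0/144\<close> times \<open>gram\<close>.  For the lower bound the two sets exchange
  their roles in the comparison of slices.
\<close>

lemma measure_model:
  assumes S: "compact S" and s: "s > 0" and d: "\<And>p. p \<in> S \<Longrightarrow> d1 \<le> gram (fst p) \<and> gram (fst p) \<le> d2" and d1: "d1 > 0" and d2: "d2 > 0"
  shows "measure lborel (model s ` S) \<le> s ^ 10 / 144 * d2 * measure lborel S"
    and "s ^ 10 / 144 * d1 * measure lborel S \<le> measure lborel (model s ` S)"
proof -
  let ?g = "\<lambda>p. (fst p, (s ^ 3 / 12) *\<^sub>R br (fst p) (J (snd p) (fst p)))"
  let ?h = "\<lambda>p::hpair. (s *\<^sub>R fst p, snd p)"
  define S' where "S' = ?g ` S"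
  have hS': "?h ` S' = model s ` S" by (simp add: S'_def model_def[abs_def] image_image)
  have S': "compact S'" unfolding S'_def
    by (intro compact_continuous_image S continuous_intros br.continuous_on J.continuous_on)
  have hc: "compact (?h ` S')"
    by (intro compact_continuous_image S' continuous_intros)
  have slice: "measure lborel (Pair X -` S') = s ^ 6 / 144 * gram X * measure lborel (Pair X -` S)"
    if X: "X \<in> fst ` S" for X
  proof -
    define L where "L w = (s ^ 3 / 12) *\<^sub>R br X (J w X)" for w
    have L: "linear L" unfolding L_def
      by (intro linearI) (simp_all add: J.add_left J.scaleR_left br.add_right br.scaleR_right scaleR_add_right)
    have "Pair X -` S' = L ` (Pair X -` S)"
    proof (intro set_eqI iffI)
      fix w assume "w \<in> Pair X -` S'"
      then have "(X, w) \<in> ?g ` S" by (simp add: S'_def)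
      then obtain p where p: "p \<in> S" "(X, w) = ?g p" by (rule imageE)
      then have "(X, snd p) \<in> S" "w = L (snd p)" by (simp_all add: L_def)
      then show "w \<in> L ` (Pair X -` S)" by simp
    next
      fix w assume "w \<in> L ` (Pair X -` S)"
      then obtain v where v: "(X, v) \<in> S" "w = L v" by blast
      then have "(X, w) = ?g (X, v)" by (simp add: L_def)
      from image_eqI[of _ ?g, OF this v(1)] show "w \<in> Pair X -` S'" by (simp only: S'_def vimage_eq)
    qed
    moreover have "\<bar>det (matrix L)\<bar> = s ^ 6 / 144 * gram X"
    proof -
      have dL: "det (matrix L) = s ^ 6 / 144 * gram X"
        by (simp add: det_2 matrix_def L_def br_J_component axis_def gram_def algebra_simps eval_nat_numeral)
      have "gram X > 0" using d d1 X by force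
      then show ?thesis unfolding dL using s by (simp add: abs_mult)
    qed
    ultimately show ?thesis
      using measure_matrix_image[OF compact_slice(1)[OF S] L, of X] by simp
  qed
  have empty: "Pair X -` S' = {}" "Pair X -` S = {}" if "X \<notin> fst ` S" for X
  proof -
    have "(X, w) \<notin> S'" for w
    proof
      assume "(X, w) \<in> S'"
      then have "(X, w) \<in> ?g ` S" by (simp add: S'_def)
      then obtain p where "p \<in> S" "(X, w) = ?g p" by (rule imageE)
      then show False using that by auto
    qed
    then show "Pair X -` S' = {}" by blast
    show "Pair X -` S = {}" using that by force
  qed
  have 1: "measure lborel S' \<le> s ^ 6 / 144 * d2 * measure lborel S"
  proof (rule measure_le_slices[OF S S'])
    fix X
    show "measure lborel (Pair X -` S') \<le> s ^ 6 / 144 * d2 * measure lborel (Pair X -` S)"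
    proof (cases "X \<in> fst ` S")
      case True
      then have "gram X \<le> d2" using d by force
      then show ?thesis unfolding slice[OF True] using s by (intro mult_right_mono mult_left_mono) auto
    qed (simp add: empty)
  qed (use s d2 in auto)
  have 2: "measure lborel S \<le> 1 / (s ^ 6 / 144 * d1) * measure lborel S'"
  proof (rule measure_le_slices[OF S' S])
    fix X
    show "measure lborel (Pair X -` S) \<le> 1 / (s ^ 6 / 144 * d1) * measure lborel (Pair X -` S')"
    proof (cases "X \<in> fst ` S")
      case True
      then have "d1 \<le> gram X" using d by force
      then have "s ^ 6 / 144 * d1 * measure lborel (Pair X -` S) \<le> s ^ 6 / 144 * gram X * measure lborel (Pair X -` S)"
        using s by (intro mult_right_mono mult_left_mono) auto
      then show ?thesis unfolding slice[OF True] using s d1 by (simp add: field_simps)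
    qed (simp add: empty)
  qed (use s d1 in auto)
  have h_slice: "(\<lambda>x. (x, y)) -` ?h ` S' = (*\<^sub>R) s ` ((\<lambda>x. (x, y)) -` S')" for y
  proof (intro set_eqI iffI)
    fix x assume "x \<in> (\<lambda>x. (x, y)) -` ?h ` S'"
    then have "(x, y) \<in> ?h ` S'" by simp
    then obtain p where p: "p \<in> S'" "(x, y) = ?h p" by (rule imageE)
    then have "(fst p, y) \<in> S'" "x = s *\<^sub>R fst p" by simp_all
    then show "x \<in> (*\<^sub>R) s ` ((\<lambda>x. (x, y)) -` S')" by blast
  next
    fix x assume "x \<in> (*\<^sub>R) s ` ((\<lambda>x. (x, y)) -` S')"
    then obtain u where u: "(u, y) \<in> S'" "x = s *\<^sub>R u" by blast
    then have "(x, y) = ?h (u, y)" by simp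
    from image_eqI[of _ ?h, OF this u(1)] show "x \<in> (\<lambda>x. (x, y)) -` ?h ` S'" by (simp only: vimage_eq)
  qed
  have 3: "measure lborel (?h ` S') \<le> s ^ 4 * measure lborel S'"
  proof (rule measure_le_slices'[OF S' hc])
    fix y
    have "(\<lambda>x. (x, y)) -` ?h ` S' = (*\<^sub>R) s ` ((\<lambda>x. (x, y)) -` S')" by (rule h_slice)
    then show "measure lborel ((\<lambda>x. (x, y)) -` ?h ` S') \<le> s ^ 4 * measure lborel ((\<lambda>x. (x, y)) -` S')"
      using measure_scaleR_image_le[OF compact_slice(2)[OF S'], of s y] s by simp
  qed (use s in auto)
  have 4: "measure lborel S' \<le> (1 / s) ^ 4 * measure lborel (?h ` S')"
  proof (rule measure_le_slices'[OF hc S'])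
    fix y
    have "(\<lambda>x. (x, y)) -` S' = (*\<^sub>R) (1 / s) ` ((\<lambda>x. (x, y)) -` ?h ` S')"
      unfolding h_slice using s by (simp add: image_image)
    then show "measure lborel ((\<lambda>x. (x, y)) -` S') \<le> (1 / s) ^ 4 * measure lborel ((\<lambda>x. (x, y)) -` ?h ` S')"
      using measure_scaleR_image_le[OF compact_slice(2)[OF hc], of "1 / s" y] s by simp
  qed (use s in auto)
  have "measure lborel (?h ` S') \<le> s ^ 4 * (s ^ 6 / 144 * d2 * measure lborel S)"
    using 3 1 s by (meson mult_left_mono order_trans zero_le_power less_imp_le)
  then show "measure lborel (model s ` S) \<le> s ^ 10 / 144 * d2 * measure lborel S"
    unfolding hS' by (simp add: eval_nat_numeral mult_ac)
  have "s ^ 10 / 144 * d1 * measure lborel S \<le> s ^ 4 * measure lborel S'"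
    using 2 s d1 by (simp add: field_simps eval_nat_numeral)
  also have "\<dots> \<le> s ^ 4 * ((1 / s) ^ 4 * measure lborel (?h ` S'))"
    using 4 s by (intro mult_left_mono) auto
  also have "\<dots> = measure lborel (model s ` S)" unfolding hS' using s by (simp add: power_divide)
  finally show "s ^ 10 / 144 * d1 * measure lborel S \<le> measure lborel (model s ` S)" .
qed

text \<open>
  If \<open>f\<close> minus the identity has Lipschitz constant \<open>c < 1\<close>, then \<open>f\<close> is injective with Lipschitz constant
  \<open>1 + c\<close>, and its inverse has Lipschitz constant \<open>1 / (1 - c)\<close>.
\<close>

lemma measure_near_identity:
  fixes f :: "'a::euclidean_space \<Rightarrow> 'a"
  assumes S: "compact S" and c: "0 \<le> c" "c < 1" and f: "\<And>p q. p \<in> S \<Longrightarrow> q \<in> S \<Longrightarrow> norm ((f p - p) - (f q - q)) \<le> c * norm (p - q)"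
  shows "compact (f ` S)" "measure lborel (f ` S) \<le> (1 + c) ^ DIM('a) * measure lborel S"
    and "(1 - c) ^ DIM('a) * measure lborel S \<le> measure lborel (f ` S)"
proof -
  have up: "norm (f p - f q) \<le> (1 + c) * norm (p - q)" if "p \<in> S" "q \<in> S" for p q
    using f[OF that] norm_triangle_ineq[of "(f p - p) - (f q - q)" "p - q"] by (simp add: algebra_simps)
  have lo: "(1 - c) * norm (p - q) \<le> norm (f p - f q)" if "p \<in> S" "q \<in> S" for p q
    using f[OF that] norm_triangle_ineq2[of "p - q" "(f q - q) - (f p - p)"] norm_minus_commute[of "f q - q" "f p - p"] by (simp add: algebra_simps)
  have "continuous_on S f"
    by (rule lipschitz_on_continuous_on[of "1 + c"]) (use c up in \<open>auto simp: lipschitz_on_def dist_norm\<close>)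
  then show fS: "compact (f ` S)" by (rule compact_continuous_image[OF _ S])
  show "measure lborel (f ` S) \<le> (1 + c) ^ DIM('a) * measure lborel S"
    by (rule measure_Lipschitz_image_le[OF S _ up]) (use c in auto)
  have inj: "inj_on f S"
  proof (rule inj_onI)
    fix p q assume "p \<in> S" "q \<in> S" "f p = f q"
    then have "(1 - c) * norm (p - q) \<le> 0" using lo[of p q] by simp
    then show "p = q" using c by (simp add: mult_le_0_iff)
  qed
  define g where "g = inv_into S f"
  have gf: "g (f p) = p" if "p \<in> S" for p using that inj by (simp add: g_def)
  have gS: "g ` f ` S = S" using gf by (force simp: image_iff)
  have "measure lborel (g ` f ` S) \<le> (1 / (1 - c)) ^ DIM('a) * measure lborel (f ` S)"
  proof (rule measure_Lipschitz_image_le[OF fS])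
    fix x y assume "x \<in> f ` S" "y \<in> f ` S"
    then obtain p q where "p \<in> S" "q \<in> S" "x = f p" "y = f q" by blast
    then show "norm (g x - g y) \<le> 1 / (1 - c) * norm (x - y)" using lo[of p q] gf c by (simp add: field_simps)
  qed (use c in auto)
  then have "measure lborel S \<le> (1 / (1 - c)) ^ DIM('a) * measure lborel (f ` S)" by (simp only: gS)
  then have "(1 - c) ^ DIM('a) * measure lborel S \<le> (1 - c) ^ DIM('a) * ((1 / (1 - c)) ^ DIM('a) * measure lborel (f ` S))"
    using c by (intro mult_left_mono) auto
  then show "(1 - c) ^ DIM('a) * measure lborel S \<le> measure lborel (f ` S)"
    using c by (simp add: power_divide)
qed

section \<open>Charts close to the identity\<close>

text \<open>
  Centre of the set of geodesics under consideration.  What matters is that \<open>gram\<close> increases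
  along the flow at these data; the orbit is \<open>(exp (\<i> c), exp (- \<i> c))\<close>.
\<close>

definition base :: "hpair" where "base = ((1, 1), axis 1 1)"

text \<open>
  The composition of the symmetric displacement with the inverse of the model map, so that the
  displacement is the model map after \<open>chart \<theta>\<close>.
\<close>

definition chart :: "real \<Rightarrow> hpair \<Rightarrow> hpair"
  where "chart \<theta> p = (let X = (1 / (2 * \<theta>)) *\<^sub>R fst (disp p (- \<theta>) \<theta>); z = (12 / (2 * \<theta>) ^ 3) *\<^sub>R snd (disp p (- \<theta>) \<theta>)
     in (X, inverse (gram X) *\<^sub>R adj_gram X z))"

lemma lip_order_inverse:
  fixes f :: "real \<Rightarrow> 'p::real_normed_vector \<Rightarrow> real"
  assumes f: "lip_order \<Theta> S 0 f" and ge: "\<And>\<theta> p. \<theta> \<in> \<Theta> \<Longrightarrow> p \<in> S \<Longrightarrow> f \<theta> p \<ge> 1"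
  shows "lip_order \<Theta> S 0 (\<lambda>\<theta> p. inverse (f \<theta> p))"
proof -
  obtain C where C: "C \<ge> 0" "\<And>\<theta>. \<theta> \<in> \<Theta> \<Longrightarrow> bdd_lip S C (f \<theta>)" using f by (auto simp: lip_order_def)
  have "bdd_lip S (max 1 C) (\<lambda>p. inverse (f \<theta> p))" if \<theta>: "\<theta> \<in> \<Theta>" for \<theta>
    unfolding bdd_lip_def
  proof (intro conjI ballI)
    fix p assume "p \<in> S"
    then show "norm (inverse (f \<theta> p)) \<le> max 1 C" using ge[OF \<theta>, of p] by (simp add: field_simps le_max_iff_disj abs_of_pos)
  next
    fix p q assume pq: "p \<in> S" "q \<in> S"
    have g: "f \<theta> p \<ge> 1" "f \<theta> q \<ge> 1" using ge[OF \<theta>] pq by auto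
    then have "inverse (f \<theta> p) - inverse (f \<theta> q) = (f \<theta> q - f \<theta> p) / (f \<theta> p * f \<theta> q)" by (simp add: field_simps)
    then have "norm (inverse (f \<theta> p) - inverse (f \<theta> q)) = \<bar>f \<theta> p - f \<theta> q\<bar> / (f \<theta> p * f \<theta> q)"
      using g by (simp add: abs_mult abs_minus_commute)
    also have "\<dots> \<le> \<bar>f \<theta> p - f \<theta> q\<bar> / 1"
      using g mult_mono[of 1 "f \<theta> p" 1 "f \<theta> q"] by (intro divide_left_mono) auto
    also have "\<dots> \<le> C * norm (p - q)" using C(2)[OF \<theta>] pq by (auto simp: bdd_lip_def)
    also have "\<dots> \<le> max 1 C * norm (p - q)" by (intro mult_right_mono) auto
    finally show "norm (inverse (f \<theta> p) - inverse (f \<theta> q)) \<le> max 1 C * norm (p - q)" .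
  qed
  then show ?thesis unfolding lip_order_def by (intro exI[of _ "max 1 C"]) auto
qed

text \<open>
  The entries of the Gram matrix and its determinant are polynomials in \<open>X\<close>, hence inherit bounds and
  Lipschitz constants.
\<close>

lemma lip_order_m:
  assumes X: "lip_order \<Theta> S 0 X" and \<Theta>: "\<Theta> \<subseteq> {0..}"
  shows "lip_order \<Theta> S 0 (\<lambda>\<theta> p. m11 (X \<theta> p))" "lip_order \<Theta> S 0 (\<lambda>\<theta> p. m12 (X \<theta> p))" "lip_order \<Theta> S 0 (\<lambda>\<theta> p. m22 (X \<theta> p))"
    "lip_order \<Theta> S 0 (\<lambda>\<theta> p. gram (X \<theta> p))"
proof -
  note j = lip_order_linear[OF bounded_linear_J1 X \<Theta>] lip_order_linear[OF bounded_linear_J2 X \<Theta>]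
  note i = lip_order_bilinear[OF bounded_bilinear_inner _ _ \<Theta>, where k = 0 and l = 0, simplified]
  note m = lip_order_bilinear[OF bounded_bilinear_mult _ _ \<Theta>, where k = 0 and l = 0, simplified]
  show a: "lip_order \<Theta> S 0 (\<lambda>\<theta> p. m11 (X \<theta> p))" and b: "lip_order \<Theta> S 0 (\<lambda>\<theta> p. m12 (X \<theta> p))" and c: "lip_order \<Theta> S 0 (\<lambda>\<theta> p. m22 (X \<theta> p))"
    unfolding m11_def m12_def m22_def by (intro i j)+
  show "lip_order \<Theta> S 0 (\<lambda>\<theta> p. gram (X \<theta> p))"
    unfolding gram_def by (intro lip_order_diff m a b c \<Theta>)
qed

lemma lip_order_D:
  assumes "lip_order \<Theta> S k F"
  shows "\<exists>C\<ge>0. (\<forall>\<theta>\<in>\<Theta>. \<forall>p\<in>S. norm (F \<theta> p) \<le> C * \<theta> ^ k) \<and>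
    (\<forall>\<theta>\<in>\<Theta>. \<forall>p\<in>S. \<forall>q\<in>S. norm (F \<theta> p - F \<theta> q) \<le> C * \<theta> ^ k * norm (p - q))"
  using assms unfolding lip_order_def bdd_lip_def by blast

lemma norm_fst_diff_le: "norm (fst p - fst q) \<le> norm (p - q)"
  and norm_snd_diff_le: "norm (snd p - snd q) \<le> norm (p - q)"
proof -
  have e: "p - q = (fst p - fst q, snd p - snd q)" by (simp add: prod_eq_iff)
  show "norm (fst p - fst q) \<le> norm (p - q)" unfolding e by (rule norm_fst_le)
  show "norm (snd p - snd q) \<le> norm (p - q)" unfolding e by (rule norm_snd_le)
qed

text \<open>
  The relative error of the model map is \<open>O(\<theta>\<^sup>2)\<close>, in value and in Lipschitz constant.  Inverting the
  model map divides the central error by the Gram matrix, which is harmless because \<open>gram \<ge> 1\<close> near the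
  base point.
\<close>

lemma chart_near_identity:
  "\<exists>C\<ge>0. \<exists>\<delta>>0. \<delta> \<le> 1 \<and> (\<forall>\<theta> p. 0 < \<theta> \<and> \<theta> \<le> \<delta> \<and> p \<in> cball base (1/4) \<longrightarrow>
      norm (chart \<theta> p - p) \<le> C * \<theta>\<^sup>2 \<and>
      (\<forall>q\<in>cball base (1/4). norm ((chart \<theta> p - p) - (chart \<theta> q - q)) \<le> C * \<theta>\<^sup>2 * norm (p - q)) \<and>
      model (2 * \<theta>) (chart \<theta> p) = disp p (- \<theta>) \<theta>)"
proof -
  let ?R = "cball base (1/4)"
  have bR: "bounded ?R" by simp
  define X where "X \<theta> p = (1 / (2 * \<theta>)) *\<^sub>R fst (disp p (- \<theta>) \<theta>)" for \<theta> p
  define z where "z \<theta> p = (12 / (2 * \<theta>) ^ 3) *\<^sub>R snd (disp p (- \<theta>) \<theta>)" for \<theta> p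
  let ?I = "{0<..1::real}"
  have I: "?I \<subseteq> {0..1}" "?I \<subseteq> {0..}" "?I \<subseteq> {0<..}" by auto
  have X2: "lip_order ?I ?R 2 (\<lambda>\<theta> p. X \<theta> p - fst p)"
  proof (rule lip_order_divide[OF _ I(3), where j = 1])
    show "lip_order ?I ?R (2 + 1) (\<lambda>\<theta> p. \<theta> ^ 1 *\<^sub>R (X \<theta> p - fst p))"
      using lip_order_scale[OF lip_order_subset[OF lip_order_symdisp(1)[OF bR] I(1)] I(2), of "1/2"]
      by (rule lip_order_cong[THEN subst[of 3 "2+1", rotated]]) (auto simp: X_def scaleR_diff_right)
  qed
  have z2: "lip_order ?I ?R 2 (\<lambda>\<theta> p. z \<theta> p - br (fst p) (J (snd p) (fst p)))"
  proof (rule lip_order_divide[OF _ I(3), where j = 3])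
    show "lip_order ?I ?R (2 + 3) (\<lambda>\<theta> p. \<theta> ^ 3 *\<^sub>R (z \<theta> p - br (fst p) (J (snd p) (fst p))))"
      using lip_order_scale[OF lip_order_subset[OF lip_order_symdisp(2)[OF bR] I(1)] I(2), of "3/2"]
      by (rule lip_order_cong[THEN subst[of 5 "2+3", rotated]]) (auto simp: z_def scaleR_diff_right power_mult_distrib)
  qed
  obtain C0 where C0: "C0 \<ge> 0" "\<forall>\<theta>\<in>?I. \<forall>p\<in>?R. norm (X \<theta> p - fst p) \<le> C0 * \<theta> ^ 2"
    using lip_order_D[OF X2] by blast
  define \<delta> where "\<delta> = min 1 (1 / (10 * (C0 + 1)))"
  have \<delta>: "0 < \<delta>" "\<delta> \<le> 1" using C0 by (auto simp: \<delta>_def)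
  let ?D = "{0<..\<delta>}"
  have D: "?D \<subseteq> ?I" "?D \<subseteq> {0..1}" "?D \<subseteq> {0..}" using \<delta> by auto
  have eta: "norm (fst p) \<ge> 11/10" if "p \<in> ?R" for p
  proof -
    have "norm (fst base - fst p) \<le> 1/4"
      using that norm_fst_diff_le[of base p] by (simp add: dist_norm)
    moreover have "norm (fst base) \<ge> 14/10"
    proof -
      have "7/5 \<le> sqrt 2" by (rule real_le_rsqrt) (simp add: power2_eq_square)
      then show ?thesis by (simp add: base_def norm_prod_def)
    qed
    ultimately show ?thesis using norm_triangle_ineq2[of "fst base" "fst p"] norm_triangle_ineq2[of "fst base" "fst base - fst p"] by simp
  qed
  have X1: "norm (X \<theta> p) \<ge> 1" if \<theta>: "\<theta> \<in> ?D" and p: "p \<in> ?R" for \<theta> p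
  proof -
    have "\<theta> \<le> 1 / (10 * (C0 + 1))" "0 < \<theta>" "\<theta> \<le> 1" using \<theta> \<delta> by (auto simp: \<delta>_def)
    have "C0 * \<theta> ^ 2 \<le> C0 * \<theta>" using \<open>0 < \<theta>\<close> \<open>\<theta> \<le> 1\<close> C0 by (intro mult_left_mono) (auto simp: power2_eq_square mult_left_le)
    also have "\<dots> \<le> C0 * (1 / (10 * (C0 + 1)))" using \<open>\<theta> \<le> 1 / (10 * (C0 + 1))\<close> C0 by (intro mult_left_mono) auto
    also have "\<dots> \<le> 1/10" using C0 by (simp add: field_simps)
    finally have "norm (X \<theta> p - fst p) \<le> 1/10" using C0(2) \<theta> D(1) p by (meson order_trans subsetD)
    then show ?thesis using eta[OF p] norm_triangle_ineq2[of "fst p" "fst p - X \<theta> p"] by (simp add: norm_minus_commute)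
  qed
  note X2 = lip_order_subset[OF X2 D(1)] and z2 = lip_order_subset[OF z2 D(1)]
  have F: "lip_order ?D ?R 0 (\<lambda>_. fst)" and W: "lip_order ?D ?R 0 (\<lambda>_. snd)"
    using lip_order_linear[OF bounded_linear_fst lip_order_ident[OF bR] D(3)] lip_order_linear[OF bounded_linear_snd lip_order_ident[OF bR] D(3)] by auto
  have X0: "lip_order ?D ?R 0 X"
    using lip_order_add[OF lip_order_weaken[OF X2 _ D(2), of 0] F] by simp
  have g0: "lip_order ?D ?R 0 (\<lambda>\<theta> p. inverse (gram (X \<theta> p)))"
    by (rule lip_order_inverse[OF lip_order_m(4)[OF X0 D(3)]]) (intro gram_ge_1 X1)
  define h where "h \<theta> p = z \<theta> p - br (X \<theta> p) (J (snd p) (X \<theta> p))" for \<theta> p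
  have J0: "lip_order ?D ?R k (\<lambda>\<theta> p. J (snd p) (G \<theta> p))" if "lip_order ?D ?R k G" for G k
    using lip_order_bilinear[OF bounded_bilinear_J W that D(3)] by simp
  have a1: "lip_order ?D ?R 2 (\<lambda>\<theta> p. br (X \<theta> p - fst p) (J (snd p) (X \<theta> p)))"
    using lip_order_bilinear[OF bounded_bilinear_br X2 J0[OF X0] D(3)] by simp
  have a2: "lip_order ?D ?R 2 (\<lambda>\<theta> p. br (fst p) (J (snd p) (X \<theta> p - fst p)))"
    using lip_order_bilinear[OF bounded_bilinear_br F J0[OF X2] D(3)] by (simp add: numeral_2_eq_2)
  have h2: "lip_order ?D ?R 2 h"
    using lip_order_diff[OF z2 lip_order_add[OF a1 a2] D(3)]
    by (rule lip_order_cong) (simp add: h_def br.diff_left br.diff_right J.diff_right)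
  have hc: "lip_order ?D ?R 2 (\<lambda>\<theta> p. h \<theta> p $ i)" for i
    by (rule lip_order_linear[OF bounded_linear_vec_nth h2 D(3)])
  have m: "lip_order ?D ?R 2 (\<lambda>\<theta> p. f \<theta> p * h \<theta> p $ i)" if "lip_order ?D ?R 0 f" for f i
    using lip_order_bilinear[OF bounded_bilinear_mult that hc D(3)] by (simp add: numeral_2_eq_2)
  have ax: "bounded_linear (\<lambda>c. c *\<^sub>R (v::real^2))" for v by (rule bounded_linear_scaleR_left)
  have ad: "lip_order ?D ?R 2 (\<lambda>\<theta> p. adj_gram (X \<theta> p) (h \<theta> p))"
    unfolding adj_gram_def
    by (intro lip_order_add lip_order_linear[OF ax _ D(3)] lip_order_diff m lip_order_m X0 D(3))
  have w2: "lip_order ?D ?R 2 (\<lambda>\<theta> p. inverse (gram (X \<theta> p)) *\<^sub>R adj_gram (X \<theta> p) (h \<theta> p))"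
    using lip_order_bilinear[OF bounded_bilinear_scaleR g0 ad D(3)] by (simp add: numeral_2_eq_2)
  have P: "bounded_linear (\<lambda>a::hvec. (a, 0::real^2))" "bounded_linear (\<lambda>b::real^2. (0::hvec, b))"
    by (intro bounded_linear_Pair bounded_linear_ident bounded_linear_zero)+
  have gpos: "gram (X \<theta> p) > 0" if "\<theta> \<in> ?D" "p \<in> ?R" for \<theta> p
    using gram_ge_1[OF X1[OF that]] by simp
  have ch: "chart \<theta> p = (X \<theta> p, inverse (gram (X \<theta> p)) *\<^sub>R adj_gram (X \<theta> p) (z \<theta> p))" for \<theta> p
    by (simp add: chart_def X_def z_def Let_def)
  have "lip_order ?D ?R 2 (\<lambda>\<theta> p. (X \<theta> p - fst p, 0) + (0, inverse (gram (X \<theta> p)) *\<^sub>R adj_gram (X \<theta> p) (h \<theta> p)))"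
    by (rule lip_order_add[OF lip_order_linear[OF P(1) X2 D(3)] lip_order_linear[OF P(2) w2 D(3)]])
  then have K2: "lip_order ?D ?R 2 (\<lambda>\<theta> p. chart \<theta> p - p)"
  proof (rule lip_order_cong)
    fix \<theta> p assume "\<theta> \<in> ?D" "p \<in> ?R"
    then have "gram (X \<theta> p) \<noteq> 0" using gpos[of \<theta> p] by simp
    then show "(X \<theta> p - fst p, 0) + (0, inverse (gram (X \<theta> p)) *\<^sub>R adj_gram (X \<theta> p) (h \<theta> p)) = chart \<theta> p - p"
      by (simp add: ch h_def adj_gram_diff adj_gram_br prod_eq_iff scaleR_diff_right)
  qed
  obtain C where C: "C \<ge> 0" "\<forall>\<theta>\<in>?D. \<forall>p\<in>?R. norm (chart \<theta> p - p) \<le> C * \<theta> ^ 2"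
    "\<forall>\<theta>\<in>?D. \<forall>p\<in>?R. \<forall>q\<in>?R. norm ((chart \<theta> p - p) - (chart \<theta> q - q)) \<le> C * \<theta> ^ 2 * norm (p - q)"
    using lip_order_D[OF K2] by blast
  show ?thesis
  proof (rule exI[of _ C], rule conjI[OF C(1)], rule exI[of _ \<delta>], intro conjI \<delta> allI impI)
    fix \<theta> :: real and p :: "hpair" assume *: "0 < \<theta> \<and> \<theta> \<le> \<delta> \<and> p \<in> ?R"
    then have \<theta>: "\<theta> \<in> ?D" "p \<in> ?R" by auto
    show "norm (chart \<theta> p - p) \<le> C * \<theta>\<^sup>2" using C(2) \<theta> by blast
    show "\<forall>q\<in>?R. norm ((chart \<theta> p - p) - (chart \<theta> q - q)) \<le> C * \<theta>\<^sup>2 * norm (p - q)" using C(3) \<theta> by blast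
    have "gram (X \<theta> p) \<noteq> 0" using gpos[OF \<theta>] by simp
    then show "model (2 * \<theta>) (chart \<theta> p) = disp p (- \<theta>) \<theta>"
      using * by (simp add: model_def ch J.scaleR_left br.scaleR_right br_adj_gram prod_eq_iff) (simp add: X_def z_def power_mult_distrib)
  qed
qed

lemma gram_Lipschitz:
  obtains C where "C \<ge> 0" "\<And>X Y. norm X \<le> 3 \<Longrightarrow> norm Y \<le> 3 \<Longrightarrow> \<bar>gram X - gram Y\<bar> \<le> C * norm (X - Y)"
proof -
  have "lip_order {1} (cball 0 3) 0 (\<lambda>_ X. gram X)"
    by (rule lip_order_m(4)[OF lip_order_ident]) auto
  from lip_order_D[OF this] obtain C where "C \<ge> 0" "\<forall>X\<in>cball 0 3. \<forall>Y\<in>cball 0 3. norm (gram X - gram Y) \<le> C * norm (X - Y)"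
    by auto
  then show thesis by (intro that[of C]) auto
qed

section \<open>Drop of volume along geodesics\<close>

text \<open>
  The extremal with data \<open>p\<close> has the data \<open>turn c p\<close> when time \<open>c\<close> is taken as the new origin.
\<close>

definition turn :: "real \<Rightarrow> hpair \<Rightarrow> hpair"
  where "turn c p = (vel p c, snd p)"

text \<open>
  For a fixed covector the flow is an isometry, so no slice gains volume.
\<close>

lemma measure_turn_le:
  assumes B: "compact B"
  shows "compact (turn c ` B)" "measure lborel (turn c ` B) \<le> measure lborel B"
proof -
  obtain R where R: "\<And>p. p \<in> B \<Longrightarrow> norm p \<le> R" using compact_imp_bounded[OF B] bounded_iff by metis
  have "norm (turn c p - turn c q) \<le> (2 + 4 * \<bar>R\<bar> * \<bar>c\<bar>) * norm (p - q)" if pq: "p \<in> B" "q \<in> B" for p q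
  proof -
    have "norm (turn c p - turn c q) \<le> norm (vel p c - vel q c) + norm (snd p - snd q)"
      by (simp add: turn_def norm_Pair_le)
    also have "norm (vel p c - vel q c) \<le> norm (fst p - fst q) + 4 * norm (snd p - snd q) * norm (fst q) * \<bar>c\<bar>"
      unfolding vel_def by (rule flow_Lipschitz)
    also have "\<dots> \<le> norm (p - q) + 4 * norm (p - q) * \<bar>R\<bar> * \<bar>c\<bar>"
    proof -
      have "norm (fst q) \<le> \<bar>R\<bar>" using norm_fst_diff_le[of q 0] R[OF pq(2)] by simp
      then show ?thesis
        by (intro add_mono mult_mono norm_fst_diff_le norm_snd_diff_le) auto
    qed
    finally show ?thesis using norm_snd_diff_le[of p q] by (simp add: algebra_simps)
  qed
  then have "continuous_on B (turn c)"
    by (intro lipschitz_on_continuous_on[of "2 + 4 * \<bar>R\<bar> * \<bar>c\<bar>"]) (auto simp: lipschitz_on_def dist_norm)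
  then show c: "compact (turn c ` B)" by (rule compact_continuous_image[OF _ B])
  have "measure lborel (turn c ` B) \<le> 1 * measure lborel B"
  proof (rule measure_le_slices'[OF B c])
    fix w
    have sl: "(\<lambda>x. (x, w)) -` turn c ` B = flow w c ` ((\<lambda>x. (x, w)) -` B)"
    proof (intro set_eqI iffI)
      fix x assume "x \<in> (\<lambda>x. (x, w)) -` turn c ` B"
      then have "(x, w) \<in> turn c ` B" by simp
      then obtain p where p: "p \<in> B" "(x, w) = turn c p" by (rule imageE)
      then have "(fst p, w) \<in> B" "x = flow w c (fst p)" by (simp_all add: turn_def vel_def)
      then show "x \<in> flow w c ` ((\<lambda>x. (x, w)) -` B)" by blast
    next
      fix x assume "x \<in> flow w c ` ((\<lambda>x. (x, w)) -` B)"
      then obtain u where u: "(u, w) \<in> B" "x = flow w c u" by blast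
      then have "(x, w) = turn c (u, w)" by (simp add: turn_def vel_def)
      from image_eqI[of _ "turn c", OF this u(1)] show "x \<in> (\<lambda>x. (x, w)) -` turn c ` B" by (simp only: vimage_eq)
    qed
    have "measure lborel (flow w c ` ((\<lambda>x. (x, w)) -` B)) \<le> 1 ^ DIM(hvec) * measure lborel ((\<lambda>x. (x, w)) -` B)"
      by (intro measure_Lipschitz_image_le compact_slice(2)[OF B]) (simp_all add: flow_diff[symmetric])
    then show "measure lborel ((\<lambda>x. (x, w)) -` turn c ` B) \<le> 1 * measure lborel ((\<lambda>x. (x, w)) -` B)"
      unfolding sl by simp
  qed simp
  then show "measure lborel (turn c ` B) \<le> measure lborel B" by simp
qed

lemma disp_turn: "disp p (\<alpha> + c) (\<beta> + c) = disp (turn c p) \<alpha> \<beta>"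
  by (simp add: disp_shift turn_def)

lemma gram_turn_base: "gram (vel base c) = 20 + 16 * sin (2 * c)"
proof -
  have a: "(axis 1 1 :: real^2) $ 1 = 1" "(axis 1 1 :: real^2) $ 2 = 0" by (simp_all add: axis_def)
  have f: "freq (axis 1 1) = 1" by (simp add: freq_def a)
  have v: "vel base c = (exp (\<i> * of_real c), exp (- (\<i> * of_real c)))"
    by (simp add: vel_def base_def flow_def f a exp_Euler exp_minus_Euler)
  have n: "norm (fst (vel base c)) = 1" "norm (snd (vel base c)) = 1"
    by (simp_all add: v norm_exp_i_times flip: of_real_minus mult_minus_right)
  have "cnj (exp (\<i> * of_real c)) * exp (- (\<i> * of_real c)) = exp (\<i> * of_real (- 2 * c))"
    by (simp add: exp_cnj mult.left_commute flip: exp_add)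
  then have "Im (cnj (fst (vel base c)) * snd (vel base c)) = - sin (2 * c)"
    by (simp add: v Im_exp)
  then show ?thesis by (simp add: gram_def m_eq n)
qed

text \<open>
  The images are the endpoints and the midpoints of the geodesics over \<open>[-\<theta>, \<theta>]\<close> with data in a ball
  about \<open>base\<close>.  The ball has radius \<open>\<theta>\<^sup>2\<close>, so that the variation of \<open>gram\<close> over the ball is also of the
  order of the errors, and \<open>gram\<close> is \<open>20 + O(\<theta>\<^sup>2)\<close> for the whole geodesics and
  \<open>20 - 16 sin \<theta> + O(\<theta>\<^sup>2)\<close> for their first halves.
\<close>

lemma volume_drop:
  obtains \<theta> \<rho> r where "0 < \<theta>" "\<theta> \<le> 1/16" "0 < \<rho>" "\<rho> < 1" "0 < r" "r \<le> 1/4"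
    "compact ((\<lambda>p. disp p (- \<theta>) \<theta>) ` cball base r)" "compact ((\<lambda>p. disp p (- \<theta>) 0) ` cball base r)"
    "0 < measure lborel ((\<lambda>p. disp p (- \<theta>) \<theta>) ` cball base r)"
    "measure lborel ((\<lambda>p. disp p (- \<theta>) 0) ` cball base r) \<le> (1/2) ^ 10 * \<rho> * measure lborel ((\<lambda>p. disp p (- \<theta>) \<theta>) ` cball base r)"
proof -
  obtain C \<delta> where C: "C \<ge> 0" "0 < \<delta>" "\<delta> \<le> 1"
    and c: "\<forall>\<theta> p. 0 < \<theta> \<and> \<theta> \<le> \<delta> \<and> p \<in> cball base (1/4) \<longrightarrow>
      norm (chart \<theta> p - p) \<le> C * \<theta>\<^sup>2 \<and>
      (\<forall>q\<in>cball base (1/4). norm ((chart \<theta> p - p) - (chart \<theta> q - q)) \<le> C * \<theta>\<^sup>2 * norm (p - q)) \<and>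
      model (2 * \<theta>) (chart \<theta> p) = disp p (- \<theta>) \<theta>"
    using chart_near_identity by blast
  have c1: "norm (chart \<theta> p - p) \<le> C * \<theta>\<^sup>2" 
    and c2: "\<And>q. q \<in> cball base (1/4) \<Longrightarrow> norm ((chart \<theta> p - p) - (chart \<theta> q - q)) \<le> C * \<theta>\<^sup>2 * norm (p - q)"
    and c3: "model (2 * \<theta>) (chart \<theta> p) = disp p (- \<theta>) \<theta>"
    if "0 < \<theta>" "\<theta> \<le> \<delta>" "p \<in> cball base (1/4)" for \<theta> p
    using c that by blast+
  obtain G where G: "G \<ge> 0" "\<And>X Y. norm X \<le> 3 \<Longrightarrow> norm Y \<le> 3 \<Longrightarrow> \<bar>gram X - gram Y\<bar> \<le> G * norm (X - Y)"
    by (rule gram_Lipschitz) blast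
  define E where "E = G * (C + 9)"
  have E: "E \<ge> 0" "G * (C + 1) \<le> E" using G C by (auto simp: E_def intro: mult_left_mono)
  \<comment> \<open>Up to the common factors these bound the volume of the endpoints from below and that of the
    midpoints from above.  They agree at \<open>\<theta> = 0\<close>, and their difference has derivative 16 there.\<close>
  define lo where "lo \<theta> = (20 - E * \<theta>\<^sup>2) * (1 - C * \<theta>\<^sup>2) ^ 6" for \<theta>
  define hi where "hi \<theta> = (20 - 16 * sin \<theta> + E * \<theta>\<^sup>2) * (1 + C * \<theta>\<^sup>2) ^ 6" for \<theta>
  have "((\<lambda>\<theta>. lo \<theta> - hi \<theta>) has_real_derivative 16) (at 0)"
    unfolding lo_def hi_def by (auto intro!: derivative_eq_intros)
  from DERIV_pos_inc_right[OF this] obtain d where d: "d > 0" "\<And>h. 0 < h \<Longrightarrow> h < d \<Longrightarrow> lo 0 - hi 0 < lo h - hi h"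
    by auto
  define \<theta> where "\<theta> = Min {d/2, \<delta>, 1/200, 1 / (C + 2), 1 / (E + 1)}"
  have th: "\<theta> > 0" "\<theta> \<le> d/2" "\<theta> \<le> \<delta>" "\<theta> \<le> 1/200" "\<theta> \<le> 1 / (C + 2)" "\<theta> \<le> 1 / (E + 1)"
    using d C E by (auto simp: \<theta>_def)
  have "lo 0 - hi 0 < lo \<theta> - hi \<theta>" using d(2)[of \<theta>] d(1) th(1,2) by linarith
  then have lohi: "hi \<theta> < lo \<theta>" by (simp add: lo_def hi_def)
  have t2: "x * \<theta>\<^sup>2 < 1" if "x \<ge> 0" "\<theta> \<le> 1 / (x + 1)" for x
  proof -
    have "x * \<theta>\<^sup>2 \<le> x * \<theta>" using that th by (intro mult_left_mono) (auto simp: power2_eq_square mult_left_le)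
    also have "\<dots> \<le> x * (1 / (x + 1))" using that by (intro mult_left_mono) auto
    also have "\<dots> < 1" using that by (simp add: field_simps)
    finally show ?thesis .
  qed
  have Ct: "C * \<theta>\<^sup>2 < 1" using t2[of C] C th(5) by (smt (verit) frac_le)
  have Et: "E * \<theta>\<^sup>2 < 1" using t2[of E] E th(6) by simp
  have sin: "0 \<le> sin \<theta>" "sin \<theta> \<le> 1" using th by (auto intro!: sin_ge_zero order_trans[OF _ less_imp_le[OF pi_half_gt_zero]] order_trans[OF th(4)] pi_ge_two[THEN [2] order_trans])
  have lopos: "lo \<theta> > 0" using Ct Et by (simp add: lo_def)
  have ge4: "20 - 16 * sin \<theta> + E * \<theta>\<^sup>2 \<ge> 4"
    using sin_le_one[of \<theta>] mult_nonneg_nonneg[OF E(1) zero_le_power2[of \<theta>]] by linarith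
  have hipos: "hi \<theta> > 0"
    unfolding hi_def using ge4 C by (intro mult_pos_pos zero_less_power) (auto simp: add_pos_nonneg)
  define r where "r = \<theta>\<^sup>2"
  have "\<theta> * \<theta> \<le> 1 * (1/200)" using th by (intro mult_mono) auto
  then have r: "r > 0" "r \<le> 1/200" using th(1) by (auto simp: r_def power2_eq_square)
  let ?B = "cball base r"
  have BR: "?B \<subseteq> cball base (1/4)" using r by auto
  have B: "compact ?B" by simp
  have mB: "measure lborel ?B > 0" using r by (simp add: content_cball_pos)
  have "sqrt 2 \<le> 3/2" by (rule real_le_lsqrt) (simp_all add: power2_eq_square)
  then have nb: "norm (fst base) \<le> 3/2" "norm (snd base) = 1"
    by (simp_all add: base_def norm_prod_def)
  have pb: "norm (fst p - fst base) \<le> r" "norm (snd p - snd base) \<le> r" if "p \<in> ?B" for p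
    using that norm_fst_diff_le[of p base] norm_snd_diff_le[of p base] by (auto simp: dist_norm norm_minus_commute)
  have tri: "norm x \<le> norm y + norm (x - y)" for x y :: hvec using norm_triangle_ineq[of y "x - y"] by simp
  have tri': "norm x \<le> norm y + norm (x - y)" for x y :: "real^2" using norm_triangle_ineq[of y "x - y"] by simp
  \<comment> \<open>For the whole geodesics the chart moves points of the ball by \<open>O(\<theta>\<^sup>2)\<close>, so \<open>gram\<close> stays close
    to its value 20 at the base point.\<close>
  have K1: "compact (chart \<theta> ` ?B)" "(1 - C * \<theta>\<^sup>2) ^ 6 * measure lborel ?B \<le> measure lborel (chart \<theta> ` ?B)"
    using measure_near_identity[OF B _ Ct, of "chart \<theta>"] c2[OF th(1,3)] BR C by (auto simp: subset_iff)
  have g1: "20 - E * \<theta>\<^sup>2 \<le> gram (fst q) \<and> gram (fst q) \<le> 20 + E * \<theta>\<^sup>2" if q: "q \<in> chart \<theta> ` ?B" for q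
  proof -
    obtain p where p: "p \<in> ?B" "q = chart \<theta> p" using q by blast
    have "norm (fst q - fst p) \<le> C * \<theta>\<^sup>2"
      using order_trans[OF norm_fst_diff_le c1[OF th(1,3)]] p BR by blast
    then have 1: "norm (fst q - fst base) \<le> (C + 1) * \<theta>\<^sup>2"
      using norm_triangle_ineq[of "fst q - fst p" "fst p - fst base"] pb(1)[OF p(1)] by (simp add: r_def algebra_simps)
    have "norm (fst q) \<le> 3" using 1 tri[of "fst q" "fst base"] nb Ct r by (simp add: algebra_simps r_def)
    then have "\<bar>gram (fst q) - gram (fst base)\<bar> \<le> G * norm (fst q - fst base)" using nb by (intro G) auto
    also have "\<dots> \<le> G * ((C + 1) * \<theta>\<^sup>2)" using 1 G by (intro mult_left_mono) auto
    also have "\<dots> \<le> E * \<theta>\<^sup>2" using mult_right_mono[OF E(2), of "\<theta>\<^sup>2"] by (simp add: mult_ac)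
    finally have "\<bar>gram (fst q) - gram (fst base)\<bar> \<le> E * \<theta>\<^sup>2" .
    moreover have "gram (fst base) = 20" using gram_turn_base[of 0] by (simp add: vel_def)
    ultimately show ?thesis by linarith
  qed
  have im1: "(\<lambda>p. disp p (- \<theta>) \<theta>) ` ?B = model (2 * \<theta>) ` chart \<theta> ` ?B"
    unfolding image_image using c3[OF th(1,3)] BR by (intro image_cong) auto
  have A: "(2 * \<theta>) ^ 10 / 144 * lo \<theta> * measure lborel ?B \<le> measure lborel ((\<lambda>p. disp p (- \<theta>) \<theta>) ` ?B)"
  proof -
    have "(2 * \<theta>) ^ 10 / 144 * lo \<theta> * measure lborel ?B = (2 * \<theta>) ^ 10 / 144 * (20 - E * \<theta>\<^sup>2) * ((1 - C * \<theta>\<^sup>2) ^ 6 * measure lborel ?B)"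
      by (simp add: lo_def mult_ac)
    also have "\<dots> \<le> (2 * \<theta>) ^ 10 / 144 * (20 - E * \<theta>\<^sup>2) * measure lborel (chart \<theta> ` ?B)"
      using K1(2) Et th(1) by (intro mult_left_mono) auto
    also have "\<dots> \<le> measure lborel (model (2 * \<theta>) ` chart \<theta> ` ?B)"
      using Et E th(1) by (intro measure_model(2)[OF K1(1) _ g1]) (auto intro: add_pos_nonneg)
    finally show ?thesis unfolding im1 .
  qed
  \<comment> \<open>The first half is an interval of length \<open>\<theta>\<close> centred at \<open>- \<theta>/2\<close>.\<close>
  let ?c = "- (\<theta> / 2)"
  define B' where "B' = turn ?c ` ?B"
  have B': "compact B'" "measure lborel B' \<le> measure lborel ?B"
    unfolding B'_def using measure_turn_le[OF B] by auto
  have tb: "norm (vel p ?c - vel base ?c) \<le> 9 * \<theta>\<^sup>2" if p: "p \<in> ?B" for p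
  proof -
    have "norm (vel p ?c - vel base ?c) \<le> norm (fst p - fst base) + 4 * norm (snd p - snd base) * norm (fst base) * \<bar>?c\<bar>"
      unfolding vel_def by (rule flow_Lipschitz)
    also have "\<dots> \<le> r + 4 * r * 2 * 1" using pb[OF p] nb th r by (intro add_mono mult_mono) auto
    finally show ?thesis by (simp add: r_def)
  qed
  have B'R: "B' \<subseteq> cball base (1/4)"
  proof
    fix q assume "q \<in> B'"
    then obtain p where p: "p \<in> ?B" "q = turn ?c p" by (auto simp: B'_def)
    have n2: "norm (fst p) \<le> 2" "norm (snd p) \<le> 2"
      using tri[of "fst p" "fst base"] tri'[of "snd p" "snd base"] pb[OF p(1)] nb r by auto
    have "norm (vel p ?c - fst p) \<le> 4 * norm (snd p) * norm (fst p) * \<bar>?c\<bar>"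
      unfolding vel_def by (rule norm_flow_diff_le)
    also have "\<dots> \<le> 4 * 2 * 2 * (1 / 400)" using n2 th by (intro mult_mono) auto
    finally have "norm (turn ?c p - p) \<le> 1/25" by (simp add: turn_def norm_prod_def)
    moreover have "norm (p - base) \<le> 1/200" using p r by (simp add: dist_norm norm_minus_commute)
    ultimately have "norm (q - base) \<le> 1/4" using norm_triangle_ineq[of "q - p" "p - base"] p(2) by simp
    then show "q \<in> cball base (1/4)" by (simp add: dist_norm norm_minus_commute)
  qed
  have h: "0 < \<theta>/2" "\<theta>/2 \<le> \<delta>" "C * (\<theta>/2)\<^sup>2 \<le> C * \<theta>\<^sup>2"
    using th C by (auto simp: power2_eq_square intro!: mult_left_mono)
  have K2: "compact (chart (\<theta>/2) ` B')" "measure lborel (chart (\<theta>/2) ` B') \<le> (1 + C * \<theta>\<^sup>2) ^ 6 * measure lborel B'"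
  proof -
    have "norm ((chart (\<theta>/2) p - p) - (chart (\<theta>/2) q - q)) \<le> C * \<theta>\<^sup>2 * norm (p - q)" if "p \<in> B'" "q \<in> B'" for p q
      by (rule order_trans[OF c2[OF h(1,2) subsetD[OF B'R that(1)] subsetD[OF B'R that(2)]] mult_right_mono[OF h(3)]]) simp
    from measure_near_identity[OF B'(1) _ Ct this] C show "compact (chart (\<theta>/2) ` B')"
      "measure lborel (chart (\<theta>/2) ` B') \<le> (1 + C * \<theta>\<^sup>2) ^ 6 * measure lborel B'" by auto
  qed
  have g2: "1 \<le> gram (fst q) \<and> gram (fst q) \<le> 20 - 16 * sin \<theta> + E * \<theta>\<^sup>2" if q: "q \<in> chart (\<theta>/2) ` B'" for q
  proof -
    obtain p where p: "p \<in> ?B" "q = chart (\<theta>/2) (turn ?c p)" using q by (auto simp: B'_def)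
    have "turn ?c p \<in> cball base (1/4)" by (rule subsetD[OF B'R]) (simp only: B'_def p(1) imageI)
    then have "norm (fst q - vel p ?c) \<le> C * \<theta>\<^sup>2"
      using norm_fst_diff_le[of q "turn ?c p"] c1[OF h(1,2), of "turn ?c p"] h(3) p(2) by (simp add: turn_def)
    then have 1: "norm (fst q - vel base ?c) \<le> (C + 9) * \<theta>\<^sup>2"
      using norm_triangle_ineq[of "fst q - vel p ?c" "vel p ?c - vel base ?c"] tb[OF p(1)] by (simp add: algebra_simps)
    have "norm (fst q) \<le> 3" using 1 tri[of "fst q" "vel base ?c"] nb Ct r by (simp add: algebra_simps r_def)
    then have "\<bar>gram (fst q) - gram (vel base ?c)\<bar> \<le> G * norm (fst q - vel base ?c)" using nb by (intro G) auto
    also have "\<dots> \<le> G * ((C + 9) * \<theta>\<^sup>2)" using 1 G by (intro mult_left_mono) auto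
    also have "\<dots> = E * \<theta>\<^sup>2" by (simp add: E_def)
    finally have "\<bar>gram (fst q) - gram (vel base ?c)\<bar> \<le> E * \<theta>\<^sup>2" .
    moreover have "gram (vel base ?c) = 20 - 16 * sin \<theta>" using gram_turn_base[of ?c] by simp
    ultimately show ?thesis using sin_le_one[of \<theta>] Et by linarith
  qed
  have im2: "(\<lambda>p. disp p (- \<theta>) 0) ` ?B = model \<theta> ` chart (\<theta>/2) ` B'"
  proof -
    have "disp p (- \<theta>) 0 = model \<theta> (chart (\<theta>/2) (turn ?c p))" if "p \<in> ?B" for p
    proof -
      have "turn ?c p \<in> cball base (1/4)" by (rule subsetD[OF B'R]) (simp only: B'_def that imageI)
      from c3[OF h(1,2) this] show ?thesis using disp_turn[of p "- (\<theta>/2)" ?c "\<theta>/2"] by simp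
    qed
    then show ?thesis unfolding B'_def image_image by (intro image_cong) auto
  qed
  have Z: "measure lborel ((\<lambda>p. disp p (- \<theta>) 0) ` ?B) \<le> \<theta> ^ 10 / 144 * hi \<theta> * measure lborel ?B"
  proof -
    have pos: "20 - 16 * sin \<theta> + E * \<theta>\<^sup>2 > 0" using ge4 by simp
    have "measure lborel (model \<theta> ` chart (\<theta>/2) ` B') \<le> \<theta> ^ 10 / 144 * (20 - 16 * sin \<theta> + E * \<theta>\<^sup>2) * measure lborel (chart (\<theta>/2) ` B')"
      using th(1) pos by (intro measure_model(1)[OF K2(1) _ g2]) auto
    also have "\<dots> \<le> \<theta> ^ 10 / 144 * (20 - 16 * sin \<theta> + E * \<theta>\<^sup>2) * ((1 + C * \<theta>\<^sup>2) ^ 6 * measure lborel ?B)"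
    proof (rule mult_left_mono)
      have "(1 + C * \<theta>\<^sup>2) ^ 6 * measure lborel B' \<le> (1 + C * \<theta>\<^sup>2) ^ 6 * measure lborel ?B"
        using B'(2) C by (intro mult_left_mono) auto
      then show "measure lborel (chart (\<theta>/2) ` B') \<le> (1 + C * \<theta>\<^sup>2) ^ 6 * measure lborel ?B" using K2(2) by simp
    qed (use th(1) pos in auto)
    finally show ?thesis unfolding im2 by (simp add: hi_def mult_ac)
  qed
  show thesis
  proof (rule that[of \<theta> "hi \<theta> / lo \<theta>" r])
    show "compact ((\<lambda>p. disp p (- \<theta>) \<theta>) ` ?B)" "compact ((\<lambda>p. disp p (- \<theta>) 0) ` ?B)"
      unfolding im1 im2
      by (rule compact_continuous_image[OF continuous_on_model K1(1)] compact_continuous_image[OF continuous_on_model K2(1)])+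
    have "0 < (2 * \<theta>) ^ 10 / 144 * lo \<theta> * measure lborel ?B" using th(1) lopos mB by simp
    then show "0 < measure lborel ((\<lambda>p. disp p (- \<theta>) \<theta>) ` ?B)" using A by linarith
    have "\<theta> ^ 10 / 144 * hi \<theta> * measure lborel ?B = (1/2) ^ 10 * (hi \<theta> / lo \<theta>) * ((2 * \<theta>) ^ 10 / 144 * lo \<theta> * measure lborel ?B)"
      using lopos by (simp add: power_mult_distrib power_divide)
    also have "\<dots> \<le> (1/2) ^ 10 * (hi \<theta> / lo \<theta>) * measure lborel ((\<lambda>p. disp p (- \<theta>) \<theta>) ` ?B)"
      using A hipos lopos by (intro mult_left_mono) auto
    finally show "measure lborel ((\<lambda>p. disp p (- \<theta>) 0) ` ?B) \<le> (1/2) ^ 10 * (hi \<theta> / lo \<theta>) * measure lborel ((\<lambda>p. disp p (- \<theta>) \<theta>) ` ?B)"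
      using Z by linarith
  qed (use th r lohi lopos hipos in auto)
qed

section \<open>The group in coordinates\<close>

definition emb :: "hpair \<Rightarrow> rvec" where
  "emb p = (\<lambda>i. if i = 0 then Re (fst (fst p)) else if i = 1 then Im (fst (fst p))
     else if i = 2 then Re (snd (fst p)) else if i = 3 then Im (snd (fst p))
     else if i = 4 then snd p $ 1 else if i = 5 then snd p $ 2 else 0)"

definition crd :: "rvec \<Rightarrow> hpair" where
  "crd x = ((Complex (x 0) (x 1), Complex (x 2) (x 3)), vector [x 4, x 5])"

text \<open>
  The coordinates 0 to 3 are the real and imaginary parts of the horizontal component, the coordinates
  4 and 5 are central.  The inner product is the standard one, for which the layers are orthogonal.
\<close>

definition G0 :: carnot_data where
  "G0 = \<lparr>vdim = 6, layer1 = range (\<lambda>a. emb (a, 0)), layer2 = range (\<lambda>w. emb (0, w)),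
     lie = (\<lambda>x y. emb (0, br (fst (crd x)) (fst (crd y)))), inp = (\<lambda>x y. crd x \<bullet> crd y)\<rparr>"

lemma G0_simps [simp]: "vdim G0 = 6" "layer1 G0 = range (\<lambda>a. emb (a, 0))" "layer2 G0 = range (\<lambda>w. emb (0, w))"
   "lie G0 x y = emb (0, br (fst (crd x)) (fst (crd y)))" "inp G0 x y = crd x \<bullet> crd y"
  by (simp_all add: G0_def)

lemma crd_emb [simp]: "crd (emb p) = p"
  by (simp add: crd_def emb_def prod_eq_iff complex_eq_iff vec_eq_iff forall_2)

lemma emb_add: "emb (p + q) = emb p + emb q"
  by (auto simp: emb_def fun_eq_iff)

lemma emb_scaleR: "emb (c *\<^sub>R p) = c *\<^sub>R emb p"
  by (auto simp: emb_def fun_eq_iff scaleR_fun_def)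

lemma emb_0 [simp]: "emb 0 = 0" "emb (0, 0) = 0"
  by (auto simp: emb_def fun_eq_iff)

lemma crd_add: "crd (x + y) = crd x + crd y"
  by (simp add: crd_def prod_eq_iff complex_eq_iff vec_eq_iff forall_2)

lemma crd_scaleR: "crd (c *\<^sub>R x) = c *\<^sub>R crd x"
  by (simp add: crd_def scaleR_fun_def prod_eq_iff complex_eq_iff vec_eq_iff forall_2)

lemma crd_0 [simp]: "crd 0 = 0"
  by (simp add: crd_def prod_eq_iff complex_eq_iff vec_eq_iff forall_2)

lemma emb_eq_iff [simp]: "emb p = emb q \<longleftrightarrow> p = q"
  by (metis crd_emb)

lemma emb_eq_0_iff [simp]: "emb p = 0 \<longleftrightarrow> p = 0"
  using emb_eq_iff[of p 0] by simp

lemma alg_G0: "alg G0 = range emb"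
proof (intro set_eqI iffI)
  fix x assume "x \<in> alg G0"
  then have z: "x i = 0" if "i \<ge> 6" for i using that by (simp add: alg_def topspace_Euclidean_space)
  have "x = emb (crd x)"
  proof
    fix i :: nat
    consider "i = 0" | "i = 1" | "i = 2" | "i = 3" | "i = 4" | "i = 5" | "i \<ge> 6" by linarith
    then show "x i = emb (crd x) i" by cases (simp_all add: emb_def crd_def z)
  qed
  then show "x \<in> range emb" by blast
qed (auto simp: alg_def topspace_Euclidean_space emb_def)

lemma emb_in_alg [simp]: "emb p \<in> alg G0"
  by (simp add: alg_G0)

lemma emb_crd: "x \<in> alg G0 \<Longrightarrow> emb (crd x) = x"
  by (auto simp: alg_G0)

lemma emb_snd_add: "emb (0, v + w) = emb (0, v) + emb (0, w)" and emb_snd_scaleR: "emb (0, c *\<^sub>R v) = c *\<^sub>R emb (0, v)"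
  and emb_fst_add: "emb (a + b, 0) = emb (a, 0) + emb (b, 0)" and emb_fst_scaleR: "emb (c *\<^sub>R a, 0) = c *\<^sub>R emb (a, 0)"
  by (simp_all flip: emb_add emb_scaleR)

lemma fst_crd_add: "fst (crd (a *\<^sub>R x + b *\<^sub>R y)) = a *\<^sub>R fst (crd x) + b *\<^sub>R fst (crd y)"
  by (simp add: crd_add crd_scaleR)

lemma step_two_carnot_G0: "step_two_carnot G0"
  unfolding step_two_carnot_def
proof (intro conjI)
  show "lie_algebra G0"
    unfolding lie_algebra_def
    by (auto simp: fst_crd_add br.add_left br.add_right br.scaleR_left br.scaleR_right emb_snd_add emb_snd_scaleR br.zero_right)
  show "adapted_inner_product G0"
    unfolding adapted_inner_product_def
  proof (intro conjI ballI allI impI)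
    fix x assume "x \<in> alg G0" "x \<noteq> 0"
    then show "inp G0 x x > 0" by (auto simp: alg_G0)
  next
    fix v w assume "v \<in> layer1 G0" "w \<in> layer2 G0"
    then show "inp G0 v w = 0" by (auto simp: inner_prod_def)
  next
    fix x y show "inp G0 x y = inp G0 y x" by (simp add: inner_commute)
  qed (simp_all add: crd_add crd_scaleR inner_add_left)
  show "stratification G0"
    unfolding stratification_def
  proof (intro conjI)
    have s2: "subspace (range (\<lambda>w. emb (0, w)))"
      unfolding subspace_def by (auto simp flip: emb_snd_add emb_snd_scaleR intro: range_eqI[of _ _ 0])
    show "subspace (layer1 G0)"
      unfolding subspace_def by (auto simp flip: emb_fst_add emb_fst_scaleR intro: range_eqI[of _ _ 0])
    show "subspace (layer2 G0)" using s2 by simp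
    show "alg G0 = {v + w |v w. v \<in> layer1 G0 \<and> w \<in> layer2 G0}"
    proof (intro set_eqI iffI)
      fix x assume "x \<in> alg G0"
      then obtain p where "x = emb p" by (auto simp: alg_G0)
      then have "x = emb (fst p, 0) + emb (0, snd p)" by (simp flip: emb_add)
      then show "x \<in> {v + w |v w. v \<in> layer1 G0 \<and> w \<in> layer2 G0}" by force
    qed (auto simp: alg_G0 simp flip: emb_add)
    show "layer1 G0 \<inter> layer2 G0 = {0}" by (auto intro: range_eqI[of _ _ 0])
    show "span {lie G0 v w |v w. v \<in> layer1 G0 \<and> w \<in> layer1 G0} = layer2 G0"
    proof (rule antisym)
      show "span {lie G0 v w |v w. v \<in> layer1 G0 \<and> w \<in> layer1 G0} \<subseteq> layer2 G0"
        by (rule span_minimal) (use s2 in auto)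
      show "layer2 G0 \<subseteq> span {lie G0 v w |v w. v \<in> layer1 G0 \<and> w \<in> layer1 G0}" (is "_ \<subseteq> span ?S")
      proof
        fix x assume "x \<in> layer2 G0"
        then obtain w where x: "x = emb (0, w)" by auto
        have in_S: "emb (0, br a b) \<in> ?S" for a b
          by (rule CollectI, rule exI[of _ "emb (a, 0)"], rule exI[of _ "emb (b, 0)"]) simp
        have w: "w = (w $ 1) *\<^sub>R br (1, 0) (\<i>, 0) + ((w $ 2 - w $ 1) / 2) *\<^sub>R br (1, 0) (0, 1)"
          by (simp add: vec_eq_iff forall_2 br_def J1_def J2_def inner_prod_def inner_complex_def field_simps)
        have "x = (w $ 1) *\<^sub>R emb (0, br (1, 0) (\<i>, 0)) + ((w $ 2 - w $ 1) / 2) *\<^sub>R emb (0, br (1, 0) (0, 1))"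
          unfolding x emb_snd_scaleR[symmetric] emb_snd_add[symmetric] using w by simp
        then show "x \<in> span ?S"
          by (simp only:) (intro span_add span_scale span_base in_S)
      qed
    qed
    have "emb (0, axis 1 1) \<in> layer2 G0" "emb (0, axis 1 1) \<noteq> 0" by (simp_all add: prod_eq_iff axis_eq_0_iff)
    then show "layer2 G0 \<noteq> {0}" by blast
    have z: "br a 0 = 0" "br 0 a = 0" for a by (simp_all add: br.zero_left br.zero_right)
    show "\<forall>v\<in>layer1 G0. \<forall>w\<in>layer2 G0. lie G0 v w = 0" "\<forall>v\<in>layer2 G0. \<forall>w\<in>layer2 G0. lie G0 v w = 0"
      by (simp_all add: z zero_prod_def[symmetric])
  qed
qed

section \<open>The number \<open>N\<^sub>0\<close>\<close>

text \<open>
  Eliminating one component of \<open>a\<close> multiplies the other one by \<open>w\<^sub>1\<^sup>2 + 3 w\<^sub>2\<^sup>2\<close>, which is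
  the product of the eigenvalues \<open>\<i> (w\<^sub>2 + freq w)\<close> and \<open>\<i> (w\<^sub>2 - freq w)\<close> of \<open>J w\<close>.
\<close>

lemma J_eq_0_iff: "J w a = 0 \<longleftrightarrow> w = 0 \<or> a = 0"
proof
  assume *: "J w a = 0"
  show "w = 0 \<or> a = 0"
  proof (rule ccontr)
    assume "\<not> (w = 0 \<or> a = 0)"
    then have "w \<noteq> 0" "a \<noteq> 0" by auto
    define x y :: complex where "x = of_real (w $ 1)" and "y = of_real (w $ 2)"
    define u v where "u = fst a" and "v = snd a"
    have 1: "\<i> * (x + y) * u = 2 * y * v" and 2: "\<i> * (x - y) * v = 2 * y * u"
      using * by (simp_all add: J_def J1_def J2_def x_def y_def u_def v_def scaleR_conv_of_real prod_eq_iff algebra_simps)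
    have "(x * x + 3 * y * y) * u = 0"
    proof -
      have "\<i> * (x - y) * (\<i> * (x + y) * u) = \<i> * (x - y) * (2 * y * v)" using 1 by simp
      also have "\<dots> = 2 * y * (\<i> * (x - y) * v)" by (simp add: mult_ac)
      also have "\<dots> = 2 * y * (2 * y * u)" using 2 by simp
      finally have "\<i> * (x - y) * (\<i> * (x + y) * u) = 4 * y * y * u" by simp
      moreover have "\<i> * (x - y) * (\<i> * (x + y) * u) = - ((x - y) * (x + y) * u)"
        by (simp add: algebra_simps)
      ultimately show ?thesis by (simp add: algebra_simps)
    qed
    moreover have "(x * x + 3 * y * y) * v = 0"
    proof -
      have "\<i> * (x + y) * (\<i> * (x - y) * v) = \<i> * (x + y) * (2 * y * u)" using 2 by simp
      also have "\<dots> = 2 * y * (\<i> * (x + y) * u)" by (simp add: mult_ac)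
      also have "\<dots> = 2 * y * (2 * y * v)" using 1 by simp
      finally have "\<i> * (x + y) * (\<i> * (x - y) * v) = 4 * y * y * v" by simp
      moreover have "\<i> * (x + y) * (\<i> * (x - y) * v) = - ((x + y) * (x - y) * v)"
        by (simp add: algebra_simps)
      ultimately show ?thesis by (simp add: algebra_simps)
    qed
    moreover have "u \<noteq> 0 \<or> v \<noteq> 0" using \<open>a \<noteq> 0\<close> by (auto simp: u_def v_def prod_eq_iff)
    ultimately have "x * x + 3 * y * y = 0" by auto
    then have "of_real ((w $ 1)\<^sup>2 + 3 * (w $ 2)\<^sup>2) = (0::complex)" by (simp add: x_def y_def power2_eq_square mult.assoc)
    then have "(w $ 1)\<^sup>2 + 3 * (w $ 2)\<^sup>2 = 0" by (simp only: of_real_eq_0_iff)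
    moreover have "(w $ 1)\<^sup>2 \<ge> 0" "(w $ 2)\<^sup>2 \<ge> 0" by auto
    ultimately have "(w $ 1)\<^sup>2 = 0" "(w $ 2)\<^sup>2 = 0" by linarith+
    then show False using \<open>w \<noteq> 0\<close> by (simp add: vec_eq_iff forall_2)
  qed
qed (auto simp: J.zero_left J.zero_right)

lemma Jmap_G0: "Jmap G0 (emb (0, w)) (emb (v, 0)) = emb (J w v, 0)"
  unfolding Jmap_def
proof (rule the_equality)
  show "emb (J w v, 0) \<in> layer1 G0 \<and> (\<forall>wa\<in>layer1 G0. inp G0 (emb (0, w)) (lie G0 (emb (v, 0)) wa) = inp G0 (emb (J w v, 0)) wa)"
    by (auto simp: inner_br)
  fix z assume z: "z \<in> layer1 G0 \<and> (\<forall>wa\<in>layer1 G0. inp G0 (emb (0, w)) (lie G0 (emb (v, 0)) wa) = inp G0 z wa)"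
  then obtain c where c: "z = emb (c, 0)" by auto
  have "J w v \<bullet> b = c \<bullet> b" for b using z c by (cases b) (auto simp: inner_br)
  then have "J w v = c" by (metis inner_commute vector_eq_rdot)
  then show "z = emb (J w v, 0)" using c by simp
qed

lemma comp1_G0: "comp1 G0 (emb p) = emb (fst p, 0)"
  unfolding comp1_def
proof (rule the_equality)
  have "emb p - emb (fst p, 0) = emb (0, snd p)"
    using emb_add[of "(fst p, 0)" "(0, snd p)"] by simp
  then show "emb (fst p, 0) \<in> layer1 G0 \<and> emb p - emb (fst p, 0) \<in> layer2 G0" by simp
  fix \<xi> assume \<xi>: "\<xi> \<in> layer1 G0 \<and> emb p - \<xi> \<in> layer2 G0"
  then obtain a w where a: "\<xi> = emb (a, 0)" "emb p - emb (a, 0) = emb (0, w)" by auto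
  then have "emb p = emb (a, w)" using emb_add[of "(a, 0)" "(0, w)"] by (simp add: algebra_simps)
  then show "\<xi> = emb (fst p, 0)" using a by simp
qed

lemma comp2_G0: "comp2 G0 (emb p) = emb (0, snd p)"
  unfolding comp2_def comp1_G0 using emb_add[of "(fst p, 0)" "(0, snd p)"] by simp

lemma dim_layers_G0: "dim (layer1 G0) \<le> 4" "dim (layer2 G0) \<le> 2"
proof -
  have "layer1 G0 \<subseteq> span ((\<lambda>a. emb (a, 0)) ` {(1, 0), (\<i>, 0), (0, 1), (0, \<i>)})"
  proof
    fix x assume "x \<in> layer1 G0"
    then obtain a where x: "x = emb (a, 0)" by auto
    have a: "a = Re (fst a) *\<^sub>R (1, 0) + Im (fst a) *\<^sub>R (\<i>, 0) + Re (snd a) *\<^sub>R (0, 1) + Im (snd a) *\<^sub>R (0, \<i>)"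
      by (simp add: prod_eq_iff complex_eq_iff)
    have "x = Re (fst a) *\<^sub>R emb ((1, 0), 0) + Im (fst a) *\<^sub>R emb ((\<i>, 0), 0) + Re (snd a) *\<^sub>R emb ((0, 1), 0) + Im (snd a) *\<^sub>R emb ((0, \<i>), 0)"
      unfolding x emb_fst_scaleR[symmetric] emb_fst_add[symmetric] using a by simp
    then show "x \<in> span ((\<lambda>a. emb (a, 0)) ` {(1, 0), (\<i>, 0), (0, 1), (0, \<i>)})"
      by (simp only:) (intro span_add span_scale span_base; blast)
  qed
  from dim_le_card[OF this] have "dim (layer1 G0) \<le> card ((\<lambda>a. emb (a, 0)) ` {(1, 0), (\<i>, 0), (0, 1), (0, \<i>)} :: rvec set)" by simp
  also have "\<dots> \<le> card {(1, 0), (\<i>, 0), (0, 1), (0::complex, \<i>)}" by (rule card_image_le) simp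
  also have "\<dots> \<le> 4" by (simp add: card_insert_if)
  finally show "dim (layer1 G0) \<le> 4" .
  have "layer2 G0 \<subseteq> span ((\<lambda>w. emb (0, w)) ` {axis 1 1, axis 2 1})"
  proof
    fix x assume "x \<in> layer2 G0"
    then obtain w where x: "x = emb (0, w)" by auto
    have w: "w = (w $ 1) *\<^sub>R axis 1 1 + (w $ 2) *\<^sub>R axis 2 1"
      by (simp add: vec_eq_iff forall_2 axis_def)
    have "x = (w $ 1) *\<^sub>R emb (0, axis 1 1) + (w $ 2) *\<^sub>R emb (0, axis 2 1)"
      unfolding x emb_snd_scaleR[symmetric] emb_snd_add[symmetric] using w by simp
    then show "x \<in> span ((\<lambda>w. emb (0, w)) ` {axis 1 1, axis 2 1})"
      by (simp only:) (intro span_add span_scale span_base; blast)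
  qed
  from dim_le_card[OF this] have "dim (layer2 G0) \<le> card ((\<lambda>w. emb (0, w)) ` {axis 1 1, axis 2 1} :: rvec set)" by simp
  also have "\<dots> \<le> card {axis 1 1, axis 2 1 :: real^2}" by (rule card_image_le) simp
  also have "\<dots> \<le> 2" by (simp add: card_insert_if)
  finally show "dim (layer2 G0) \<le> 2" .
qed

text \<open>
  If \<open>p\<close> has no horizontal part, every central vector lies in \<open>W\<^sub>\<infinity>(p)\<close> and \<open>N(p)\<close> is infinite.
  Otherwise \<open>U\<^sub>1(p) = {0}\<close> by invertibility of the pencil, so the whole correction series vanishes and
  \<open>2 Q - n = 10\<close> remains.
\<close>

lemma N_zero_G0: "N_zero G0 \<le> 10"
  unfolding N_zero_def
proof (rule Sup_least, clarify)
  fix x assume x: "x \<in> alg G0" "N_at G0 x < \<infinity>"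
  then obtain p where p: "x = emb p" by (auto simp: alg_G0)
  have \<xi>: "fst p \<noteq> 0"
  proof
    assume 0: "fst p = 0"
    have "(Jmap G0 (comp2 G0 x) ^^ l) (comp1 G0 x) = 0" for l
      using Jmap_G0[of "snd p" 0] by (induction l) (simp_all add: p comp1_G0 comp2_G0 0 J.zero_right)
    moreover have "Jmap G0 (emb (0, w)) 0 = 0" for w using Jmap_G0[of w 0] by (simp add: J.zero_right)
    ultimately have "emb (0, axis 1 1) \<in> Winf G0 x" by (simp add: Winf_def)
    moreover have "emb (0, axis 1 1) \<noteq> 0" by (simp add: prod_eq_iff axis_eq_0_iff)
    ultimately have "Winf G0 x \<noteq> {0}" by blast
    then show False using x by (simp add: N_at_def)
  qed
  have "Ulow G0 x l \<subseteq> {0}" if "l > 0" for l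
  proof
    fix v assume v: "v \<in> Ulow G0 x l"
    then obtain w where w: "v = emb (0, w)" by (auto simp: Ulow_def)
    have "comp1 G0 x \<in> {(Jmap G0 (comp2 G0 x) ^^ k) (comp1 G0 x) |k. k < l}"
      using that by (intro CollectI exI[of _ 0]) simp
    then have "comp1 G0 x \<in> Uup G0 x l"
      unfolding Uup_def by (rule span_base)
    then have "Jmap G0 v (comp1 G0 x) = 0" using v by (simp add: Ulow_def)
    then have "J w (fst p) = 0" using Jmap_G0[of w "fst p"] by (simp add: w p comp1_G0 prod_eq_iff)
    then show "v \<in> {0}" using \<xi> by (simp add: J_eq_0_iff w)
  qed
  then have "Wspace G0 x l \<subseteq> span {}" if "l > 0" for l using that by (auto simp: Wspace_def)
  then have "dim (Wspace G0 x l) = 0" if "l > 0" for l using dim_le_card[of "Wspace G0 x l" "{}"] that by simp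
  then have "real l * real (dim (Wspace G0 x l)) = 0" for l by (cases "l = 0") auto
  then have "(\<Sum>l. real l * real (dim (Wspace G0 x l))) = (\<Sum>l::nat. 0)" by (rule suminf_cong)
  then have "(\<Sum>l. real l * real (dim (Wspace G0 x l))) = 0" by simp
  then have "N_at G0 x = ereal (2 * real (hom_dim G0) - real (top_dim G0))"
    using x by (auto simp: N_at_def split: if_splits)
  also have "\<dots> \<le> 10" using dim_layers_G0 by (simp add: hom_dim_def top_dim_def)
  finally show "N_at G0 x \<le> 10" .
qed

section \<open>Paths in coordinates\<close>

lemma AE_unit_interval_iff:
  "(AE t in lebesgue_on {0..1::real}. P t) \<longleftrightarrow> (\<exists>E. negligible E \<and> (\<forall>t\<in>{0..1} - E. P t))"
proof -
  have "(AE t in lebesgue_on {0..1}. P t) \<longleftrightarrow> (AE t in lebesgue. t \<in> {0..1} \<longrightarrow> P t)"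
    by (rule AE_restrict_space_iff) simp
  also have "\<dots> \<longleftrightarrow> (\<exists>E. negligible E \<and> (\<forall>t\<in>{0..1} - E. P t))"
    unfolding eventually_ae_filter negligible_iff_null_sets
  proof
    assume "\<exists>N\<in>null_sets lebesgue. {x \<in> space lebesgue. \<not> (x \<in> {0..1} \<longrightarrow> P x)} \<subseteq> N"
    then obtain N where N: "N \<in> null_sets lebesgue" "{x \<in> space lebesgue. \<not> (x \<in> {0..1} \<longrightarrow> P x)} \<subseteq> N" ..
    have "P t" if "t \<in> {0..1} - N" for t using that N(2) by auto
    then show "\<exists>E. E \<in> null_sets lebesgue \<and> (\<forall>t\<in>{0..1} - E. P t)" using N(1) by blast
  next
    assume "\<exists>E. E \<in> null_sets lebesgue \<and> (\<forall>t\<in>{0..1} - E. P t)"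
    then obtain E where E: "E \<in> null_sets lebesgue" "\<forall>t\<in>{0..1} - E. P t" by blast
    then show "\<exists>N\<in>null_sets lebesgue. {x \<in> space lebesgue. \<not> (x \<in> {0..1} \<longrightarrow> P x)} \<subseteq> N"
      by (intro bexI[of _ E]) auto
  qed
  finally show ?thesis .
qed

definition unit_vec :: "nat \<Rightarrow> rvec" where "unit_vec i = (\<lambda>j. if j = i then 1 else 0)"

lemma crd_sum: "crd x = (\<Sum>i<6. x i *\<^sub>R crd (unit_vec i))"
  by (simp add: eval_nat_numeral crd_def unit_vec_def prod_eq_iff complex_eq_iff vec_eq_iff forall_2)

lemma bounded_linear_emb_component: "bounded_linear (\<lambda>p. emb p i)"
  by (rule linear_conv_bounded_linear[THEN iffD1], rule linearI) (simp_all add: emb_add emb_scaleR scaleR_fun_def)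

lemma has_velocity_emb:
  assumes "\<And>s. s \<in> {0..1} \<Longrightarrow> \<gamma> s \<in> alg G0" "t \<in> {0..1}"
  shows "has_velocity \<gamma> (emb p) t \<longleftrightarrow> ((\<lambda>s. crd (\<gamma> s)) has_vector_derivative p) (at t within {0..1})"
proof
  assume v: "has_velocity \<gamma> (emb p) t"
  have "((\<lambda>s. \<Sum>i<6. \<gamma> s i *\<^sub>R crd (unit_vec i)) has_vector_derivative (\<Sum>i<6. emb p i *\<^sub>R crd (unit_vec i))) (at t within {0..1})"
    using v by (intro has_vector_derivative_sum) 
      (auto simp: has_velocity_def has_real_derivative_iff_has_vector_derivative intro!: bounded_linear.has_vector_derivative[OF bounded_linear_scaleR_left])
  then show "((\<lambda>s. crd (\<gamma> s)) has_vector_derivative p) (at t within {0..1})"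
    unfolding crd_sum[symmetric] by simp
next
  assume d: "((\<lambda>s. crd (\<gamma> s)) has_vector_derivative p) (at t within {0..1})"
  show "has_velocity \<gamma> (emb p) t"
    unfolding has_velocity_def has_real_derivative_iff_has_vector_derivative
  proof
    fix i
    have "((\<lambda>s. emb (crd (\<gamma> s)) i) has_vector_derivative emb p i) (at t within {0..1})"
      by (rule bounded_linear.has_vector_derivative[OF bounded_linear_emb_component d])
    then show "((\<lambda>s. \<gamma> s i) has_vector_derivative emb p i) (at t within {0..1})"
      by (rule has_vector_derivative_transform[rotated 2]) (use assms emb_crd in auto)
  qed
qed

lemma ac_path_G0: "ac_path G0 \<gamma> \<longleftrightarrow> (\<forall>t\<in>{0..1}. \<gamma> t \<in> alg G0) \<and> ac (\<lambda>t. crd (\<gamma> t))"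
proof -
  have "ac (\<lambda>t. crd (\<gamma> t))" if *: "\<And>i. ac (\<lambda>t. \<gamma> t i)"
  proof -
    have "ac (\<lambda>t. \<Sum>i<n. \<gamma> t i *\<^sub>R crd (unit_vec i))" for n
      by (induction n) (auto intro!: ac_const ac_add ac_bounded_linear[OF bounded_linear_scaleR_left] *)
    then show ?thesis unfolding crd_sum[of "\<gamma> _"] .
  qed
  moreover have "ac (\<lambda>t. \<gamma> t i)" if *: "\<forall>t\<in>{0..1}. \<gamma> t \<in> alg G0" "ac (\<lambda>t. crd (\<gamma> t))" for i
    by (rule ac_cong[OF ac_bounded_linear[OF bounded_linear_emb_component *(2)]]) (use * emb_crd in auto)
  ultimately show ?thesis by (auto simp: ac_path_def abs_cont_iff_ac)
qed

lemma ldiff_G0: "ldiff G0 x (emb (a, 0)) = emb (a, (1/2) *\<^sub>R br (fst (crd x)) a)"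
  by (simp add: ldiff_def flip: emb_scaleR emb_add)

text \<open>
  The horizontality condition at time \<open>t\<close> with control value \<open>a\<close>, in coordinates: the central component
  moves with half the bracket of position and velocity.
\<close>

definition steered_at :: "(real \<Rightarrow> rvec) \<Rightarrow> hvec \<Rightarrow> real \<Rightarrow> bool" where
  "steered_at \<gamma> a t \<longleftrightarrow> ((\<lambda>s. crd (\<gamma> s)) has_vector_derivative (a, (1/2) *\<^sub>R br (fst (crd (\<gamma> t))) a)) (at t within {0..1})"

lemma steered_at_iff:
  assumes "ac_path G0 \<gamma>" "t \<in> {0..1}"
  shows "has_velocity \<gamma> (ldiff G0 (\<gamma> t) (emb (a, 0))) t \<longleftrightarrow> steered_at \<gamma> a t"
  unfolding steered_at_def ldiff_G0 using assms by (intro has_velocity_emb) (auto simp: ac_path_G0)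

lemma steered_at_fst:
  assumes "steered_at \<gamma> a t" shows "((\<lambda>s. fst (crd (\<gamma> s))) has_vector_derivative a) (at t within {0..1})"
  using bounded_linear.has_vector_derivative[OF bounded_linear_fst assms[unfolded steered_at_def]] by simp

lemma steered_at_snd:
  assumes "steered_at \<gamma> a t" shows "((\<lambda>s. snd (crd (\<gamma> s))) has_vector_derivative (1/2) *\<^sub>R br (fst (crd (\<gamma> t))) a) (at t within {0..1})"
  using bounded_linear.has_vector_derivative[OF bounded_linear_snd assms[unfolded steered_at_def]] by simp

lemma vector_derivative_unit_unique:
  assumes "t \<in> {0..1::real}" "(f has_vector_derivative a) (at t within {0..1})" "(f has_vector_derivative b) (at t within {0..1})"
  shows "a = b"
  using vector_derivative_unique_within[OF _ assms(2,3)] assms(1) by (simp add: trivial_limit_within islimpt_Icc)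

lemma hvel_G0:
  assumes "ac_path G0 \<gamma>" "t \<in> {0..1}" "steered_at \<gamma> a t"
  shows "hvel G0 \<gamma> t = emb (a, 0)"
  unfolding hvel_def
proof (rule the_equality)
  show "emb (a, 0) \<in> layer1 G0 \<and> has_velocity \<gamma> (ldiff G0 (\<gamma> t) (emb (a, 0))) t"
    using assms by (simp add: steered_at_iff del: crd_emb)
  fix v assume v: "v \<in> layer1 G0 \<and> has_velocity \<gamma> (ldiff G0 (\<gamma> t) v) t"
  then obtain b where b: "v = emb (b, 0)" by auto
  then have "steered_at \<gamma> b t" using v assms by (simp add: steered_at_iff)
  then have "b = a" using vector_derivative_unit_unique[OF assms(2) steered_at_fst steered_at_fst] assms(3) by blast
  then show "v = emb (a, 0)" using b by simp
qed

lemma speed_G0: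
  assumes "ac_path G0 \<gamma>" "t \<in> {0..1}" "steered_at \<gamma> a t"
  shows "speed G0 \<gamma> t = norm a"
  unfolding speed_def hvel_G0[OF assms] by (simp add: inner_prod_def norm_eq_sqrt_inner)

lemma horizontal_G0:
  "horizontal G0 \<gamma> \<longleftrightarrow> ac_path G0 \<gamma> \<and> (\<exists>E u. negligible E \<and> (\<forall>t\<in>{0..1} - E. steered_at \<gamma> (u t) t))"
proof (cases "ac_path G0 \<gamma>")
  case True
  have "(\<exists>v\<in>layer1 G0. has_velocity \<gamma> (ldiff G0 (\<gamma> t) v) t) \<longleftrightarrow> (\<exists>a. steered_at \<gamma> a t)" if "t \<in> {0..1}" for t
    using steered_at_iff[OF True that] by auto
  then have "horizontal G0 \<gamma> \<longleftrightarrow> (\<exists>E. negligible E \<and> (\<forall>t\<in>{0..1} - E. \<exists>a. steered_at \<gamma> a t))"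
    using True by (simp add: horizontal_def AE_unit_interval_iff)
  also have "\<dots> \<longleftrightarrow> (\<exists>E u. negligible E \<and> (\<forall>t\<in>{0..1} - E. steered_at \<gamma> (u t) t))"
    by (metis (no_types, lifting))
  finally show ?thesis using True by blast
qed (simp add: horizontal_def)

section \<open>Calibration of short normal extremals\<close>

lemma unit_interval_constant:
  assumes "\<And>t. t \<in> {0..1::real} \<Longrightarrow> (f has_vector_derivative 0) (at t within {0..1})" "t \<in> {0..1}"
  shows "f t = (f 0 :: 'a::real_normed_vector)"
proof -
  obtain c where "\<And>x. x \<in> {0..1} \<Longrightarrow> f x = c"
    using has_vector_derivative_zero_constant[of "{0..1}" f] assms(1) by auto
  then show ?thesis using assms(2) by simp
qed

text \<open>
  The pointwise inequality behind the calibration.  Here \<open>y\<close> is the deviation of the competitor from the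
  extremal, \<open>w b + d\<close> its velocity and \<open>w b\<close> the velocity of the extremal after reparametrisation.  After
  cancellation it remains to bound \<open>A y \<bullet> d + (1 - 2 \<theta>) (y \<bullet> d)\<close>, and both summands are at most
  \<open>|y| |d|\<close>; the Riccati term \<open>- w |y|\<^sup>2\<close> completes the square \<open>(|d| - w |y|)\<^sup>2 \<ge> 0\<close>.
\<close>

lemma calibration_inequality:
  fixes a y d b :: "'a::real_inner"
  assumes skew: "A y \<bullet> b = - (y \<bullet> A b)" "A y \<bullet> y = 0" and A: "norm (A y) \<le> norm y"
    and w: "w > 0" and \<theta>: "\<bar>1 - 2 * \<theta>\<bar> \<le> 1" and "norm b = \<rho>" and b: "b = \<zeta> + A a"
    and add: "A (a + y) = A a + A y" and sc: "A (w *\<^sub>R b) = w *\<^sub>R A b"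
  shows "\<rho>\<^sup>2 * w + A (a + y) \<bullet> (w *\<^sub>R b + d) - w * (A a \<bullet> b) + (A (w *\<^sub>R b) \<bullet> y + A a \<bullet> d) + 2 * (\<zeta> \<bullet> d)
      + ((1/2 - \<theta>) * (2 * (y \<bullet> d)) - w * (y \<bullet> y)) \<le> (norm (w *\<^sub>R b + d))\<^sup>2 / w"
proof -
  have nn: "norm z * norm z = z \<bullet> z" for z :: 'a using power2_norm_eq_inner[of z] by (simp add: power2_eq_square)
  have \<rho>: "\<rho>\<^sup>2 = b \<bullet> b" using assms(6) by (simp add: power2_norm_eq_inner[symmetric])
  have R: "(norm (w *\<^sub>R b + d))\<^sup>2 / w = w * (b \<bullet> b) + 2 * (b \<bullet> d) + (d \<bullet> d) / w"
    using w by (simp add: power2_norm_eq_inner inner_add_left inner_add_right inner_commute field_simps)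
  have "A y \<bullet> d \<le> norm y * norm d"
    using norm_cauchy_schwarz[of "A y" d] mult_right_mono[OF A, of "norm d"] by simp
  moreover have "(1 - 2 * \<theta>) * (y \<bullet> d) \<le> norm y * norm d"
  proof -
    have "(1 - 2 * \<theta>) * (y \<bullet> d) \<le> \<bar>1 - 2 * \<theta>\<bar> * \<bar>y \<bullet> d\<bar>" by (metis abs_ge_self abs_mult)
    also have "\<dots> \<le> 1 * (norm y * norm d)"
      using \<theta> by (intro mult_mono) (auto simp: Cauchy_Schwarz_ineq2)
    finally show ?thesis by simp
  qed
  moreover have "2 * (norm y * norm d) - w * (y \<bullet> y) \<le> (d \<bullet> d) / w"
  proof -
    have "0 \<le> (norm d - w * norm y)\<^sup>2" by simp
    then have "2 * w * (norm y * norm d) - w * w * (y \<bullet> y) \<le> d \<bullet> d"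
      by (simp add: power2_eq_square algebra_simps flip: nn)
    then show ?thesis using w by (simp add: field_simps)
  qed
  ultimately have key: "A y \<bullet> d + (1 - 2 * \<theta>) * (y \<bullet> d) - w * (y \<bullet> y) \<le> (d \<bullet> d) / w" by linarith
  have "\<rho>\<^sup>2 * w + A (a + y) \<bullet> (w *\<^sub>R b + d) - w * (A a \<bullet> b) + (A (w *\<^sub>R b) \<bullet> y + A a \<bullet> d) + 2 * (\<zeta> \<bullet> d)
      + ((1/2 - \<theta>) * (2 * (y \<bullet> d)) - w * (y \<bullet> y))
    = w * (b \<bullet> b) + 2 * ((\<zeta> + A a) \<bullet> d) + (A y \<bullet> d + (1 - 2 * \<theta>) * (y \<bullet> d) - w * (y \<bullet> y))"
    unfolding add sc \<rho> by (simp add: inner_add_left inner_add_right skew(1) inner_commute[of y "A b"] algebra_simps)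
  also have "\<dots> \<le> (norm (w *\<^sub>R b + d))\<^sup>2 / w" unfolding R b[symmetric] using key by simp
  finally show ?thesis .
qed

text \<open>
  Here \<open>A = J w\<close> for the covector \<open>w\<close> of the extremal \<open>(xr, zr)\<close>, and \<open>s\<close>, \<open>zr\<close> are the central components
  paired with \<open>w\<close>.  The competitor \<open>(x, s)\<close> is compared with the extremal run at the time \<open>\<theta> t\<close> that is
  the normalised arclength of the competitor, regularised by \<open>\<delta> > 0\<close> so as to be strictly
  increasing.  The function \<open>\<Phi>\<close> plays the role of a solution of the Hamilton-Jacobi equation along the
  competitor: it has the end values 0 and \<open>\<rho>\<^sup>2\<close>, where \<open>\<rho>\<close> is the length of the extremal, and its
  derivative is at most \<open>(L + \<delta>) |u|\<close>, where \<open>L\<close> is the length of the competitor.  Integration gives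
  \<open>\<rho>\<^sup>2 \<le> (L + \<delta>) L\<close>.  The correction \<open>(1/2 - \<theta>) |y|\<^sup>2\<close>, which vanishes at both ends together with
  \<open>y\<close>, absorbs the quadratic terms provided that \<open>A\<close> has norm at most 1, that is, for short extremals.
\<close>

lemma normal_extremal_length_le:
  fixes x u xr ur :: "real \<Rightarrow> 'a::euclidean_space" and s zr :: "real \<Rightarrow> real"
  assumes A: "bounded_linear A" "\<And>a b. A a \<bullet> b = - (a \<bullet> A b)" "\<And>a. norm (A a) \<le> norm a"
    and xr: "\<And>t. t \<in> {0..1} \<Longrightarrow> (xr has_vector_derivative ur t) (at t within {0..1})" "xr 0 = 0"
    and ur: "\<And>t. t \<in> {0..1} \<Longrightarrow> (ur has_vector_derivative A (ur t)) (at t within {0..1})"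
    and zr: "\<And>t. t \<in> {0..1} \<Longrightarrow> (zr has_vector_derivative (1/2) * (A (xr t) \<bullet> ur t)) (at t within {0..1})" "zr 0 = 0"
    and x: "ac x" "ac s" "negligible E" "\<And>t. t \<in> {0..1} - E \<Longrightarrow> (x has_vector_derivative u t) (at t within {0..1})"
      "\<And>t. t \<in> {0..1} - E \<Longrightarrow> (s has_vector_derivative (1/2) * (A (x t) \<bullet> u t)) (at t within {0..1})"
      "x 0 = 0" "s 0 = 0" "x 1 = xr 1" "s 1 = zr 1"
  shows "norm (ur 0) \<le> integral {0..1} (\<lambda>t. norm (u t))"
proof -
  interpret A: bounded_linear A by fact
  have self: "A a \<bullet> a = 0" for a using A(2)[of a a] by (simp add: inner_commute)
  have u: "u absolutely_integrable_on {0..1}" by (rule ac_absolutely_integrable[OF x(1,3,4)])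
  define \<rho> where "\<rho> = norm (ur 0)"
  have d1: "((\<lambda>t. ur t \<bullet> ur t) has_vector_derivative 0) (at t within {0..1})" if "t \<in> {0..1}" for t
    using bounded_bilinear.has_vector_derivative[OF bounded_bilinear_inner ur[OF that] ur[OF that]]
    by (simp add: self inner_commute[of "ur t" "A (ur t)"])
  have n\<rho>: "norm (ur t) = \<rho>" if "t \<in> {0..1}" for t
    using unit_interval_constant[of "\<lambda>t. ur t \<bullet> ur t", OF d1 that] by (simp add: \<rho>_def norm_eq_sqrt_inner)
  have d2: "((\<lambda>t. ur t - A (xr t)) has_vector_derivative 0) (at t within {0..1})" if "t \<in> {0..1}" for t
    using has_vector_derivative_diff[OF ur[OF that] A.has_vector_derivative[OF xr(1)[OF that]]] by simp
  have urA: "ur t = ur 0 + A (xr t)" if "t \<in> {0..1}" for t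
    using unit_interval_constant[of "\<lambda>t. ur t - A (xr t)", OF d2 that] by (simp add: xr A.zero algebra_simps)
  have cur: "continuous_on {0..1} ur" 
    using has_vector_derivative_continuous[OF ur] by (simp add: continuous_on_eq_continuous_within)
  have cxr: "continuous_on {0..1} xr" 
    using has_vector_derivative_continuous[OF xr(1)] by (simp add: continuous_on_eq_continuous_within)
  define l where "l t = norm (u t)" for t
  have l: "l absolutely_integrable_on {0..1}" "l integrable_on {0..1}"
    using absolutely_integrable_norm[OF u] by (simp_all add: l_def[abs_def] o_def absolutely_integrable_on_def)
  define L where "L = integral {0..1} l"
  have L: "L \<ge> 0" unfolding L_def by (rule integral_nonneg[OF l(2)]) (simp add: l_def)
  have step: "\<rho>\<^sup>2 \<le> (L + \<delta>) * L" if \<delta>: "\<delta> > 0" for \<delta>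
  proof -
    \<comment> \<open>The derivative of the regularised arclength, normalised to total mass 1.\<close>
    define w where "w t = (l t + \<delta>) / (L + \<delta>)" for t
    have w0: "w t > 0" for t using L \<delta> by (auto simp: w_def l_def add_nonneg_pos)
    have wi: "w absolutely_integrable_on {0..1}" "w integrable_on {0..1}"
    proof -
      have "(\<lambda>t. (1 / (L + \<delta>)) *\<^sub>R (l t + \<delta>)) absolutely_integrable_on {0..1}"
        by (intro absolutely_integrable_scaleR_left set_integral_add(1) l absolutely_integrable_on_const) auto
      then show "w absolutely_integrable_on {0..1}" by (simp add: w_def[abs_def])
      then show "w integrable_on {0..1}" by (simp add: absolutely_integrable_on_def)
    qed
    define \<theta> where "\<theta> t = integral {0..t} w" for t
    have ac\<theta>: "ac \<theta>" unfolding \<theta>_def[abs_def] by (rule ac_integral[OF wi(1)])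
    obtain E2 where E2: "negligible E2" "\<And>t. t \<in> {0..1} - E2 \<Longrightarrow> (\<theta> has_vector_derivative w t) (at t within {0..1})"
      using AE_deriv_integral[OF wi(2)] unfolding \<theta>_def[abs_def] by blast
    have \<theta>0: "\<theta> 0 = 0" by (simp add: \<theta>_def)
    have \<theta>1: "\<theta> 1 = 1"
    proof -
      have "integral {0..1} (\<lambda>t. (1 / (L + \<delta>)) *\<^sub>R (l t + \<delta>)) = (1 / (L + \<delta>)) *\<^sub>R (L + \<delta>)"
        using l by (simp only: integral_cmul) (simp add: integral_add L_def integrable_on_const)
      then show ?thesis using L \<delta> by (simp add: \<theta>_def w_def[abs_def])
    qed
    have \<theta>I: "\<theta> t \<in> {0..1}" if t: "t \<in> {0..1}" for t
    proof -
      have wt: "w integrable_on {0..t}" using integrable_on_subinterval[OF wi(2), of 0 t] t by auto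
      have "0 \<le> \<theta> t" unfolding \<theta>_def by (rule integral_nonneg[OF wt]) (use w0 in \<open>auto simp: less_imp_le\<close>)
      moreover have "\<theta> t \<le> \<theta> 1" unfolding \<theta>_def
        by (rule integral_subset_le[OF _ wt wi(2)]) (use t w0 in \<open>auto simp: less_imp_le\<close>)
      ultimately show ?thesis using \<theta>1 by simp
    qed
    have comp: "((\<lambda>t. f (\<theta> t)) has_vector_derivative w t *\<^sub>R f') (at t within {0..1})"
      if t: "t \<in> {0..1} - E2" and f: "\<And>s. s = \<theta> t \<Longrightarrow> (f has_vector_derivative f') (at s within {0..1})" for t f and f' :: "'z::real_normed_vector"
    proof -
      have "(f has_vector_derivative f') (at (\<theta> t) within \<theta> ` {0..1})"
        by (rule has_vector_derivative_within_subset[OF f]) (use \<theta>I in auto)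
      from vector_diff_chain_within[OF E2(2)[OF t] this] show ?thesis by (simp add: o_def)
    qed
    define y where "y t = x t - xr (\<theta> t)" for t
    define \<Phi> where "\<Phi> t = \<rho>\<^sup>2 * \<theta> t + 2 * s t - 2 * zr (\<theta> t) + A (xr (\<theta> t)) \<bullet> y t + 2 * (ur 0 \<bullet> y t)
        + (1/2 - \<theta> t) * (y t \<bullet> y t)" for t
    have acxr: "ac (\<lambda>t. xr (\<theta> t))" by (rule ac_compose_C1[OF ac\<theta> \<theta>I xr(1) cur])
    have aczr: "ac (\<lambda>t. zr (\<theta> t))"
    proof (rule ac_compose_C1[OF ac\<theta> \<theta>I zr(1)])
      show "continuous_on {0..1} (\<lambda>t. 1 / 2 * (A (xr t) \<bullet> ur t))"
        by (intro continuous_intros cur A.continuous_on cxr)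
    qed
    have acy: "ac y" unfolding y_def[abs_def] by (rule ac_diff[OF x(1) acxr])
    have ac\<Phi>: "ac \<Phi>"
      unfolding \<Phi>_def[abs_def]
      by (intro ac_add ac_diff ac_bilinear[OF bounded_bilinear_inner] ac_bilinear[OF bounded_bilinear_mult] ac_const
          ac\<theta> x(2) aczr acy ac_bounded_linear[OF A(1)] acxr)
    define \<Phi>' where "\<Phi>' t = \<rho>\<^sup>2 * w t + A (x t) \<bullet> u t - w t * (A (xr (\<theta> t)) \<bullet> ur (\<theta> t))
        + (A (w t *\<^sub>R ur (\<theta> t)) \<bullet> y t + A (xr (\<theta> t)) \<bullet> (u t - w t *\<^sub>R ur (\<theta> t))) + 2 * (ur 0 \<bullet> (u t - w t *\<^sub>R ur (\<theta> t)))
        + ((1/2 - \<theta> t) * (2 * (y t \<bullet> (u t - w t *\<^sub>R ur (\<theta> t)))) - w t * (y t \<bullet> y t))" for t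
    have d\<Phi>: "(\<Phi> has_vector_derivative \<Phi>' t) (at t within {0..1})" if t: "t \<in> {0..1} - (E \<union> E2)" for t
    proof -
      have t': "t \<in> {0..1} - E" "t \<in> {0..1} - E2" using t by auto
      note inn = bounded_bilinear.has_vector_derivative[OF bounded_bilinear_inner]
      note mul = bounded_bilinear.has_vector_derivative[OF bounded_bilinear_mult]
      have dxr: "((\<lambda>t. xr (\<theta> t)) has_vector_derivative w t *\<^sub>R ur (\<theta> t)) (at t within {0..1})"
        by (intro comp[OF t'(2)]) (use xr(1)[OF \<theta>I[of t]] t in simp)
      have dzr: "((\<lambda>t. zr (\<theta> t)) has_vector_derivative w t *\<^sub>R ((1/2) * (A (xr (\<theta> t)) \<bullet> ur (\<theta> t)))) (at t within {0..1})"
        by (intro comp[OF t'(2)]) (use zr(1)[OF \<theta>I[of t]] t in simp)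
      have dy: "(y has_vector_derivative (u t - w t *\<^sub>R ur (\<theta> t))) (at t within {0..1})"
        unfolding y_def[abs_def] by (rule has_vector_derivative_diff[OF x(4)[OF t'(1)] dxr])
      note d\<theta> = E2(2)[OF t'(2)] and ds = x(5)[OF t'(1)]
      have half: "((\<lambda>t. 1/2 - \<theta> t) has_vector_derivative (0 - w t)) (at t within {0..1})"
        by (rule has_vector_derivative_diff[OF has_vector_derivative_const d\<theta>])
      have "(\<Phi> has_vector_derivative (\<rho>\<^sup>2 * w t + 0 * \<theta> t) + (2 * ((1/2) * (A (x t) \<bullet> u t)) + 0 * s t)
          - (2 * (w t *\<^sub>R ((1/2) * (A (xr (\<theta> t)) \<bullet> ur (\<theta> t)))) + 0 * zr (\<theta> t))
          + (A (xr (\<theta> t)) \<bullet> (u t - w t *\<^sub>R ur (\<theta> t)) + A (w t *\<^sub>R ur (\<theta> t)) \<bullet> y t)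
          + (2 * (ur 0 \<bullet> (u t - w t *\<^sub>R ur (\<theta> t)) + 0 \<bullet> y t) + 0 * (ur 0 \<bullet> y t))
          + ((1/2 - \<theta> t) * (y t \<bullet> (u t - w t *\<^sub>R ur (\<theta> t)) + (u t - w t *\<^sub>R ur (\<theta> t)) \<bullet> y t) + (0 - w t) * (y t \<bullet> y t))) (at t within {0..1})"
        unfolding \<Phi>_def[abs_def]
        by (intro has_vector_derivative_add has_vector_derivative_diff mul inn has_vector_derivative_const
            d\<theta> ds dzr dy half A.has_vector_derivative dxr)
      moreover have "(\<rho>\<^sup>2 * w t + 0 * \<theta> t) + (2 * ((1/2) * (A (x t) \<bullet> u t)) + 0 * s t)
          - (2 * (w t *\<^sub>R ((1/2) * (A (xr (\<theta> t)) \<bullet> ur (\<theta> t)))) + 0 * zr (\<theta> t))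
          + (A (xr (\<theta> t)) \<bullet> d + c \<bullet> y t) + (2 * (ur 0 \<bullet> d + 0 \<bullet> y t) + 0 * (ur 0 \<bullet> y t))
          + ((1/2 - \<theta> t) * (y t \<bullet> d + d \<bullet> y t) + (0 - w t) * (y t \<bullet> y t))
        = \<rho>\<^sup>2 * w t + A (x t) \<bullet> u t - w t * (A (xr (\<theta> t)) \<bullet> ur (\<theta> t)) + (c \<bullet> y t + A (xr (\<theta> t)) \<bullet> d) + 2 * (ur 0 \<bullet> d)
        + ((1/2 - \<theta> t) * (2 * (y t \<bullet> d)) - w t * (y t \<bullet> y t))" for c d
        unfolding inner_commute[of d "y t"] by simp
      ultimately show ?thesis unfolding \<Phi>'_def by metis
    qed
    have le: "\<Phi>' t \<le> (L + \<delta>) * l t" if t: "t \<in> {0..1}" for t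
    proof -
      have th: "\<bar>1 - 2 * \<theta> t\<bar> \<le> 1" using \<theta>I[OF t] by auto
      have "\<Phi>' t \<le> (norm (w t *\<^sub>R ur (\<theta> t) + (u t - w t *\<^sub>R ur (\<theta> t))))\<^sup>2 / w t"
        using calibration_inequality[of A "y t" "ur (\<theta> t)" "w t" "\<theta> t" \<rho> "ur 0" "xr (\<theta> t)" "u t - w t *\<^sub>R ur (\<theta> t)",
           OF A(2) self A(3) w0 th n\<rho>[OF \<theta>I[OF t]] urA[OF \<theta>I[OF t]] A.add A.scaleR]
        by (simp add: \<Phi>'_def y_def)
      also have "\<dots> = (l t)\<^sup>2 * (L + \<delta>) / (l t + \<delta>)" by (simp add: l_def w_def)
      also have "\<dots> \<le> (L + \<delta>) * l t"
      proof -
        have "l t * l t * (L + \<delta>) \<le> (L + \<delta>) * l t * (l t + \<delta>)"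
          using L \<delta> by (simp add: l_def algebra_simps)
        then show ?thesis using \<delta> by (simp add: divide_le_eq add_nonneg_pos l_def power2_eq_square)
      qed
      finally show ?thesis .
    qed
    have "(\<Phi>' has_integral (\<Phi> 1 - \<Phi> 0)) {0..1}"
      using ac_has_integral[OF ac\<Phi> negligible_Un[OF x(3) E2(1)] d\<Phi>, of 0 1] by auto
    moreover have "((\<lambda>t. (L + \<delta>) * l t) has_integral (L + \<delta>) * L) {0..1}"
      unfolding L_def using l(2) by (intro has_integral_mult_right integrable_integral)
    ultimately have "\<Phi> 1 - \<Phi> 0 \<le> (L + \<delta>) * L" by (rule has_integral_le[OF _ _ le])
    moreover have "\<Phi> 1 = \<rho>\<^sup>2" by (simp add: \<Phi>_def y_def \<theta>1 x)
    moreover have "\<Phi> 0 = 0" by (simp add: \<Phi>_def y_def \<theta>0 x xr zr)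
    ultimately show ?thesis by simp
  qed
  have "\<rho>\<^sup>2 \<le> L * L"
  proof (rule field_le_epsilon)
    fix e :: real assume "e > 0"
    then have "\<rho>\<^sup>2 \<le> (L + e / (L + 1)) * L" using L by (intro step) auto
    also have "\<dots> \<le> L * L + e" using L \<open>e > 0\<close> by (simp add: field_simps)
    finally show "\<rho>\<^sup>2 \<le> L * L + e" .
  qed
  then have "\<rho>\<^sup>2 \<le> L\<^sup>2" by (simp only: power2_eq_square)
  then have "\<rho> \<le> L" using L by (rule power2_le_imp_le)
  then show ?thesis by (simp add: \<rho>_def L_def l_def[abs_def])
qed

section \<open>The endpoint map and abnormal paths\<close>

definition hcoord :: "(real \<Rightarrow> rvec) \<Rightarrow> real \<Rightarrow> hvec" where "hcoord v t = fst (crd (v t))"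

lemma integrable_unit_iff:
  fixes f :: "real \<Rightarrow> 'a::euclidean_space"
  shows "integrable (lebesgue_on {0..1}) f \<longleftrightarrow> f absolutely_integrable_on {0..1}"
  by (simp add: integrable_restrict_space set_integrable_def)

lemma integral_unit_eq:
  fixes f :: "real \<Rightarrow> 'a::euclidean_space"
  assumes "f absolutely_integrable_on {0..1}"
  shows "integral\<^sup>L (lebesgue_on {0..1}) f = integral {0..1} f"
  using set_lebesgue_integral_eq_integral(2)[OF assms]
  by (simp add: integral_restrict_space set_lebesgue_integral_def)

lemma continuous_absolutely_integrable_unit:
  fixes f :: "real \<Rightarrow> 'a::euclidean_space"
  shows "continuous_on {0..1} f \<Longrightarrow> f absolutely_integrable_on {0..1}"
  using absolutely_integrable_continuous_real .

lemma bilinear_absolutely_integrable: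
  fixes h :: "'a::euclidean_space \<Rightarrow> 'b::euclidean_space \<Rightarrow> 'c::euclidean_space"
  assumes h: "bounded_bilinear h" and f: "continuous_on {0..1::real} f" and g: "g absolutely_integrable_on {0..1}"
  shows "(\<lambda>t. h (f t) (g t)) absolutely_integrable_on {0..1}"
proof (rule absolutely_integrable_bounded_measurable_product[where h=h and f=f and g=g and S="{0..1}"])
  show "bilinear h" using h by (simp add: bilinear_conv_bounded_bilinear)
  show "f \<in> borel_measurable (lebesgue_on {0..1})"
    by (rule continuous_imp_measurable_on_sets_lebesgue[OF f]) simp
  show "bounded (f ` {0..1})" by (intro compact_imp_bounded compact_continuous_image f) simp
qed (simp_all add: g)

lemma L2_control_iff:
  "v \<in> L2_control G0 \<longleftrightarrow> (\<forall>t\<in>{0..1}. v t = emb (hcoord v t, 0)) \<and>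
     hcoord v \<in> borel_measurable (lebesgue_on {0..1}) \<and> (\<lambda>t. (norm (hcoord v t))\<^sup>2) absolutely_integrable_on {0..1}"
proof (cases "\<forall>t\<in>{0..1}. v t = emb (hcoord v t, 0)")
  case True
  have "(\<forall>i. (\<lambda>t. v t i) \<in> borel_measurable (lebesgue_on {0..1})) \<longleftrightarrow> hcoord v \<in> borel_measurable (lebesgue_on {0..1})"
  proof
    assume "\<forall>i. (\<lambda>t. v t i) \<in> borel_measurable (lebesgue_on {0..1})"
    then have "(\<lambda>t. \<Sum>i<6. v t i *\<^sub>R crd (unit_vec i)) \<in> borel_measurable (lebesgue_on {0..1})"
      by (intro borel_measurable_sum borel_measurable_scaleR) auto
    then have c: "(\<lambda>t. crd (v t)) \<in> borel_measurable (lebesgue_on {0..1})" by (simp only: crd_sum[symmetric])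
    have "continuous_on UNIV (fst :: hpair \<Rightarrow> hvec)" by (intro continuous_intros)
    from borel_measurable_continuous_on[OF this c] show "hcoord v \<in> borel_measurable (lebesgue_on {0..1})"
      by (simp add: hcoord_def[abs_def])
  next
    assume m: "hcoord v \<in> borel_measurable (lebesgue_on {0..1})"
    show "\<forall>i. (\<lambda>t. v t i) \<in> borel_measurable (lebesgue_on {0..1})"
    proof
      fix i
      have "bounded_linear (\<lambda>a. emb (a, 0) i)"
        using bounded_linear_compose[OF bounded_linear_emb_component bounded_linear_Pair[OF bounded_linear_ident bounded_linear_zero]] .
      from borel_measurable_continuous_on[OF linear_continuous_on[OF this] m]
      have "(\<lambda>t. emb (hcoord v t, 0) i) \<in> borel_measurable (lebesgue_on {0..1})" .
      then show "(\<lambda>t. v t i) \<in> borel_measurable (lebesgue_on {0..1})"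
        by (rule measurable_cong[THEN iffD1, rotated]) (use True in auto)
    qed
  qed
  moreover have "integrable (lebesgue_on {0..1}) (\<lambda>t. inp G0 (v t) (v t)) \<longleftrightarrow> integrable (lebesgue_on {0..1}) (\<lambda>t. (norm (hcoord v t))\<^sup>2)"
  proof (rule Bochner_Integration.integrable_cong[OF refl])
    fix t assume "t \<in> space (lebesgue_on {0..1::real})"
    then have "v t = emb (hcoord v t, 0)" using True by auto
    then have "inp G0 (v t) (v t) = (hcoord v t, 0::real^2) \<bullet> (hcoord v t, 0)" by (metis G0_simps(5) crd_emb)
    then show "inp G0 (v t) (v t) = (norm (hcoord v t))\<^sup>2" by (simp add: inner_prod_def power2_norm_eq_inner)
  qed
  moreover have "\<forall>t\<in>{0..1}. v t \<in> layer1 G0" 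
  proof
    fix t :: real assume "t \<in> {0..1}"
    then have "v t = emb (hcoord v t, 0)" using True by blast
    then show "v t \<in> layer1 G0" by simp
  qed
  ultimately show ?thesis using True unfolding L2_control_def integrable_unit_iff by blast
next
  case False
  then have "\<not> (\<forall>t\<in>{0..1}. v t \<in> layer1 G0)" by (force simp: hcoord_def)
  then show ?thesis using False unfolding L2_control_def by blast
qed

lemma L2_controlD:
  assumes "v \<in> L2_control G0"
  shows "\<And>t. t \<in> {0..1} \<Longrightarrow> v t = emb (hcoord v t, 0)" "hcoord v absolutely_integrable_on {0..1}"
    "(\<lambda>t. (norm (hcoord v t))\<^sup>2) absolutely_integrable_on {0..1}"
    "L2_norm G0 v = sqrt (integral {0..1} (\<lambda>t. (norm (hcoord v t))\<^sup>2))"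
proof -
  note v = assms[unfolded L2_control_iff]
  show 1: "\<And>t. t \<in> {0..1} \<Longrightarrow> v t = emb (hcoord v t, 0)" using v by blast
  show 3: "(\<lambda>t. (norm (hcoord v t))\<^sup>2) absolutely_integrable_on {0..1}" using v by blast
  have i: "(\<lambda>t. (norm (hcoord v t))\<^sup>2 + 1) integrable_on {0..1}"
    using 3 by (intro integrable_add) (auto simp: absolutely_integrable_on_def integrable_on_const)
  show "hcoord v absolutely_integrable_on {0..1}"
  proof (rule measurable_bounded_by_integrable_imp_absolutely_integrable[OF _ _ i])
    fix t :: real
    have "0 \<le> (norm (hcoord v t) - 1)\<^sup>2 + (norm (hcoord v t))\<^sup>2 + 1" by simp
    then have "2 * norm (hcoord v t) \<le> 2 * ((norm (hcoord v t))\<^sup>2 + 1)" by (simp add: power2_eq_square algebra_simps)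
    then show "norm (hcoord v t) \<le> (norm (hcoord v t))\<^sup>2 + 1" by simp
  qed (use v in auto)
  have "integral\<^sup>L (lebesgue_on {0..1}) (\<lambda>t. inp G0 (v t) (v t)) = integral\<^sup>L (lebesgue_on {0..1}) (\<lambda>t. (norm (hcoord v t))\<^sup>2)"
  proof (rule Bochner_Integration.integral_cong[OF refl])
    fix t assume "t \<in> space (lebesgue_on {0..1::real})"
    then have "v t = emb (hcoord v t, 0)" using 1 by auto
    then have "inp G0 (v t) (v t) = (hcoord v t, 0::real^2) \<bullet> (hcoord v t, 0)" by (metis G0_simps(5) crd_emb)
    then show "inp G0 (v t) (v t) = (norm (hcoord v t))\<^sup>2" by (simp add: inner_prod_def power2_norm_eq_inner)
  qed
  then show "L2_norm G0 v = sqrt (integral {0..1} (\<lambda>t. (norm (hcoord v t))\<^sup>2))"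
    unfolding L2_norm_def using integral_unit_eq[OF 3] by simp
qed

text \<open>
  Integrating \<open>(norm (hcoord v) - m)\<^sup>2 \<ge> 0\<close>, where \<open>m\<close> is the mean of the norm, gives the Cauchy-Schwarz
  inequality on the unit interval.
\<close>

lemma integral_norm_le_L2_norm:
  assumes "v \<in> L2_control G0"
  shows "integral {0..1} (\<lambda>t. norm (hcoord v t)) \<le> L2_norm G0 v"
proof -
  note v = L2_controlD[OF assms]
  define m where "m = integral {0..1} (\<lambda>t. norm (hcoord v t))"
  have n: "(\<lambda>t. norm (hcoord v t)) integrable_on {0..1}" and n2: "(\<lambda>t. (norm (hcoord v t))\<^sup>2) integrable_on {0..1}"
    using v(2,3) by (auto simp: absolutely_integrable_on_def)
  have "integral {0..1} (\<lambda>t. 2 * m * norm (hcoord v t)) \<le> integral {0..1} (\<lambda>t. (norm (hcoord v t))\<^sup>2 + m\<^sup>2)"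
  proof (rule integral_le)
    show "2 * m * norm (hcoord v t) \<le> (norm (hcoord v t))\<^sup>2 + m\<^sup>2" for t
      using sum_squares_bound[of m "norm (hcoord v t)"] by simp
  qed (intro integrable_add n2 integrable_on_const integrable_on_mult_right n; simp)+
  then have "2 * m * m \<le> integral {0..1} (\<lambda>t. (norm (hcoord v t))\<^sup>2) + m\<^sup>2"
    using n n2 by (simp add: integral_add integrable_on_const m_def[symmetric])
  then have "m\<^sup>2 \<le> integral {0..1} (\<lambda>t. (norm (hcoord v t))\<^sup>2)" by (simp add: power2_eq_square)
  then have "m \<le> sqrt (integral {0..1} (\<lambda>t. (norm (hcoord v t))\<^sup>2))" by (rule real_le_rsqrt)
  then show ?thesis by (simp add: v(4) m_def)
qed

lemma L2_control_comb:
  assumes "v \<in> L2_control G0" "w \<in> L2_control G0"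
  shows "a *\<^sub>R v + b *\<^sub>R w \<in> L2_control G0"
    and "hcoord (a *\<^sub>R v + b *\<^sub>R w) t = a *\<^sub>R hcoord v t + b *\<^sub>R hcoord w t"
proof -
  have h: "hcoord (a *\<^sub>R v + b *\<^sub>R w) t = a *\<^sub>R hcoord v t + b *\<^sub>R hcoord w t" for t
    by (simp add: hcoord_def crd_add crd_scaleR scaleR_fun_def[of _ v] scaleR_fun_def[of _ w])
  show "hcoord (a *\<^sub>R v + b *\<^sub>R w) t = a *\<^sub>R hcoord v t + b *\<^sub>R hcoord w t" by (rule h)
  have m: "hcoord v \<in> borel_measurable (lebesgue_on {0..1})" "hcoord w \<in> borel_measurable (lebesgue_on {0..1})"
    using assms by (auto simp: L2_control_iff)
  have hf: "hcoord (a *\<^sub>R v + b *\<^sub>R w) = (\<lambda>t. a *\<^sub>R hcoord v t + b *\<^sub>R hcoord w t)" using h by auto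
  have mm: "(\<lambda>t. a *\<^sub>R hcoord v t + b *\<^sub>R hcoord w t) \<in> borel_measurable (lebesgue_on {0..1})"
    using m by (intro borel_measurable_add borel_measurable_scaleR) auto
  show "a *\<^sub>R v + b *\<^sub>R w \<in> L2_control G0"
    unfolding L2_control_iff
  proof (intro conjI ballI)
    fix t :: real assume t: "t \<in> {0..1}"
    have "(a *\<^sub>R v + b *\<^sub>R w) t = a *\<^sub>R v t + b *\<^sub>R w t" by (simp add: scaleR_fun_def[of _ v] scaleR_fun_def[of _ w])
    also have "\<dots> = a *\<^sub>R emb (hcoord v t, 0) + b *\<^sub>R emb (hcoord w t, 0)"
      using L2_controlD(1)[OF assms(1) t] L2_controlD(1)[OF assms(2) t] by simp
    also have "\<dots> = emb (hcoord (a *\<^sub>R v + b *\<^sub>R w) t, 0)" unfolding h by (simp add: emb_fst_add emb_fst_scaleR)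
    finally show "(a *\<^sub>R v + b *\<^sub>R w) t = emb (hcoord (a *\<^sub>R v + b *\<^sub>R w) t, 0)" .
  next
    show "hcoord (a *\<^sub>R v + b *\<^sub>R w) \<in> borel_measurable (lebesgue_on {0..1})" unfolding hf by (rule mm)
    have i: "(\<lambda>t. 2 * a\<^sup>2 * (norm (hcoord v t))\<^sup>2 + 2 * b\<^sup>2 * (norm (hcoord w t))\<^sup>2) integrable_on {0..1}"
      using L2_controlD(3)[OF assms(1)] L2_controlD(3)[OF assms(2)]
      by (intro integrable_add integrable_on_mult_right) (auto simp: absolutely_integrable_on_def)
    show "(\<lambda>t. (norm (hcoord (a *\<^sub>R v + b *\<^sub>R w) t))\<^sup>2) absolutely_integrable_on {0..1}"
    proof (rule measurable_bounded_by_integrable_imp_absolutely_integrable[OF _ _ i])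
      show "(\<lambda>t. (norm (hcoord (a *\<^sub>R v + b *\<^sub>R w) t))\<^sup>2) \<in> borel_measurable (lebesgue_on {0..1})"
        unfolding hf by (intro borel_measurable_power measurable_compose[OF mm borel_measurable_norm])
      fix t :: real
      let ?x = "norm (a *\<^sub>R hcoord v t)" and ?y = "norm (b *\<^sub>R hcoord w t)"
      have "(norm (hcoord (a *\<^sub>R v + b *\<^sub>R w) t))\<^sup>2 \<le> (?x + ?y)\<^sup>2"
        unfolding h by (intro power_mono norm_triangle_ineq) auto
      also have "\<dots> \<le> 2 * ?x\<^sup>2 + 2 * ?y\<^sup>2" using sum_squares_bound[of ?x ?y] by (simp add: power2_sum)
      finally show "norm ((norm (hcoord (a *\<^sub>R v + b *\<^sub>R w) t))\<^sup>2) \<le> 2 * a\<^sup>2 * (norm (hcoord v t))\<^sup>2 + 2 * b\<^sup>2 * (norm (hcoord w t))\<^sup>2"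
        by (simp add: power_mult_distrib)
    qed simp
  qed
qed

text \<open>
  The horizontal component of the path steered by \<open>v\<close> from the identity.
\<close>

definition htrace :: "(real \<Rightarrow> rvec) \<Rightarrow> real \<Rightarrow> hvec" where "htrace v t = integral {0..t} (hcoord v)"

lemma htrace_props:
  assumes "v \<in> L2_control G0"
  shows "ac (htrace v)" "continuous_on {0..1} (htrace v)" "htrace v 0 = 0"
    "\<And>t. t \<in> {0..1} \<Longrightarrow> norm (htrace v t) \<le> L2_norm G0 v"
    "\<exists>E. negligible E \<and> (\<forall>t\<in>{0..1} - E. (htrace v has_vector_derivative hcoord v t) (at t within {0..1}))"
proof -
  note v = L2_controlD[OF assms]
  show a: "ac (htrace v)" unfolding htrace_def[abs_def] by (rule ac_integral[OF v(2)])
  show "continuous_on {0..1} (htrace v)" by (rule ac_imp_continuous_on[OF a])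
  show "htrace v 0 = 0" by (simp add: htrace_def)
  have i: "hcoord v integrable_on {0..1}" "(\<lambda>t. norm (hcoord v t)) integrable_on {0..1}"
    using v(2) by (auto simp: absolutely_integrable_on_def)
  show "norm (htrace v t) \<le> L2_norm G0 v" if t: "t \<in> {0..1}" for t
  proof -
    have s: "hcoord v integrable_on {0..t}" "(\<lambda>t. norm (hcoord v t)) integrable_on {0..t}"
      using integrable_on_subinterval[OF i(1), of 0 t] integrable_on_subinterval[OF i(2), of 0 t] t by auto
    have "norm (htrace v t) \<le> integral {0..t} (\<lambda>t. norm (hcoord v t))"
      unfolding htrace_def by (rule integral_norm_bound_integral[OF s]) simp
    also have "\<dots> \<le> integral {0..1} (\<lambda>t. norm (hcoord v t))"
      by (rule integral_subset_le[OF _ s(2) i(2)]) (use t in auto)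
    finally show ?thesis using integral_norm_le_L2_norm[OF assms] by simp
  qed
  show "\<exists>E. negligible E \<and> (\<forall>t\<in>{0..1} - E. (htrace v has_vector_derivative hcoord v t) (at t within {0..1}))"
    using AE_deriv_integral[OF i(1)] unfolding htrace_def[abs_def] by (metis (no_types))
qed

lemma steers_G0_iff:
  assumes "u \<in> L2_control G0"
  shows "steers G0 p u \<gamma> \<longleftrightarrow> ac_path G0 \<gamma> \<and> \<gamma> 0 = p \<and> (\<exists>E. negligible E \<and> (\<forall>t\<in>{0..1} - E. steered_at \<gamma> (hcoord u t) t))"
proof (cases "ac_path G0 \<gamma>")
  case True
  have "has_velocity \<gamma> (ldiff G0 (\<gamma> t) (u t)) t \<longleftrightarrow> steered_at \<gamma> (hcoord u t) t" if "t \<in> {0..1}" for t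
    using steered_at_iff[OF True that, of "hcoord u t"] L2_controlD(1)[OF assms that] by simp
  then show ?thesis using True by (auto simp: steers_def AE_unit_interval_iff)
qed (simp add: steers_def)

text \<open>
  The bracket only involves horizontal components, so the control equation is solved by two successive
  integrations.
\<close>

lemma steers_formula:
  assumes u: "u \<in> L2_control G0" and s: "steers G0 (emb p) u \<gamma>" and t: "t \<in> {0..1}"
  shows "\<gamma> t = emb (fst p + htrace u t, snd p + integral {0..t} (\<lambda>t. (1/2) *\<^sub>R br (fst p + htrace u t) (hcoord u t)))"
proof -
  obtain E where g: "ac_path G0 \<gamma>" "\<gamma> 0 = emb p" and E: "negligible E" "\<forall>t\<in>{0..1} - E. steered_at \<gamma> (hcoord u t) t"
    using s unfolding steers_G0_iff[OF u] by blast
  have acg: "ac (\<lambda>t. crd (\<gamma> t))" using g by (simp add: ac_path_G0)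
  have f: "fst (crd (\<gamma> t)) = fst p + htrace u t" if t: "t \<in> {0..1}" for t
  proof -
    have "(hcoord u has_integral (fst (crd (\<gamma> t)) - fst (crd (\<gamma> 0)))) {0..t}"
      by (rule ac_has_integral[OF ac_bounded_linear[OF bounded_linear_fst acg] E(1)])
        (use E(2) t steered_at_fst in auto)
    from integral_unique[OF this] show ?thesis using g(2) by (simp add: htrace_def)
  qed
  have hi: "((\<lambda>t. (1/2) *\<^sub>R br (fst (crd (\<gamma> t))) (hcoord u t)) has_integral (snd (crd (\<gamma> t)) - snd (crd (\<gamma> 0)))) {0..t}"
    by (rule ac_has_integral[OF ac_bounded_linear[OF bounded_linear_snd acg] E(1)])
      (use E(2) t steered_at_snd in auto)
  have "snd (crd (\<gamma> t)) - snd p = integral {0..t} (\<lambda>t. (1/2) *\<^sub>R br (fst (crd (\<gamma> t))) (hcoord u t))"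
    using integral_unique[OF hi] g(2) by simp
  also have "\<dots> = integral {0..t} (\<lambda>t. (1/2) *\<^sub>R br (fst p + htrace u t) (hcoord u t))"
    by (rule integral_cong) (use f t in auto)
  finally have "crd (\<gamma> t) = (fst p + htrace u t, snd p + integral {0..t} (\<lambda>t. (1/2) *\<^sub>R br (fst p + htrace u t) (hcoord u t)))"
    using f[OF t] by (simp add: prod_eq_iff algebra_simps)
  moreover have "\<gamma> t = emb (crd (\<gamma> t))" using g t by (simp add: ac_path_G0 emb_crd)
  ultimately show ?thesis by simp
qed

lemma br_integrable:
  assumes u: "u \<in> L2_control G0" and f: "continuous_on {0..1} f"
  shows "(\<lambda>t. (1/2) *\<^sub>R br (f t) (hcoord u t)) absolutely_integrable_on {0..1}"
  by (intro absolutely_integrable_scaleR_left bilinear_absolutely_integrable[OF bounded_bilinear_br f] L2_controlD(2)[OF u])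

lemma steers_exists:
  assumes u: "u \<in> L2_control G0"
  shows "\<exists>\<gamma>. steers G0 (emb p) u \<gamma>"
proof -
  define g where "g t = (1/2) *\<^sub>R br (fst p + htrace u t) (hcoord u t)" for t
  have g: "g absolutely_integrable_on {0..1}"
    unfolding g_def[abs_def] by (intro br_integrable[OF u] continuous_intros htrace_props(2)[OF u])
  define \<gamma> where "\<gamma> t = emb (fst p + htrace u t, snd p + integral {0..t} g)" for t
  obtain E1 where E1: "negligible E1" "\<forall>t\<in>{0..1} - E1. (htrace u has_vector_derivative hcoord u t) (at t within {0..1})"
    using htrace_props(5)[OF u] by blast
  have "g integrable_on {0..1}" using g by (simp add: absolutely_integrable_on_def)
  then obtain E2 where E2: "negligible E2" "\<And>t. t \<in> {0..1} - E2 \<Longrightarrow> ((\<lambda>t. integral {0..t} g) has_vector_derivative g t) (at t within {0..1})"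
    using AE_deriv_integral by metis
  have "ac_path G0 \<gamma>"
    unfolding ac_path_G0 \<gamma>_def by (auto intro!: ac_Pair ac_add ac_const htrace_props(1)[OF u] ac_integral[OF g])
  moreover have "\<gamma> 0 = emb p" by (simp add: \<gamma>_def htrace_props(3)[OF u])
  moreover have "steered_at \<gamma> (hcoord u t) t" if "t \<in> {0..1} - (E1 \<union> E2)" for t
  proof -
    have a: "((\<lambda>t. fst p + htrace u t) has_vector_derivative hcoord u t) (at t within {0..1})"
      using has_vector_derivative_add[OF has_vector_derivative_const E1(2)[rule_format, of t]] that by simp
    have b: "((\<lambda>t. snd p + integral {0..t} g) has_vector_derivative g t) (at t within {0..1})"
      using has_vector_derivative_add[OF has_vector_derivative_const E2(2)[of t]] that by simp
    show ?thesis
      unfolding steered_at_def \<gamma>_def crd_emb fst_conv g_def[symmetric] by (rule has_vector_derivative_Pair[OF a b])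
  qed
  ultimately have "steers G0 (emb p) u \<gamma>"
    unfolding steers_G0_iff[OF u] using negligible_Un[OF E1(1) E2(1)] by blast
  then show ?thesis by blast
qed

lemma endpoint_G0:
  assumes u: "u \<in> L2_control G0"
  shows "endpoint G0 (emb p) u = emb (fst p + htrace u 1, snd p + integral {0..1} (\<lambda>t. (1/2) *\<^sub>R br (fst p + htrace u t) (hcoord u t)))"
  unfolding endpoint_def
proof (rule the_equality)
  show "\<exists>\<gamma>. steers G0 (emb p) u \<gamma> \<and> \<gamma> 1 = emb (fst p + htrace u 1, snd p + integral {0..1} (\<lambda>t. (1/2) *\<^sub>R br (fst p + htrace u t) (hcoord u t)))"
    using steers_exists[OF u, of p] steers_formula[OF u, of p _ 1] by auto
qed (use steers_formula[OF u, of p _ 1] in auto)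

lemma htrace_comb:
  assumes "v \<in> L2_control G0" "w \<in> L2_control G0" "t \<in> {0..1}"
  shows "htrace (a *\<^sub>R v + b *\<^sub>R w) t = a *\<^sub>R htrace v t + b *\<^sub>R htrace w t"
proof -
  have "hcoord v integrable_on {0..1}" "hcoord w integrable_on {0..1}"
    using L2_controlD(2)[OF assms(1)] L2_controlD(2)[OF assms(2)] by (auto simp: absolutely_integrable_on_def)
  then have i: "hcoord v integrable_on {0..t}" "hcoord w integrable_on {0..t}"
    using assms(3) integrable_on_subinterval[of _ "{0..1}" 0 t] by auto
  have "hcoord (a *\<^sub>R v + b *\<^sub>R w) = (\<lambda>t. a *\<^sub>R hcoord v t + b *\<^sub>R hcoord w t)"
    using L2_control_comb(2)[OF assms(1,2)] by auto
  then show ?thesis unfolding htrace_def using i by (simp add: integral_add integral_cmul integrable_cmul)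
qed

text \<open>
  The differential of the endpoint map at \<open>u\<close> in direction \<open>v\<close>: the part of the explicit endpoint
  formula that is linear in \<open>v\<close>.
\<close>

definition dend :: "hpair \<Rightarrow> (real \<Rightarrow> rvec) \<Rightarrow> (real \<Rightarrow> rvec) \<Rightarrow> hpair"
  where "dend p u v = (htrace v 1, integral {0..1} (\<lambda>t. (1/2) *\<^sub>R br (fst p + htrace u t) (hcoord v t))
     + integral {0..1} (\<lambda>t. (1/2) *\<^sub>R br (htrace v t) (hcoord u t)))"

lemma emb_component_le: "\<bar>emb q i\<bar> \<le> norm q"
proof -
  have "\<bar>emb q i\<bar> \<le> norm (fst (fst q)) \<or> \<bar>emb q i\<bar> \<le> norm (snd (fst q)) \<or> \<bar>emb q i\<bar> \<le> norm (snd q)"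
    by (simp add: emb_def abs_Re_le_cmod abs_Im_le_cmod component_le_norm_cart)
  moreover have "norm (fst (fst q)) \<le> norm (fst q)" "norm (snd (fst q)) \<le> norm (fst q)"
    "norm (fst q) \<le> norm q" "norm (snd q) \<le> norm q"
    using norm_fst_le[of "fst (fst q)" "snd (fst q)"] norm_snd_le[of "snd (fst q)" "fst (fst q)"]
      norm_fst_le[of "fst q" "snd q"] norm_snd_le[of "snd q" "fst q"] by simp_all
  ultimately show ?thesis by linarith
qed

lemma norm_integral_br_le:
  assumes v: "v \<in> L2_control G0" and f: "continuous_on {0..1} f" "\<And>t. t \<in> {0..1} \<Longrightarrow> norm (f t) \<le> M"
  shows "norm (integral {0..1} (\<lambda>t. (1/2) *\<^sub>R br (f t) (hcoord v t))) \<le> 2 * M * L2_norm G0 v"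
proof -
  have M: "M \<ge> 0" using order_trans[OF norm_ge_zero f(2)[of 0]] by simp
  have n: "(\<lambda>t. norm (hcoord v t)) integrable_on {0..1}" using L2_controlD(2)[OF v] by (simp add: absolutely_integrable_on_def)
  have "norm (integral {0..1} (\<lambda>t. (1/2) *\<^sub>R br (f t) (hcoord v t))) \<le> integral {0..1} (\<lambda>t. 2 * M * norm (hcoord v t))"
  proof (rule integral_norm_bound_integral)
    show "(\<lambda>t. (1/2) *\<^sub>R br (f t) (hcoord v t)) integrable_on {0..1}"
      using br_integrable[OF v f(1)] by (simp add: absolutely_integrable_on_def)
    show "(\<lambda>t. 2 * M * norm (hcoord v t)) integrable_on {0..1}" by (intro integrable_on_mult_right n)
    fix t :: real assume t: "t \<in> {0..1}"
    have "norm ((1/2) *\<^sub>R br (f t) (hcoord v t)) \<le> 2 * norm (f t) * norm (hcoord v t)"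
      using norm_br_le[of "f t" "hcoord v t"] by simp
    also have "\<dots> \<le> 2 * M * norm (hcoord v t)" using f(2)[OF t] by (intro mult_right_mono) auto
    finally show "norm ((1/2) *\<^sub>R br (f t) (hcoord v t)) \<le> 2 * M * norm (hcoord v t)" .
  qed
  also have "\<dots> = 2 * M * integral {0..1} (\<lambda>t. norm (hcoord v t))" by simp
  also have "\<dots> \<le> 2 * M * L2_norm G0 v" using integral_norm_le_L2_norm[OF v] M by (intro mult_left_mono) auto
  finally show ?thesis .
qed

lemma dend_linear:
  assumes u: "u \<in> L2_control G0" and v: "v \<in> L2_control G0" and w: "w \<in> L2_control G0"
  shows "dend p u (a *\<^sub>R v + b *\<^sub>R w) = a *\<^sub>R dend p u v + b *\<^sub>R dend p u w"
proof -
  have c: "continuous_on {0..1} (\<lambda>t. fst p + htrace u t)" by (intro continuous_intros htrace_props(2)[OF u])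
  have i: "(\<lambda>t. (1/2) *\<^sub>R br (fst p + htrace u t) (hcoord v t)) integrable_on {0..1}"
    "(\<lambda>t. (1/2) *\<^sub>R br (fst p + htrace u t) (hcoord w t)) integrable_on {0..1}"
    "(\<lambda>t. (1/2) *\<^sub>R br (htrace v t) (hcoord u t)) integrable_on {0..1}"
    "(\<lambda>t. (1/2) *\<^sub>R br (htrace w t) (hcoord u t)) integrable_on {0..1}"
    using br_integrable[OF v c] br_integrable[OF w c] br_integrable[OF u htrace_props(2)[OF v]] br_integrable[OF u htrace_props(2)[OF w]]
    by (simp_all only: absolutely_integrable_on_def)
  have lin: "integral {0..1} (\<lambda>t. a *\<^sub>R f t + b *\<^sub>R g t) = a *\<^sub>R integral {0..1} f + b *\<^sub>R integral {0..1} g"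
    if "f integrable_on {0..1}" "g integrable_on {0..1}" for f g :: "real \<Rightarrow> real^2"
    using that by (simp add: integral_add integral_cmul integrable_cmul)
  have 1: "integral {0..1} (\<lambda>t. (1/2) *\<^sub>R br (fst p + htrace u t) (hcoord (a *\<^sub>R v + b *\<^sub>R w) t))
     = a *\<^sub>R integral {0..1} (\<lambda>t. (1/2) *\<^sub>R br (fst p + htrace u t) (hcoord v t)) + b *\<^sub>R integral {0..1} (\<lambda>t. (1/2) *\<^sub>R br (fst p + htrace u t) (hcoord w t))"
    unfolding lin[OF i(1,2), symmetric]
    by (rule integral_cong) (simp only: L2_control_comb(2)[OF v w] br.add_right br.scaleR_right scaleR_add_right scaleR_left_commute)
  have 2: "integral {0..1} (\<lambda>t. (1/2) *\<^sub>R br (htrace (a *\<^sub>R v + b *\<^sub>R w) t) (hcoord u t))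
     = a *\<^sub>R integral {0..1} (\<lambda>t. (1/2) *\<^sub>R br (htrace v t) (hcoord u t)) + b *\<^sub>R integral {0..1} (\<lambda>t. (1/2) *\<^sub>R br (htrace w t) (hcoord u t))"
    unfolding lin[OF i(3,4), symmetric]
    by (rule integral_cong) (simp only: htrace_comb[OF v w] br.add_left br.scaleR_left scaleR_add_right scaleR_left_commute)
  have "htrace (a *\<^sub>R v + b *\<^sub>R w) 1 = a *\<^sub>R htrace v 1 + b *\<^sub>R htrace w 1" by (rule htrace_comb[OF v w]) simp
  then show ?thesis unfolding dend_def 1 2 by (simp add: scaleR_add_right)
qed

text \<open>
  The endpoint is a quadratic polynomial in the control, so the remainder is exactly the bracket term
  in \<open>v\<close> alone, which the square of the norm of \<open>v\<close> dominates.
\<close>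

lemma has_endpoint_differential_dend:
  assumes u: "u \<in> L2_control G0"
  shows "has_endpoint_differential G0 (emb p) u (\<lambda>v. emb (dend p u v))"
  unfolding has_endpoint_differential_def
proof (intro conjI ballI allI impI)
  fix v w a b assume "v \<in> L2_control G0" "w \<in> L2_control G0"
  then show "emb (dend p u (a *\<^sub>R v + b *\<^sub>R w)) = a *\<^sub>R emb (dend p u v) + b *\<^sub>R emb (dend p u w)"
    by (simp add: dend_linear[OF u] emb_add emb_scaleR)
next
  have c: "continuous_on {0..1} (\<lambda>t. fst p + htrace u t)" by (intro continuous_intros htrace_props(2)[OF u])
  obtain M where M: "\<And>t. t \<in> {0..1} \<Longrightarrow> norm (fst p + htrace u t) \<le> M"
    using ac_bounded[OF ac_add[OF ac_const htrace_props(1)[OF u]]] by metis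
  show "\<exists>B. \<forall>v\<in>L2_control G0. \<forall>i. \<bar>emb (dend p u v) i\<bar> \<le> B * L2_norm G0 v"
  proof (intro exI ballI allI)
    fix v i assume v: "v \<in> L2_control G0"
    have t1: "norm (htrace v 1) \<le> L2_norm G0 v" using htrace_props(4)[OF v, of 1] by simp
    have t2: "norm (integral {0..1} (\<lambda>t. (1/2) *\<^sub>R br (fst p + htrace u t) (hcoord v t))) \<le> 2 * M * L2_norm G0 v"
      by (rule norm_integral_br_le[OF v c M])
    have t3: "norm (integral {0..1} (\<lambda>t. (1/2) *\<^sub>R br (htrace v t) (hcoord u t))) \<le> 2 * L2_norm G0 v * L2_norm G0 u"
      by (rule norm_integral_br_le[OF u htrace_props(2,4)[OF v]])
    have "\<bar>emb (dend p u v) i\<bar> \<le> norm (dend p u v)" by (rule emb_component_le)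
    also have "\<dots> \<le> L2_norm G0 v + (2 * M * L2_norm G0 v + 2 * L2_norm G0 v * L2_norm G0 u)"
      unfolding dend_def by (intro order_trans[OF norm_Pair_le] add_mono t1 order_trans[OF norm_triangle_ineq] t2 t3)
    also have "\<dots> = (1 + 2 * M + 2 * L2_norm G0 u) * L2_norm G0 v" by (simp add: algebra_simps)
    finally show "\<bar>emb (dend p u v) i\<bar> \<le> (1 + 2 * M + 2 * L2_norm G0 u) * L2_norm G0 v" .
  qed
  fix \<epsilon> :: real assume \<epsilon>: "\<epsilon> > 0"
  show "\<exists>\<delta>>0. \<forall>v\<in>L2_control G0. L2_norm G0 v < \<delta> \<longrightarrow>
       (\<forall>i. \<bar>endpoint G0 (emb p) (u + v) i - endpoint G0 (emb p) u i - emb (dend p u v) i\<bar> \<le> \<epsilon> * L2_norm G0 v)"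
  proof (intro exI[of _ "\<epsilon> / 2"] conjI ballI allI impI)
    fix v i assume v: "v \<in> L2_control G0" and small: "L2_norm G0 v < \<epsilon> / 2"
    have uv: "u + v \<in> L2_control G0" and hc: "hcoord (u + v) t = hcoord u t + hcoord v t" for t
      using L2_control_comb[OF u v, of 1 1] by simp_all
    have tr: "htrace (u + v) t = htrace u t + htrace v t" if "t \<in> {0..1}" for t
      using htrace_comb[OF u v that, of 1 1] by simp
    have i1: "(\<lambda>t. (1/2) *\<^sub>R br (fst p + htrace u t) (hcoord u t)) integrable_on {0..1}"
     and i2: "(\<lambda>t. (1/2) *\<^sub>R br (fst p + htrace u t) (hcoord v t)) integrable_on {0..1}"
     and i3: "(\<lambda>t. (1/2) *\<^sub>R br (htrace v t) (hcoord u t)) integrable_on {0..1}"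
     and i4: "(\<lambda>t. (1/2) *\<^sub>R br (htrace v t) (hcoord v t)) integrable_on {0..1}"
      using br_integrable[OF u c] br_integrable[OF v c] br_integrable[OF u htrace_props(2)[OF v]] br_integrable[OF v htrace_props(2)[OF v]]
      by (simp_all only: absolutely_integrable_on_def)
    have "integral {0..1} (\<lambda>t. (1/2) *\<^sub>R br (fst p + htrace (u + v) t) (hcoord (u + v) t))
      = integral {0..1} (\<lambda>t. ((1/2) *\<^sub>R br (fst p + htrace u t) (hcoord u t) + (1/2) *\<^sub>R br (fst p + htrace u t) (hcoord v t))
         + ((1/2) *\<^sub>R br (htrace v t) (hcoord u t) + (1/2) *\<^sub>R br (htrace v t) (hcoord v t)))"
      by (rule integral_cong) (simp add: tr hc br.add_left br.add_right scaleR_add_right)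
    also have "\<dots> = (integral {0..1} (\<lambda>t. (1/2) *\<^sub>R br (fst p + htrace u t) (hcoord u t)) + integral {0..1} (\<lambda>t. (1/2) *\<^sub>R br (fst p + htrace u t) (hcoord v t)))
       + (integral {0..1} (\<lambda>t. (1/2) *\<^sub>R br (htrace v t) (hcoord u t)) + integral {0..1} (\<lambda>t. (1/2) *\<^sub>R br (htrace v t) (hcoord v t)))"
      by (simp only: integral_add i1 i2 i3 i4 integrable_add)
    finally have split: "integral {0..1} (\<lambda>t. (1/2) *\<^sub>R br (fst p + htrace (u + v) t) (hcoord (u + v) t)) = \<dots>" .
    let ?r = "integral {0..1} (\<lambda>t. (1/2) *\<^sub>R br (htrace v t) (hcoord v t))"
    have "endpoint G0 (emb p) (u + v) = endpoint G0 (emb p) u + emb (dend p u v) + emb (0, ?r)"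
      unfolding endpoint_G0[OF u] endpoint_G0[OF uv] split tr[of 1, simplified] emb_add[symmetric] emb_eq_iff dend_def
      by (simp add: algebra_simps)
    then have "endpoint G0 (emb p) (u + v) i - endpoint G0 (emb p) u i - emb (dend p u v) i = emb (0, ?r) i" by simp
    also have "\<bar>\<dots>\<bar> \<le> norm (0::hvec, ?r)" by (rule emb_component_le)
    also have "\<dots> = norm ?r" by (simp add: norm_prod_def)
    also have "\<dots> \<le> 2 * L2_norm G0 v * L2_norm G0 v" by (rule norm_integral_br_le[OF v htrace_props(2,4)[OF v]])
    also have "\<dots> \<le> \<epsilon> * L2_norm G0 v"
      using small htrace_props(4)[OF v, of 0] order_trans[OF norm_ge_zero htrace_props(4)[OF v, of 0]] by (intro mult_right_mono) auto
    finally show "\<bar>endpoint G0 (emb p) (u + v) i - endpoint G0 (emb p) u i - emb (dend p u v) i\<bar> \<le> \<epsilon> * L2_norm G0 v" .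
  qed (use \<epsilon> in simp)
qed simp

text \<open>
  Integration by parts moves the derivative from \<open>htrace u\<close> to \<open>htrace v\<close>; this exhibits the composition
  of a linear functional \<open>(\<xi>, l)\<close> with the differential as the inner product with a continuous control.
\<close>

lemma dend_representer:
  assumes u: "u \<in> L2_control G0" and v: "v \<in> L2_control G0"
  shows "integral {0..1} (\<lambda>t. (\<xi> + (1/2) *\<^sub>R J l (fst p) + J l (htrace u t) - (1/2) *\<^sub>R J l (htrace u 1)) \<bullet> hcoord v t)
    = (\<xi>, l) \<bullet> dend p u v"
proof -
  let ?X = "htrace u" and ?Y = "htrace v" and ?I = "integral {0..1}"
  note Xp = htrace_props[OF u] and Yp = htrace_props[OF v]
  have hv: "hcoord v absolutely_integrable_on {0..1}" and hu: "hcoord u absolutely_integrable_on {0..1}"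
    using L2_controlD(2) u v by auto
  have ii: "(\<lambda>t. f t \<bullet> hcoord w t) integrable_on {0..1}" if "continuous_on {0..1} f" "w \<in> L2_control G0" for f w
    using bilinear_absolutely_integrable[OF bounded_bilinear_inner that(1) L2_controlD(2)[OF that(2)]] by (simp add: absolutely_integrable_on_def)
  have cJ: "continuous_on {0..1} (\<lambda>t. J l (f t))" if "continuous_on {0..1} f" for f
    by (rule bounded_linear.continuous_on[OF J.bounded_linear_right that])
  have lI: "l \<bullet> ?I f = ?I (\<lambda>t. l \<bullet> f t)" if "f integrable_on {0..1}" for f :: "real \<Rightarrow> real^2"
    using integral_linear[OF that bounded_linear_inner_right[of l]] by (simp add: o_def)
  have xI: "x \<bullet> ?Y 1 = ?I (\<lambda>t. x \<bullet> hcoord v t)" for x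
    using integral_linear[of "hcoord v" "{0..1}", OF _ bounded_linear_inner_right[of x]] hv
    by (simp add: o_def htrace_def absolutely_integrable_on_def)
  obtain E1 where E1: "negligible E1" "\<forall>t\<in>{0..1} - E1. (?X has_vector_derivative hcoord u t) (at t within {0..1})" using Xp(5) by blast
  obtain E2 where E2: "negligible E2" "\<forall>t\<in>{0..1} - E2. (?Y has_vector_derivative hcoord v t) (at t within {0..1})" using Yp(5) by blast
  have parts: "((\<lambda>t. J l (?Y t) \<bullet> hcoord u t + J l (hcoord v t) \<bullet> ?X t) has_integral (J l (?Y 1) \<bullet> ?X 1 - J l (?Y 0) \<bullet> ?X 0)) {0..1}"
  proof (rule ac_has_integral[OF _ negligible_Un[OF E1(1) E2(1)]])
    show "ac (\<lambda>t. J l (?Y t) \<bullet> ?X t)"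
      by (intro ac_bilinear[OF bounded_bilinear_inner] ac_bounded_linear[OF J.bounded_linear_right] Xp(1) Yp(1))
    fix t assume t: "t \<in> {0..1} - (E1 \<union> E2)"
    show "((\<lambda>t. J l (?Y t) \<bullet> ?X t) has_vector_derivative J l (?Y t) \<bullet> hcoord u t + J l (hcoord v t) \<bullet> ?X t) (at t within {0..1})"
      by (intro bounded_bilinear.has_vector_derivative[OF bounded_bilinear_inner] bounded_linear.has_vector_derivative[OF J.bounded_linear_right])
        (use t E1(2) E2(2) in auto)
  qed auto
  have sk: "J l (hcoord v t) \<bullet> ?X t = - (J l (?X t) \<bullet> hcoord v t)" for t by (metis J_skew inner_commute)
  have e1: "?I (\<lambda>t. J l (?Y t) \<bullet> hcoord u t) = J l (?Y 1) \<bullet> ?X 1 + ?I (\<lambda>t. J l (?X t) \<bullet> hcoord v t)"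
  proof -
    have "?I (\<lambda>t. J l (?Y t) \<bullet> hcoord u t - J l (?X t) \<bullet> hcoord v t) = J l (?Y 1) \<bullet> ?X 1"
      using integral_unique[OF parts] by (simp add: sk Xp(3))
    moreover have "?I (\<lambda>t. J l (?Y t) \<bullet> hcoord u t - J l (?X t) \<bullet> hcoord v t) = ?I (\<lambda>t. J l (?Y t) \<bullet> hcoord u t) - ?I (\<lambda>t. J l (?X t) \<bullet> hcoord v t)"
      by (intro integral_diff ii cJ Xp(2) Yp(2) u v)
    ultimately show ?thesis by simp
  qed
  have e2: "J l (?Y 1) \<bullet> ?X 1 = - ?I (\<lambda>t. J l (?X 1) \<bullet> hcoord v t)"
    using J_skew[of l "?Y 1" "?X 1"] xI[of "J l (?X 1)"] by (simp add: inner_commute)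
  have e3: "l \<bullet> ?I (\<lambda>t. (1/2) *\<^sub>R br (fst p + ?X t) (hcoord v t))
     = (1/2) * ?I (\<lambda>t. J l (fst p) \<bullet> hcoord v t) + (1/2) * ?I (\<lambda>t. J l (?X t) \<bullet> hcoord v t)"
  proof -
    have "l \<bullet> ?I (\<lambda>t. (1/2) *\<^sub>R br (fst p + ?X t) (hcoord v t)) = ?I (\<lambda>t. l \<bullet> ((1/2) *\<^sub>R br (fst p + ?X t) (hcoord v t)))"
      by (rule lI, rule absolutely_integrable_on_def[THEN iffD1, THEN conjunct1], rule br_integrable[OF v]) (intro continuous_intros Xp(2))
    also have "\<dots> = ?I (\<lambda>t. (1/2) * (J l (fst p) \<bullet> hcoord v t) + (1/2) * (J l (?X t) \<bullet> hcoord v t))"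
      by (rule integral_cong) (simp add: inner_br J.add_right inner_add_left)
    also have "\<dots> = ?I (\<lambda>t. (1/2) * (J l (fst p) \<bullet> hcoord v t)) + ?I (\<lambda>t. (1/2) * (J l (?X t) \<bullet> hcoord v t))"
      by (intro integral_add integrable_on_mult_right ii cJ Xp(2) v continuous_on_const)
    finally show ?thesis by (simp only: integral_mult_right)
  qed
  have e4: "l \<bullet> ?I (\<lambda>t. (1/2) *\<^sub>R br (?Y t) (hcoord u t)) = (1/2) * ?I (\<lambda>t. J l (?Y t) \<bullet> hcoord u t)"
  proof -
    have "l \<bullet> ?I (\<lambda>t. (1/2) *\<^sub>R br (?Y t) (hcoord u t)) = ?I (\<lambda>t. l \<bullet> ((1/2) *\<^sub>R br (?Y t) (hcoord u t)))"
      by (rule lI, rule absolutely_integrable_on_def[THEN iffD1, THEN conjunct1], rule br_integrable[OF u Yp(2)])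
    also have "\<dots> = ?I (\<lambda>t. (1/2) * (J l (?Y t) \<bullet> hcoord u t))"
      by (rule integral_cong) (simp add: inner_br)
    finally show ?thesis by (simp only: integral_mult_right)
  qed
  have "(\<xi>, l) \<bullet> dend p u v = ?I (\<lambda>t. \<xi> \<bullet> hcoord v t) + (1/2) * ?I (\<lambda>t. J l (fst p) \<bullet> hcoord v t)
      + ?I (\<lambda>t. J l (?X t) \<bullet> hcoord v t) - (1/2) * ?I (\<lambda>t. J l (?X 1) \<bullet> hcoord v t)"
    unfolding dend_def inner_Pair inner_add_right xI e3 e4 e1 e2 by (simp add: field_simps)
  also have "\<dots> = ?I (\<lambda>t. \<xi> \<bullet> hcoord v t + (1/2) * (J l (fst p) \<bullet> hcoord v t) + J l (?X t) \<bullet> hcoord v t - (1/2) * (J l (?X 1) \<bullet> hcoord v t))"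
  proof -
    note k = ii[OF continuous_on_const v] ii[OF cJ[OF Xp(2)] v]
    show ?thesis
      by (simp only: integral_diff integral_add integral_mult_right integrable_add integrable_on_mult_right k)
  qed
  also have "\<dots> = ?I (\<lambda>t. (\<xi> + (1/2) *\<^sub>R J l (fst p) + J l (?X t) - (1/2) *\<^sub>R J l (?X 1)) \<bullet> hcoord v t)"
    by (rule integral_cong) (simp add: inner_add_left inner_diff_left)
  finally show ?thesis ..
qed

text \<open>
  A covector \<open>(\<xi>, l)\<close> orthogonal to the image annihilates in particular its own representing control,
  which is therefore identically zero.  Then \<open>J l (htrace u t)\<close> does not depend on \<open>t\<close>, hence is 0, and
  invertibility of the pencil gives \<open>l = 0\<close> and \<open>\<xi> = 0\<close>.
\<close>

lemma dend_surjective: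
  assumes u: "u \<in> L2_control G0" and ne: "t0 \<in> {0..1}" "htrace u t0 \<noteq> 0"
  shows "dend p u ` L2_control G0 = UNIV"
proof (rule ccontr)
  assume not: "dend p u ` L2_control G0 \<noteq> UNIV"
  let ?R = "dend p u ` L2_control G0"
  have "subspace ?R"
    unfolding subspace_def
  proof (intro conjI ballI allI)
    have z: "0 *\<^sub>R u + 0 *\<^sub>R u \<in> L2_control G0" by (rule L2_control_comb(1)[OF u u])
    have "dend p u (0 *\<^sub>R u + 0 *\<^sub>R u) = 0" using dend_linear[OF u u u, of p 0 0] by simp
    then show "0 \<in> ?R" using z by (metis image_eqI)
  next
    fix x y assume "x \<in> ?R" "y \<in> ?R"
    then obtain v w where v: "v \<in> L2_control G0" "x = dend p u v" and w: "w \<in> L2_control G0" "y = dend p u w" by blast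
    have "x + y = dend p u (1 *\<^sub>R v + 1 *\<^sub>R w)" using dend_linear[OF u v(1) w(1), of p 1 1] v w by simp
    then show "x + y \<in> ?R" using L2_control_comb(1)[OF v(1) w(1)] by blast
  next
    fix c x assume "x \<in> ?R"
    then obtain v where v: "v \<in> L2_control G0" "x = dend p u v" by blast
    have "c *\<^sub>R x = dend p u (c *\<^sub>R v + 0 *\<^sub>R v)" using dend_linear[OF u v(1) v(1), of p c 0] v by simp
    then show "c *\<^sub>R x \<in> ?R" using L2_control_comb(1)[OF v(1) v(1)] by blast
  qed
  then have "span ?R \<noteq> UNIV" using not by (simp add: span_eq_iff[THEN iffD2])
  then obtain q where q: "q \<noteq> 0" "\<forall>x\<in>span ?R. q \<bullet> x = 0" using span_not_UNIV_orthogonal by blast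
  obtain \<xi> l where ql: "q = (\<xi>, l)" by (cases q)
  define W where "W t = \<xi> + (1/2) *\<^sub>R J l (fst p) + J l (htrace u t) - (1/2) *\<^sub>R J l (htrace u 1)" for t
  have cW: "continuous_on {0..1} W"
    unfolding W_def[abs_def] by (intro continuous_intros bounded_linear.continuous_on[OF J.bounded_linear_right] htrace_props(2)[OF u])
  define v where "v t = emb (W t, 0)" for t
  have hv: "hcoord v = W" by (simp add: hcoord_def v_def fun_eq_iff)
  have "v \<in> L2_control G0"
    unfolding L2_control_iff hv
  proof (intro conjI ballI)
    show "W \<in> borel_measurable (lebesgue_on {0..1})"
      by (rule continuous_imp_measurable_on_sets_lebesgue[OF cW]) simp
    show "(\<lambda>t. (norm (W t))\<^sup>2) absolutely_integrable_on {0..1}"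
      by (intro continuous_absolutely_integrable_unit continuous_intros cW)
  qed (simp add: v_def)
  then have "q \<bullet> dend p u v = 0" using q(2) span_base by blast
  then have "integral {0..1} (\<lambda>t. W t \<bullet> W t) = 0"
    using dend_representer[OF u \<open>v \<in> L2_control G0\<close>, of \<xi> l p] by (simp add: ql hv W_def)
  moreover have cWW: "continuous_on {0..1} (\<lambda>t. W t \<bullet> W t)" by (intro continuous_intros cW)
  ultimately have "W t \<bullet> W t = 0" if "t \<in> {0..1}" for t
    using integral_eq_0_iff[OF cWW] that by simp
  then have W0: "W t = 0" if "t \<in> {0..1}" for t using that by simp
  have "J l (htrace u t0) = W t0 - W 0" by (simp add: W_def htrace_props(3)[OF u] J.zero_right)
  then have "J l (htrace u t0) = 0" using W0[OF ne(1)] W0[of 0] by simp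
  then have "l = 0" using ne(2) by (simp add: J_eq_0_iff)
  then have "\<xi> = 0" using W0[of 0] by (simp add: W_def J.zero_left)
  then show False using q(1) ql \<open>l = 0\<close> by (simp add: zero_prod_def)
qed

text \<open>
  A path with vanishing horizontal component of the displacement is constant, so every nonconstant path
  is regular, minimising or not.
\<close>

lemma ideal_group_G0: "ideal_group G0"
  unfolding ideal_group_def
proof (intro notI, elim exE conjE)
  fix \<gamma> assume ab: "abnormal G0 \<gamma>" and nc: "\<not> (\<forall>t\<in>{0..1}. \<gamma> t = \<gamma> 0)"
  from ab obtain u where u: "u \<in> L2_control G0" and s: "steers G0 (\<gamma> 0) u \<gamma>" and cr: "critical_control G0 (\<gamma> 0) u"
    unfolding abnormal_def by blast
  have "\<gamma> 0 \<in> alg G0" using s by (auto simp: steers_def ac_path_G0)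
  then obtain p where p: "\<gamma> 0 = emb p" by (auto simp: alg_G0)
  have "\<exists>t0\<in>{0..1}. htrace u t0 \<noteq> 0"
  proof (rule ccontr)
    assume "\<not> (\<exists>t0\<in>{0..1}. htrace u t0 \<noteq> 0)"
    then have z: "htrace u t = 0" if "t \<in> {0..1}" for t using that by blast
    have "\<gamma> t = \<gamma> 0" if t: "t \<in> {0..1}" for t
    proof -
      have hi: "hcoord u integrable_on {0..t}"
        using L2_controlD(2)[OF u] integrable_on_subinterval[of "hcoord u" "{0..1}" 0 t] t by (auto simp: absolutely_integrable_on_def)
      have "integral {0..t} (\<lambda>t. (1/2) *\<^sub>R br (fst p + htrace u t) (hcoord u t)) = integral {0..t} (\<lambda>t. (1/2) *\<^sub>R br (fst p) (hcoord u t))"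
        by (rule integral_cong) (use t in \<open>simp add: z\<close>)
      also have "\<dots> = (1/2) *\<^sub>R br (fst p) (htrace u t)"
        using integral_linear[OF hi br.bounded_linear_right[of "fst p"]] by (simp add: o_def htrace_def)
      also have "\<dots> = 0" by (simp add: z[OF t] br.zero_right)
      finally show ?thesis using steers_formula[OF u s[unfolded p] t] p by (simp add: z[OF t])
    qed
    then show False using nc by blast
  qed
  then have "dend p u ` L2_control G0 = UNIV" using dend_surjective[OF u] by blast
  then have "(\<lambda>v. emb (dend p u v)) ` L2_control G0 = alg G0"
    unfolding alg_G0 by (metis image_image)
  then show False using cr has_endpoint_differential_dend[OF u, of p] unfolding critical_control_def p by blast
qed

section \<open>Minimality of the geodesics\<close>

lemma path_len_G0:
  assumes g: "ac_path G0 \<gamma>" and E: "negligible E" "\<And>t. t \<in> {0..1} - E \<Longrightarrow> steered_at \<gamma> (u t) t"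
  shows "path_len G0 \<gamma> = integral {0..1} (\<lambda>t. norm (u t))"
proof -
  have "u absolutely_integrable_on {0..1}"
    by (rule ac_absolutely_integrable[OF ac_bounded_linear[OF bounded_linear_fst] E(1), of "\<lambda>t. crd (\<gamma> t)"])
      (use g steered_at_fst[OF E(2)] in \<open>auto simp: ac_path_G0\<close>)
  then have n: "(\<lambda>t. norm (u t)) absolutely_integrable_on {0..1}"
    using absolutely_integrable_norm by (auto simp: o_def)
  have eq: "speed G0 \<gamma> t = norm (u t)" if "t \<in> {0..1} - E" for t
    using speed_G0[OF g _ E(2)[OF that]] that by simp
  then have "speed G0 \<gamma> absolutely_integrable_on {0..1}"
    by (intro absolutely_integrable_spike[OF n E(1)])
  then have "path_len G0 \<gamma> = integral {0..1} (speed G0 \<gamma>)"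
    unfolding path_len_def by (rule integral_unit_eq)
  also have "\<dots> = integral {0..1} (\<lambda>t. norm (u t))"
    by (rule integral_spike[OF E(1)]) (use eq in auto)
  finally show ?thesis .
qed

text \<open>
  The displacement from \<open>-\<theta>\<close>, reparametrised to the unit interval; this extremal starts at the identity.
\<close>

definition geo :: "real \<Rightarrow> hpair \<Rightarrow> real \<Rightarrow> rvec"
  where "geo \<theta> p t = emb (disp p (- \<theta>) (2 * \<theta> * t - \<theta>))"

lemma geo_ends: "geo \<theta> p 0 = 0" "geo \<theta> p (1/2) = emb (disp p (- \<theta>) 0)" "geo \<theta> p 1 = emb (disp p (- \<theta>) \<theta>)"
  by (simp_all add: geo_def)

lemma affine_deriv:
  assumes "\<And>s. (f has_vector_derivative f' s) (at s)"
  shows "((\<lambda>t. f (c * t - d)) has_vector_derivative c *\<^sub>R f' (c * t - d)) (at t within S)"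
proof -
  have "((\<lambda>t. c * t - d) has_vector_derivative c) (at t)"
    unfolding has_real_derivative_iff_has_vector_derivative[symmetric] by (auto intro!: derivative_eq_intros)
  from has_vector_derivative_at_within[OF vector_diff_chain_at[OF this assms]] show ?thesis by (simp add: o_def)
qed

lemma geo_coord_deriv:
  "((\<lambda>t. fst (disp p (- \<theta>) (2 * \<theta> * t - \<theta>))) has_vector_derivative (2 * \<theta>) *\<^sub>R vel p (2 * \<theta> * t - \<theta>)) (at t within S)"
  "((\<lambda>t. snd (disp p (- \<theta>) (2 * \<theta> * t - \<theta>))) has_vector_derivative
     (1/2) *\<^sub>R br (fst (disp p (- \<theta>) (2 * \<theta> * t - \<theta>))) ((2 * \<theta>) *\<^sub>R vel p (2 * \<theta> * t - \<theta>))) (at t within S)"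
  using affine_deriv[OF disp_fst_deriv, where c="2 * \<theta>" and d=\<theta>] 
    affine_deriv[OF disp_snd_deriv, where c="2 * \<theta>" and d=\<theta>]
  by (simp_all add: br.scaleR_right mult.commute)

lemma geo_steered_at: "steered_at (geo \<theta> p) ((2 * \<theta>) *\<^sub>R vel p (2 * \<theta> * t - \<theta>)) t"
  unfolding steered_at_def geo_def crd_emb
  using has_vector_derivative_Pair[OF geo_coord_deriv(1)[of p \<theta> t "{0..1}"] geo_coord_deriv(2)[of p \<theta> t "{0..1}"]]
  by (simp only: prod.collapse)

lemma isCont_affine_vel: "isCont (\<lambda>t. vel p (2 * \<theta> * t - \<theta>)) t"
  by (intro isCont_o2[OF _ isCont_vel] continuous_intros)

lemma ac_path_geo: "ac_path G0 (geo \<theta> p)"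
proof -
  have 1: "ac (\<lambda>t. fst (disp p (- \<theta>) (2 * \<theta> * t - \<theta>)))"
    by (rule ac_C1[OF geo_coord_deriv(1)]) (intro continuous_intros continuous_at_imp_continuous_on ballI isCont_affine_vel)
  have 2: "ac (\<lambda>t. snd (disp p (- \<theta>) (2 * \<theta> * t - \<theta>)))"
    by (rule ac_C1[OF geo_coord_deriv(2)])
      (intro continuous_intros br.continuous_on continuous_at_imp_continuous_on ballI isCont_affine_vel ac_imp_continuous_on[OF 1])
  show ?thesis unfolding ac_path_G0 geo_def using ac_Pair[OF 1 2] by simp
qed

text \<open>
  On the unit interval the covector of the extremal is \<open>2 \<theta> \<tau>\<close>, and shortness says that \<open>J (2 \<theta> \<tau>)\<close>
  has norm at most 1, as the calibration requires.
\<close>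

lemma min_geodesic_geo:
  assumes \<theta>: "\<theta> > 0" and short: "8 * \<theta> * norm (snd p) \<le> 1"
  shows "min_geodesic G0 (geo \<theta> p)"
proof -
  let ?u = "\<lambda>t. (2 * \<theta>) *\<^sub>R vel p (2 * \<theta> * t - \<theta>)"
  let ?w = "(2 * \<theta>) *\<^sub>R snd p"
  let ?xr = "\<lambda>t. fst (disp p (- \<theta>) (2 * \<theta> * t - \<theta>))"
  let ?zr = "\<lambda>t. ?w \<bullet> snd (disp p (- \<theta>) (2 * \<theta> * t - \<theta>))"
  have nu: "norm (?u t) = 2 * \<theta> * norm (fst p)" for t using \<theta> by simp
  have len: "path_len G0 (geo \<theta> p) = 2 * \<theta> * norm (fst p)"
    using path_len_G0[OF ac_path_geo negligible_empty geo_steered_at] \<theta> by simp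
  have hor: "horizontal G0 (geo \<theta> p)"
    unfolding horizontal_G0
    by (intro conjI ac_path_geo exI[of _ "{}"] exI[of _ ?u] negligible_empty ballI geo_steered_at)
  have lower: "2 * \<theta> * norm (fst p) \<le> path_len G0 \<gamma>"
    if g: "horizontal G0 \<gamma>" "\<gamma> 0 = geo \<theta> p 0" "\<gamma> 1 = geo \<theta> p 1" for \<gamma>
  proof -
    obtain E u where ac\<gamma>: "ac_path G0 \<gamma>" and E: "negligible E" "\<forall>t\<in>{0..1} - E. steered_at \<gamma> (u t) t"
      using g(1) unfolding horizontal_G0 by blast
    have acc: "ac (\<lambda>t. crd (\<gamma> t))" using ac\<gamma> by (simp add: ac_path_G0)
    have "norm (?u 0) \<le> integral {0..1} (\<lambda>t. norm (u t))"
    proof (rule normal_extremal_length_le[where A="J ?w" and xr="?xr" and ur="?u" and zr="?zr"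
          and x="\<lambda>t. fst (crd (\<gamma> t))" and s="\<lambda>t. ?w \<bullet> snd (crd (\<gamma> t))" and E=E])
      show "bounded_linear (J ?w)" by (rule J.bounded_linear_right)
      show "J ?w a \<bullet> b = - (a \<bullet> J ?w b)" for a b by (rule J_skew)
      show "norm (J ?w a) \<le> norm a" for a
      proof -
        have "norm (J ?w a) \<le> (8 * \<theta> * norm (snd p)) * norm a" using norm_J_le[of ?w a] \<theta> by simp
        also have "\<dots> \<le> 1 * norm a" by (intro mult_right_mono short) auto
        finally show ?thesis by simp
      qed
      show "(?xr has_vector_derivative ?u t) (at t within {0..1})" for t by (rule geo_coord_deriv)
      show "(?u has_vector_derivative J ?w (?u t)) (at t within {0..1})" for t
        using bounded_linear.has_vector_derivative[OF bounded_linear_scaleR_right affine_deriv[OF vel_deriv, where c="2 * \<theta>" and d=\<theta>], of "2 * \<theta>" p t]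
        by (simp add: J.scaleR_left J.scaleR_right)
      show "(?zr has_vector_derivative 1/2 * (J ?w (?xr t) \<bullet> ?u t)) (at t within {0..1})" for t
        using bounded_linear.has_vector_derivative[OF bounded_linear_inner_right geo_coord_deriv(2), of ?w p \<theta> t]
        unfolding inner_scaleR_right inner_br by simp
      show "ac (\<lambda>t. fst (crd (\<gamma> t)))" by (rule ac_bounded_linear[OF bounded_linear_fst acc])
      show "ac (\<lambda>t. ?w \<bullet> snd (crd (\<gamma> t)))" by (rule ac_bounded_linear[OF bounded_linear_inner_right ac_bounded_linear[OF bounded_linear_snd acc]])
      show "negligible E" by (rule E)
      fix t assume t: "t \<in> {0..1} - E"
      then have s: "steered_at \<gamma> (u t) t" using E(2) by blast
      show "((\<lambda>t. fst (crd (\<gamma> t))) has_vector_derivative u t) (at t within {0..1})" by (rule steered_at_fst[OF s])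
      show "((\<lambda>t. ?w \<bullet> snd (crd (\<gamma> t))) has_vector_derivative 1/2 * (J ?w (fst (crd (\<gamma> t))) \<bullet> u t)) (at t within {0..1})"
        using bounded_linear.has_vector_derivative[OF bounded_linear_inner_right steered_at_snd[OF s], of ?w]
        unfolding inner_scaleR_right inner_br by simp
    qed (use g(2,3) in \<open>simp_all add: geo_ends\<close>)
    then show ?thesis
      using path_len_G0[OF ac\<gamma> E(1), of u] E(2) \<theta> by simp
  qed
  have "cc_dist G0 (geo \<theta> p 0) (geo \<theta> p 1) = 2 * \<theta> * norm (fst p)"
    unfolding cc_dist_def
  proof (rule cInf_eq_minimum)
    show "2 * \<theta> * norm (fst p) \<in> {path_len G0 \<gamma> |\<gamma>. horizontal G0 \<gamma> \<and> \<gamma> 0 = geo \<theta> p 0 \<and> \<gamma> 1 = geo \<theta> p 1}"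
      using len hor by force
  qed (use lower in auto)
  moreover have "speed G0 (geo \<theta> p) t = 2 * \<theta> * norm (fst p)" if "t \<in> {0..1}" for t
    using speed_G0[OF ac_path_geo that geo_steered_at] nu by simp
  then have "AE t in lebesgue_on {0..1}. speed G0 (geo \<theta> p) t = 2 * \<theta> * norm (fst p)"
    by (intro AE_I2) simp
  ultimately show ?thesis unfolding min_geodesic_def using hor len by auto
qed

section \<open>Haar measure in coordinates\<close>

lemma emb_component: "i < 6 \<Longrightarrow> emb p i = p \<bullet> crd (unit_vec i)"
proof -
  assume "i < 6"
  then consider "i = 0" | "i = 1" | "i = 2" | "i = 3" | "i = 4" | "i = 5" by linarith
  then show ?thesis
    by cases (simp_all add: emb_def crd_def unit_vec_def inner_prod_def inner_complex_def inner_vec_def sum_2)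
qed

lemma Basis_coords: "bij_betw (\<lambda>i. crd (unit_vec i)) {..<6} (Basis :: (hpair) set)"
proof -
  have inj: "inj_on (\<lambda>i. crd (unit_vec i)) {..<6::nat}"
  proof (rule inj_onI)
    fix i j :: nat assume ij: "i \<in> {..<6}" "j \<in> {..<6}" "crd (unit_vec i) = crd (unit_vec j)"
    have u: "emb (crd (unit_vec k)) = unit_vec k" if "k < 6" for k
      using that by (intro emb_crd) (auto simp: alg_def topspace_Euclidean_space unit_vec_def)
    have "unit_vec i = emb (crd (unit_vec i))" using ij(1) by (intro u[symmetric]) simp
    also have "\<dots> = emb (crd (unit_vec j))" by (simp only: ij(3))
    also have "\<dots> = unit_vec j" using ij(2) by (intro u) simp
    finally have "unit_vec i i = unit_vec j i" by simp
    then show "i = j" by (simp add: unit_vec_def split: if_splits)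
  qed
  have sub: "(\<lambda>i. crd (unit_vec i)) ` {..<6} \<subseteq> (Basis :: (hpair) set)"
  proof (rule image_subsetI)
    fix i :: nat assume "i \<in> {..<6}"
    then have "i < 6" by simp
    have c: "Complex 1 0 = 1" "Complex 0 1 = \<i>" "Complex 0 0 = 0" by (simp_all add: complex_eq_iff)
    have v: "vector [1, 0] = (axis 1 1 :: real^2)" "vector [0, 1] = (axis 2 1 :: real^2)" "vector [0, 0] = (0 :: real^2)"
      by (simp_all add: vec_eq_iff forall_2 axis_def)
    have a: "axis 1 1 \<in> (Basis :: (real^2) set)" "axis 2 1 \<in> (Basis :: (real^2) set)" by (simp_all add: axis_in_Basis_iff)
    from \<open>i < 6\<close> consider "i = 0" | "i = 1" | "i = 2" | "i = 3" | "i = 4" | "i = 5" by linarith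
    then show "crd (unit_vec i) \<in> Basis"
      by cases (simp_all add: crd_def unit_vec_def Basis_prod_def Basis_complex_def c v a image_iff zero_prod_def)
  qed
  have "card ((\<lambda>i. crd (unit_vec i)) ` {..<6::nat}) = DIM(hpair)"
    using card_image[OF inj] by simp
  then have "(\<lambda>i. crd (unit_vec i)) ` {..<6} = (Basis :: (hpair) set)"
    by (intro card_subset_eq sub) simp_all
  with inj show ?thesis by (simp add: bij_betw_def)
qed

lemma crd_measurable: "crd \<in> (\<Pi>\<^sub>M i\<in>{..<6}. lborel) \<rightarrow>\<^sub>M borel"
proof -
  have "(\<lambda>x. \<Sum>i<6. x i *\<^sub>R crd (unit_vec i)) \<in> (\<Pi>\<^sub>M i\<in>{..<6::nat}. lborel) \<rightarrow>\<^sub>M borel"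
  proof (intro borel_measurable_sum borel_measurable_scaleR borel_measurable_const)
    fix i :: nat assume "i \<in> {..<6}"
    then have "(\<lambda>x. x i) \<in> (\<Pi>\<^sub>M i\<in>{..<6::nat}. lborel) \<rightarrow>\<^sub>M (lborel :: real measure)" by (rule measurable_component_singleton)
    then show "(\<lambda>x. x i) \<in> borel_measurable (\<Pi>\<^sub>M i\<in>{..<6::nat}. (lborel :: real measure))" by simp
  qed
  then show ?thesis by (simp only: crd_sum[symmetric])
qed

text \<open>
  Both measures agree on boxes, since the coordinates are those with respect to the standard basis.
\<close>

lemma lborel_eq_distr_crd: "lborel = distr (\<Pi>\<^sub>M i\<in>{..<6}. lborel) borel crd"
proof (rule lborel_eqI)
  interpret product_sigma_finite "\<lambda>_::nat. lborel :: real measure" ..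
  fix l u :: "hpair" assume lu: "\<And>b. b \<in> Basis \<Longrightarrow> l \<bullet> b \<le> u \<bullet> b"
  have Bs: "(Basis :: (hpair) set) = (\<lambda>i. crd (unit_vec i)) ` {..<6}"
    by (rule bij_betw_imp_surj_on[OF Basis_coords, symmetric])
  have box: "x \<in> box l u \<longleftrightarrow> (\<forall>i<6. emb l i < emb x i \<and> emb x i < emb u i)" for x
  proof -
    have "x \<in> box l u \<longleftrightarrow> (\<forall>b\<in>(\<lambda>i. crd (unit_vec i)) ` {..<6}. l \<bullet> b < x \<bullet> b \<and> x \<bullet> b < u \<bullet> b)"
      unfolding mem_box Bs by (rule refl)
    also have "\<dots> \<longleftrightarrow> (\<forall>i\<in>{..<6}. l \<bullet> crd (unit_vec i) < x \<bullet> crd (unit_vec i) \<and> x \<bullet> crd (unit_vec i) < u \<bullet> crd (unit_vec i))"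
      by (rule ball_simps)
    also have "\<dots> \<longleftrightarrow> (\<forall>i\<in>{..<6}. emb l i < emb x i \<and> emb x i < emb u i)"
      by (rule ball_cong) (simp_all add: emb_component)
    finally show ?thesis by blast
  qed
  have le: "emb l i \<le> emb u i" if "i < 6" for i
  proof -
    have "crd (unit_vec i) \<in> Basis" unfolding Bs using that by simp
    then show ?thesis using lu that by (simp add: emb_component)
  qed
  have "crd -` box l u \<inter> space (\<Pi>\<^sub>M i\<in>{..<6}. lborel) = (\<Pi>\<^sub>E i\<in>{..<6}. {emb l i<..<emb u i})"
  proof -
    have ec: "emb (crd x) i = x i" if "i < 6" for x i
    proof -
      from that consider "i = 0" | "i = 1" | "i = 2" | "i = 3" | "i = 4" | "i = 5" by linarith
      then show ?thesis by cases (simp_all add: emb_def crd_def)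
    qed
    have bx: "crd x \<in> box l u \<longleftrightarrow> (\<forall>i<6. emb l i < x i \<and> x i < emb u i)" for x
      unfolding box by (metis ec)
    show ?thesis
    proof (rule set_eqI)
      fix x
      show "x \<in> crd -` box l u \<inter> space (\<Pi>\<^sub>M i\<in>{..<6}. lborel) \<longleftrightarrow> x \<in> (\<Pi>\<^sub>E i\<in>{..<6}. {emb l i<..<emb u i})"
        unfolding Int_iff vimage_eq bx by (auto simp: space_PiM PiE_iff)
    qed
  qed
  then have "emeasure (distr (\<Pi>\<^sub>M i\<in>{..<6}. lborel) borel crd) (box l u) = emeasure (\<Pi>\<^sub>M i\<in>{..<6}. lborel) (\<Pi>\<^sub>E i\<in>{..<6}. {emb l i<..<emb u i})"
    using emeasure_distr[OF crd_measurable, of "box l u"] by simp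
  also have "\<dots> = (\<Prod>i<6. emeasure lborel {emb l i<..<emb u i})"
    by (rule emeasure_PiM) auto
  also have "\<dots> = (\<Prod>i<6. ennreal (emb u i - emb l i))"
    by (rule prod.cong) (auto simp: le)
  also have "\<dots> = ennreal (\<Prod>i<6. emb u i - emb l i)"
    by (rule prod_ennreal) (use le in auto)
  also have "(\<Prod>i<6. emb u i - emb l i) = (\<Prod>i<6. (u - l) \<bullet> crd (unit_vec i))"
    by (rule prod.cong) (auto simp: emb_component inner_diff_left)
  also have "\<dots> = (\<Prod>b\<in>Basis. (u - l) \<bullet> b)"
    by (rule prod.reindex_bij_betw[OF Basis_coords])
  finally show "emeasure (distr (\<Pi>\<^sub>M i\<in>{..<6}. lborel) borel crd) (box l u) = (\<Prod>b\<in>Basis. (u - l) \<bullet> b)" .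
qed simp

lemma embed_eq: "embed 6 x = emb (crd x)"
proof
  fix i :: nat
  consider "i = 0" | "i = 1" | "i = 2" | "i = 3" | "i = 4" | "i = 5" | "i \<ge> 6" by linarith
  then show "embed 6 x i = emb (crd x) i" by cases (simp_all add: embed_def emb_def crd_def)
qed

lemma haar_emb_image:
  assumes S: "compact S"
  shows "emb ` S \<in> sets (haar G0)" "emeasure (haar G0) (emb ` S) = ennreal (measure lborel S)"
proof -
  have "continuous_on UNIV (\<lambda>x. \<Sum>i<6. x i *\<^sub>R crd (unit_vec i))"
    by (intro continuous_on_sum continuous_on_scaleR continuous_on_const continuous_on_product_coordinates)
  then have cont: "continuous_on UNIV crd" by (simp only: crd_sum[symmetric])
  have "emb ` S = (\<Inter>i\<in>{6..}. {x. x i = 0}) \<inter> crd -` S"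
  proof (intro set_eqI iffI)
    fix x assume "x \<in> (\<Inter>i\<in>{6..}. {x. x i = 0}) \<inter> crd -` S"
    then have "x \<in> alg G0" "crd x \<in> S" by (auto simp: alg_def topspace_Euclidean_space)
    then show "x \<in> emb ` S" using emb_crd by (metis image_eqI)
  qed (auto simp: emb_def[of _] crd_emb[unfolded emb_def])
  moreover have "closed ((\<Inter>i\<in>{6..}. {x::rvec. x i = 0}) \<inter> crd -` S)"
    by (intro closed_Int closed_INT ballI closed_Collect_eq closed_vimage compact_imp_closed[OF S] cont
        continuous_on_product_coordinates continuous_on_const)
  ultimately have b: "emb ` S \<in> sets borel" by (simp add: borel_closed)
  let ?M = "\<Pi>\<^sub>M i\<in>{..<6::nat}. (lborel :: real measure)"
  have SB: "S \<in> sets borel" by (rule borel_compact[OF S])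
  show "emb ` S \<in> sets (haar G0)" unfolding haar_def by (rule sets_completionI_sets) (simp add: b)
  have "emeasure (haar G0) (emb ` S) = emeasure (distr ?M borel (embed 6)) (emb ` S)"
    unfolding haar_def by (simp add: b)
  also have "\<dots> = emeasure ?M (embed 6 -` emb ` S \<inter> space ?M)"
    by (rule emeasure_distr[OF measurable_embed b])
  also have "embed 6 -` emb ` S = crd -` S" by (auto simp: embed_eq)
  also have "emeasure ?M (crd -` S \<inter> space ?M) = emeasure (distr ?M borel crd) S"
    by (rule emeasure_distr[OF crd_measurable SB, symmetric])
  also have "\<dots> = emeasure lborel S" by (simp only: lborel_eq_distr_crd[symmetric])
  also have "\<dots> = ennreal (measure lborel S)"
    using emeasure_compact_finite[OF S] by (intro emeasure_eq_ennreal_measure) (simp add: less_top)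
  finally show "emeasure (haar G0) (emb ` S) = ennreal (measure lborel S)" .
qed

section \<open>The curvature exponent\<close>

text \<open>
  The contraction property is tested at the identity with \<open>s = 1/2\<close> and \<open>A\<close> the set of endpoints of
  the geodesics of \<open>volume_drop\<close>.  Since the selected geodesics are the only minimisers between their
  ends, the contracted set consists of midpoints of these same geodesics.  So
  \<open>(1/2)\<^sup>N \<le> \<rho> (1/2)\<^sup>1\<^sup>0\<close>.
\<close>

lemma MCP0_exponent_bound: "\<exists>c>10. \<forall>N. MCP0 G0 N \<longrightarrow> c \<le> N"
proof -
  obtain \<theta> \<rho> r where th: "0 < \<theta>" "\<theta> \<le> 1/16" and \<rho>: "0 < \<rho>" "\<rho> < 1" and r: "0 < r" "r \<le> 1/4"
    and cA: "compact ((\<lambda>p. disp p (- \<theta>) \<theta>) ` cball base r)" and cZ: "compact ((\<lambda>p. disp p (- \<theta>) 0) ` cball base r)"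
    and posA: "0 < measure lborel ((\<lambda>p. disp p (- \<theta>) \<theta>) ` cball base r)"
    and drop: "measure lborel ((\<lambda>p. disp p (- \<theta>) 0) ` cball base r) \<le> (1/2) ^ 10 * \<rho> * measure lborel ((\<lambda>p. disp p (- \<theta>) \<theta>) ` cball base r)"
    by (rule volume_drop)
  define SA SZ where "SA = (\<lambda>p. disp p (- \<theta>) \<theta>) ` cball base r" and "SZ = (\<lambda>p. disp p (- \<theta>) 0) ` cball base r"
  have geo: "min_geodesic G0 (geo \<theta> p)" if p: "p \<in> cball base r" for p
  proof (rule min_geodesic_geo[OF th(1)])
    have "norm (snd base - snd p) \<le> 1/4" using norm_snd_diff_le[of base p] p r by (simp add: dist_norm)
    moreover have "norm (snd base) = 1" by (simp add: base_def)
    ultimately have "norm (snd p) \<le> 5/4" using norm_triangle_ineq2[of "snd p" "snd base"] by (simp add: norm_minus_commute)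
    then have "8 * \<theta> * norm (snd p) \<le> 8 * (1/16) * (5/4)" using th by (intro mult_mono) auto
    then show "8 * \<theta> * norm (snd p) \<le> 1" by simp
  qed
  show ?thesis
  proof (intro exI[of _ "10 - log 2 \<rho>"] conjI allI impI)
    show "10 - log 2 \<rho> > 10" using \<rho> by simp
    fix N assume "MCP0 G0 N"
    then obtain C \<Phi> where sel: "geodesic_selection G0 C \<Phi>"
      and mcp: "\<forall>p\<in>alg G0. \<forall>A\<in>sets (haar G0). A \<subseteq> alg G0 \<and> 0 < emeasure (haar G0) A \<and> emeasure (haar G0) A < \<infinity> \<longrightarrow>
        (\<forall>s\<in>{0..1}. outer_measure_of (haar G0) (Zset C \<Phi> s p A) \<ge> ennreal (s powr N) * emeasure (haar G0) A)"
      unfolding MCP0_def by blast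
    have 0: "0 \<in> alg G0" using emb_in_alg[of 0] by simp
    have Z: "Zset C \<Phi> (1/2) 0 (emb ` SA) \<subseteq> emb ` SZ"
    proof
      fix x assume "x \<in> Zset C \<Phi> (1/2) 0 (emb ` SA)"
      then obtain y where y: "y \<in> emb ` SA" "y \<notin> C 0" "x = \<Phi> 0 y (1/2)" by (auto simp: Zset_def)
      then obtain p where p: "p \<in> cball base r" "y = emb (disp p (- \<theta>) \<theta>)" by (auto simp: SA_def)
      have "y \<in> alg G0 - C 0" using y(2) p(2) by simp
      then have "\<forall>\<gamma>. min_geodesic G0 \<gamma> \<and> \<gamma> 0 = 0 \<and> \<gamma> 1 = y \<longrightarrow> (\<forall>t\<in>{0..1}. \<gamma> t = \<Phi> 0 y t)"
        using sel 0 unfolding geodesic_selection_def by blast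
      then have "min_geodesic G0 (geo \<theta> p) \<and> geo \<theta> p 0 = 0 \<and> geo \<theta> p 1 = y \<longrightarrow> (\<forall>t\<in>{0..1}. geo \<theta> p t = \<Phi> 0 y t)"
        by (rule spec)
      moreover have "min_geodesic G0 (geo \<theta> p) \<and> geo \<theta> p 0 = 0 \<and> geo \<theta> p 1 = y"
        by (intro conjI geo[OF p(1)]) (simp_all add: geo_ends p(2))
      ultimately have "\<forall>t\<in>{0..1}. geo \<theta> p t = \<Phi> 0 y t" by (rule mp)
      then have "x = geo \<theta> p (1/2)" using y(3) by simp
      then show "x \<in> emb ` SZ" using p(1) by (auto simp: geo_ends SZ_def)
    qed
    note hA = haar_emb_image[OF cA, folded SA_def] and hZ = haar_emb_image[OF cZ, folded SZ_def]
    have "emb ` SA \<subseteq> alg G0" by auto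
    moreover have "0 < emeasure (haar G0) (emb ` SA)" "emeasure (haar G0) (emb ` SA) < \<infinity>"
      using posA by (simp_all add: hA(2) SA_def[symmetric])
    moreover have "(1/2::real) \<in> {0..1}" by simp
    ultimately have "ennreal ((1/2) powr N) * emeasure (haar G0) (emb ` SA) \<le> outer_measure_of (haar G0) (Zset C \<Phi> (1/2) 0 (emb ` SA))"
      using mcp 0 hA(1) by blast
    also have "\<dots> \<le> outer_measure_of (haar G0) (emb ` SZ)" by (rule outer_measure_of_mono[OF Z])
    also have "\<dots> = ennreal (measure lborel SZ)" using hZ by simp
    finally have "ennreal ((1/2) powr N * measure lborel SA) \<le> ennreal (measure lborel SZ)"
      by (simp add: hA(2) ennreal_mult')
    then have "(1/2) powr N * measure lborel SA \<le> measure lborel SZ" by (simp add: ennreal_le_iff)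
    also have "\<dots> \<le> (1/2) ^ 10 * \<rho> * measure lborel SA" using drop by (simp add: SA_def SZ_def)
    finally have le: "(1/2) powr N \<le> (1/2) ^ 10 * \<rho>"
      using posA by (simp add: SA_def[symmetric])
    have "2 powr (- N) = (1/2) powr N" by (simp add: powr_divide powr_minus_divide)
    also have "\<dots> \<le> 2 powr (-10 + log 2 \<rho>)"
    proof -
      have "2 powr (-10 + log 2 \<rho>) = 2 powr (-10) * 2 powr log 2 \<rho>" by (rule powr_add)
      also have "2 powr log 2 \<rho> = \<rho>" using \<rho> by simp
      also have "(2::real) powr (-10) = (1/2) ^ 10" by (simp add: powr_minus power_one_over)
      finally show ?thesis using le by simp
    qed
    finally have "- N \<le> -10 + log 2 \<rho>" by simp
    then show "10 - log 2 \<rho> \<le> N" by simp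
  qed
qed

theorem theorem15:
  shows "\<exists>G. step_two_carnot G \<and> ideal_group G \<and> N_CE G > N_zero G"
proof (intro exI[of _ G0] conjI step_two_carnot_G0 ideal_group_G0)
  obtain c where c: "c > 10" "\<forall>N. MCP0 G0 N \<longrightarrow> c \<le> N" using MCP0_exponent_bound by blast
  have "ereal c \<le> N_CE G0" unfolding N_CE_def by (rule Inf_greatest) (use c(2) in auto)
  moreover have "(10::ereal) < ereal c" using c(1) by simp
  ultimately show "N_CE G0 > N_zero G0" using N_zero_G0 by (meson less_le_trans le_less_trans)
qed

end
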